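(* If $K$ and $L$ are unconditional convex bodies in $\mathbb{R}^n$ with respect to the same orthonormal basis and $\lambda\in(0,1)$, then $$V((1-\lambda)\cdot K +_0 \lambda\cdot L)= V(K)^{1-\lambda}\, V(L)^\lambda$$ holds if and only if $K=K_1\oplus\ldots \oplus K_m$ and $L=L_1\oplus\ldots \oplus L_m$ for some $m\geq 1$ and unconditional compact convex sets $K_1,\ldots, K_m,L_1,\ldots,L_m$ of dimension at least one, where $\sum_{i=1}^m\dim K_i=n$ and $K_i$ and $L_i$ are dilates for $i=1,\ldots,m$.
   Context: A convex body in $\mathbb{R}^n$ is a compact convex set with non-empty interior; $V$ is $n$-dimensional Lebesgue measure. A set $X$ is unconditional with respect to a fixed orthonormal basis $e_1,\ldots,e_n$ if it is symmetric through each coordinate hyperplane $e_i^\perp$, i.e. $(x_1,\ldots,x_n)\in X$ implies $(\pm x_1,\ldots,\pm x_n)\in X$; all unconditional sets in the claim are with respect to the same basis. $K_1\oplus\ldots\oplus K_m$ denotes the Minkowski sum of compact convex sets whose affine hulls are pairwise orthogonal. $M$ and $N$ are dilates if $N=cM$ for some $c>0$. The support function of a compact convex set $K$ is $h_K(u)=\max\{\langle u,y\rangle: y\in K\}$. For convex bodies $K,L$ with the origin in their interiors, the $L_0$-sum is $$(1-\lambda)\cdot K+_0\lambda\cdot L=\{x\in\mathbb{R}^n:\langle x,u\rangle\leq h_K(u)^{1-\lambda}h_L(u)^{\lambda}\ \ \forall u\in S^{n-1}\}.$$ *)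

theory Defs
  imports "HOL-Analysis.Analysis"
begin

text \<open>No spanning condition is needed: \<open>CARD('n)\<close> orthonormal vectors form a basis.\<close>

definition orthonormal_basis :: "('n::finite \<Rightarrow> real^'n) \<Rightarrow> bool" where
  "orthonormal_basis e \<longleftrightarrow> (\<forall>i j. e i \<bullet> e j = (if i = j then 1 else 0))"

text \<open>
  For a unit vector \<open>v\<close> this is the reflection in the hyperplane \<open>v\<^sup>\<bottom>\<close>; for \<open>v = e i\<close> it changes the sign
  of the \<open>i\<close>-th coordinate with respect to \<open>e\<close>.
\<close>

definition hyperplane_reflection :: "'a::real_inner \<Rightarrow> 'a \<Rightarrow> 'a" where
  "hyperplane_reflection v x = x - (2 * (x \<bullet> v)) *\<^sub>R v"

definition unconditional :: "('n::finite \<Rightarrow> real^'n) \<Rightarrow> (real^'n) set \<Rightarrow> bool" where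
  "unconditional e X \<longleftrightarrow> (\<forall>i. \<forall>x\<in>X. hyperplane_reflection (e i) x \<in> X)"

definition convex_body :: "'a::euclidean_space set \<Rightarrow> bool" where
  "convex_body K \<longleftrightarrow> compact K \<and> convex K \<and> interior K \<noteq> {}"

text \<open>The supremum is attained whenever \<open>K\<close> is compact and nonempty.\<close>

definition support_function :: "'a::euclidean_space set \<Rightarrow> 'a \<Rightarrow> real" where
  "support_function K u = (SUP y\<in>K. u \<bullet> y)"

text \<open>
  The \<open>L\<^sub>0\<close>-sum \<open>(1 - t) \<cdot> K +\<^sub>0 t \<cdot> L\<close>, meant for convex bodies with the origin in their
  interiors, so that both support functions are positive on the sphere. Unconditional
  convex bodies satisfy this.
\<close>

definition L0_sum :: "real \<Rightarrow> 'a::euclidean_space set \<Rightarrow> 'a set \<Rightarrow> 'a set" where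
  "L0_sum t K L =
     {x. \<forall>u\<in>sphere 0 1. x \<bullet> u \<le> support_function K u powr (1 - t) * support_function L u powr t}"

text \<open>Two affine subspaces are orthogonal if their direction spaces are.\<close>

definition orthogonal_affine :: "'a::euclidean_space set \<Rightarrow> 'a set \<Rightarrow> bool" where
  "orthogonal_affine A B \<longleftrightarrow> (\<forall>x\<in>A. \<forall>y\<in>A. \<forall>z\<in>B. \<forall>w\<in>B. orthogonal (x - y) (z - w))"

text \<open>\<open>S = X\<^sub>1 \<oplus> \<dots> \<oplus> X\<^sub>m\<close>; addition of sets is the Minkowski sum.\<close>

definition is_orthogonal_sum :: "nat \<Rightarrow> (nat \<Rightarrow> 'a::euclidean_space set) \<Rightarrow> 'a set \<Rightarrow> bool" where
  "is_orthogonal_sum m X S \<longleftrightarrow>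
     pairwise (\<lambda>i j. orthogonal_affine (affine hull X i) (affine hull X j)) {1..m} \<and>
     S = (\<Sum>i=1..m. X i)"

definition dilates :: "'a::real_vector set \<Rightarrow> 'a set \<Rightarrow> bool" where
  "dilates M N \<longleftrightarrow> (\<exists>c>0. N = (\<lambda>x. c *\<^sub>R x) ` M)"

end

theory Submission
  imports Defs "HOL-Probability.Weak_Convergence"
begin

text \<open>
  Write \<open>x\<^sub>i\<close> for the coordinates with respect to \<open>e\<close>. By Hoelder the \<open>L\<^sub>0\<close>-sum contains every point with
  \<open>\<bar>z\<^sub>i\<bar> = \<bar>x\<^sub>i\<bar> powr (1 - t) * \<bar>y\<^sub>i\<bar> powr t\<close>, \<open>x \<in> K\<close>, \<open>y \<in> L\<close>, so the Prekopa-Leindler inequality in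
  logarithmic coordinates bounds its volume from below.

  Suppose equality holds, and let \<open>w = \<Prod>i. \<bar>x\<^sub>i\<bar> powr l\<^sub>i\<close> be a monomial with \<open>l\<^sub>i \<ge> 0\<close>. Applying the inequality
  to the sublevel sets of \<open>w\<close> shows that the quantile function of \<open>w\<close> on the \<open>L\<^sub>0\<close>-sum is at most the geometric
  mean of its quantile functions on \<open>K\<close> and \<open>L\<close>; applying it with the weight \<open>w\<close> bounds the mean of \<open>w\<close>
  from below by the geometric mean of the means. This is an equality case of Hoelder, so the distributions
  of \<open>w\<close> on \<open>K\<close> and on \<open>L\<close> agree up to a factor \<open>c l\<close>, which is also the ratio of the suprema of \<open>w\<close>.
  Since equality persists for the weighted volumes, \<open>c\<close> is multiplicative, \<open>c l = \<Prod>i. d\<^sub>i powr l\<^sub>i\<close>, and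
  separation in logarithmic coordinates gives that \<open>L\<close> is the image of \<open>K\<close> under the diagonal map \<open>d\<close>.

  For such \<open>L\<close> the volume equality says that the \<open>L\<^sub>0\<close>-sum is the image of \<open>K\<close> under the diagonal map
  with entries \<open>d\<^sub>i powr t\<close>. The equality case of the finite Hoelder inequality turns this into the splitting
  of \<open>K\<close> along the level sets of \<open>d\<close>; the values of \<open>d\<close> are the dilation factors.
\<close>

section \<open>Geometric means and the one-dimensional Brunn-Minkowski inequality\<close>

text \<open>The equality case of Prekopa-Leindler in several dimensions is never analysed. Only the
  inequality is used, but for a whole family of weights and sets, and equality is analysed once, for
  distributions on the positive half-line. Monomials are the natural family: the weight of a
  coordinatewise geometric mean is the geometric mean of the weights, so weighted volumes and
  sublevel sets both fit the inequality. In logarithmic coordinates a monomial is the exponential of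
  a linear functional, so its supremum over a body records the support function of the logarithmic
  image. A diagonal map is a translation there and changes that support function by a linear term,
  which is why multiplicativity of \<open>c\<close> is the goal. Exponents can be taken nonnegative
  because the logarithmic image is downward closed; this also keeps the weights bounded on bounded
  sets.

  Both directions of the theorem meet in \<open>level_split\<close>, which expresses the splitting
  without choosing summands. A decomposition is not unique: summands with the same dilation factor
  can be merged.\<close>

lemma weighted_am_gm:
  fixes a b t :: real
  assumes "0 \<le> a" "0 \<le> b" "0 < t" "t < 1"
  shows "a powr (1 - t) * b powr t \<le> (1 - t) * a + t * b"
proof (cases "a = 0 \<or> b = 0")
  case True
  then show ?thesis using assms by auto
next
  case False
  then show ?thesis using Youngs_inequality_0[of "1 - t" t a b] assms by simp
qed

text \<open>After division by the common value \<open>m\<close>, the weighted averages of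
  \<open>ln\<close> and of its tangent x - 1 at 1 both vanish. Hence the tangent bound is an
  equality in each term, which happens only at 1.\<close>

lemma weighted_am_gm_eq:
  fixes a b t :: real
  assumes ab: "0 < a" "0 < b" and t: "0 < t" "t < 1"
    and eq: "a powr (1 - t) * b powr t = (1 - t) * a + t * b"
  shows "a = b"
proof -
  define m where "m = (1 - t) * a + t * b"
  have m: "m > 0" unfolding m_def using ab t by (intro add_pos_pos mult_pos_pos) auto
  have "ln m = ln (a powr (1 - t) * b powr t)" by (simp add: m_def eq)
  also have "\<dots> = (1 - t) * ln a + t * ln b" using ab by (simp add: ln_mult ln_powr)
  finally have lnm: "ln m = (1 - t) * ln a + t * ln b" .
  define A B where "A = a / m" and "B = b / m"
  have AB: "A > 0" "B > 0" using ab m by (simp_all add: A_def B_def)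
  have "(1 - t) * ln A + t * ln B = (1 - t) * ln a + t * ln b - ln m"
    using ab m by (simp add: A_def B_def ln_div algebra_simps)
  then have s0: "(1 - t) * ln A + t * ln B = 0" using lnm by simp
  have "((1 - t) * a + t * b) / m = 1" using m by (simp add: m_def)
  then have s1: "(1 - t) * (A - 1) + t * (B - 1) = 0"
    unfolding A_def B_def using m by (simp only: add_divide_distrib) (simp add: algebra_simps)
  have "(1 - t) * ln A \<le> (1 - t) * (A - 1)" "t * ln B \<le> t * (B - 1)"
    using AB t by (auto intro!: mult_left_mono ln_le_minus_one)
  then have "(1 - t) * ln A = (1 - t) * (A - 1)" "t * ln B = t * (B - 1)"
    using s0 s1 by linarith+
  then have "ln A = A - 1" "ln B = B - 1" using t by auto
  then have "A = 1" "B = 1" using ln_eq_minus_one AB by auto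
  then show ?thesis using m by (simp add: A_def B_def)
qed

lemma geometric_mean_normalize:
  fixes x y P Q t :: real
  assumes "0 \<le> x" "0 \<le> y" "0 < P" "0 < Q"
  shows "x powr (1 - t) * y powr t = P powr (1 - t) * Q powr t * ((x / P) powr (1 - t) * (y / Q) powr t)"
proof -
  have "x powr (1 - t) = P powr (1 - t) * (x / P) powr (1 - t)"
    "y powr t = Q powr t * (y / Q) powr t"
    using assms by (simp_all add: powr_mult[symmetric])
  then show ?thesis by (simp only: mult_ac)
qed

text \<open>Dividing by the totals \<open>P\<close> and \<open>Q\<close> reduces this to AM-GM in
  each term, and the arithmetic means then add up to 1.\<close>

lemma holder_sum:
  fixes p q :: "'i \<Rightarrow> real"
  assumes fin: "finite I" and t: "0 < t" "t < 1" and nn: "\<And>i. i \<in> I \<Longrightarrow> 0 \<le> p i" "\<And>i. i \<in> I \<Longrightarrow> 0 \<le> q i"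
  shows "(\<Sum>i\<in>I. p i powr (1 - t) * q i powr t) \<le> (\<Sum>i\<in>I. p i) powr (1 - t) * (\<Sum>i\<in>I. q i) powr t"
proof -
  define P Q where "P = (\<Sum>i\<in>I. p i)" and "Q = (\<Sum>i\<in>I. q i)"
  have PQ: "P \<ge> 0" "Q \<ge> 0" using nn by (auto simp: P_def Q_def intro: sum_nonneg)
  show ?thesis
  proof (cases "P = 0 \<or> Q = 0")
    case True
    then have "(\<forall>i\<in>I. p i = 0) \<or> (\<forall>i\<in>I. q i = 0)"
      using nn fin by (auto simp: P_def Q_def sum_nonneg_eq_0_iff)
    then have "(\<Sum>i\<in>I. p i powr (1 - t) * q i powr t) = 0" by (intro sum.neutral) auto
    then show ?thesis by (simp add: P_def[symmetric] Q_def[symmetric])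
  next
    case False
    then have pos: "P > 0" "Q > 0" using PQ by auto
    have "(\<Sum>i\<in>I. p i powr (1 - t) * q i powr t)
        = P powr (1 - t) * Q powr t * (\<Sum>i\<in>I. (p i / P) powr (1 - t) * (q i / Q) powr t)"
      unfolding sum_distrib_left using pos nn
      by (intro sum.cong geometric_mean_normalize) auto
    also have "\<dots> \<le> P powr (1 - t) * Q powr t * (\<Sum>i\<in>I. (1 - t) * (p i / P) + t * (q i / Q))"
      using pos nn t by (intro mult_left_mono sum_mono weighted_am_gm) auto
    also have "(\<Sum>i\<in>I. (1 - t) * (p i / P) + t * (q i / Q)) = 1"
      using pos by (simp add: sum.distrib sum_distrib_left[symmetric] sum_divide_distrib[symmetric]
          P_def[symmetric] Q_def[symmetric])
    finally show ?thesis by (simp add: P_def Q_def)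
  qed
qed

text \<open>In normalized form the AM-GM defects are nonnegative and have sum 0, so each of them
  vanishes. Positivity at \<open>j\<close> makes the equality case of AM-GM applicable
  there.\<close>

lemma holder_sum_eq:
  fixes p q :: "'i \<Rightarrow> real"
  assumes fin: "finite I" and t: "0 < t" "t < 1" and nn: "\<And>i. i \<in> I \<Longrightarrow> 0 \<le> p i" "\<And>i. i \<in> I \<Longrightarrow> 0 \<le> q i"
    and eq: "(\<Sum>i\<in>I. p i powr (1 - t) * q i powr t) = (\<Sum>i\<in>I. p i) powr (1 - t) * (\<Sum>i\<in>I. q i) powr t"
    and j: "j \<in> I" "p j > 0" "q j > 0"
  shows "p j / (\<Sum>i\<in>I. p i) = q j / (\<Sum>i\<in>I. q i)"
proof -
  define P Q where "P = (\<Sum>i\<in>I. p i)" and "Q = (\<Sum>i\<in>I. q i)"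
  have pos: "P > 0" "Q > 0" using nn fin j by (auto simp: P_def Q_def intro: sum_pos2)
  have le: "(p i / P) powr (1 - t) * (q i / Q) powr t \<le> (1 - t) * (p i / P) + t * (q i / Q)"
    if "i \<in> I" for i using pos nn t that by (intro weighted_am_gm) auto
  have "(\<Sum>i\<in>I. p i powr (1 - t) * q i powr t)
      = P powr (1 - t) * Q powr t * (\<Sum>i\<in>I. (p i / P) powr (1 - t) * (q i / Q) powr t)"
    unfolding sum_distrib_left using pos nn
    by (intro sum.cong geometric_mean_normalize) auto
  with eq have "(\<Sum>i\<in>I. (p i / P) powr (1 - t) * (q i / Q) powr t) = 1"
    using pos by (simp add: P_def[symmetric] Q_def[symmetric])
  moreover have "(\<Sum>i\<in>I. (1 - t) * (p i / P) + t * (q i / Q)) = 1"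
    using pos by (simp add: sum.distrib sum_distrib_left[symmetric] sum_divide_distrib[symmetric]
        P_def[symmetric] Q_def[symmetric])
  ultimately have s: "(\<Sum>i\<in>I. ((1 - t) * (p i / P) + t * (q i / Q)) - (p i / P) powr (1 - t) * (q i / Q) powr t) = 0"
    by (simp add: sum_subtractf)
  have "((1 - t) * (p j / P) + t * (q j / Q)) - (p j / P) powr (1 - t) * (q j / Q) powr t = 0"
    by (rule sum_nonneg_0[OF fin _ s j(1)]) (use le in simp)
  then have "(p j / P) powr (1 - t) * (q j / Q) powr t = (1 - t) * (p j / P) + t * (q j / Q)"
    by linarith
  then have "p j / P = q j / Q"
    by (rule weighted_am_gm_eq[OF _ _ t, rotated -1]) (use pos j in simp_all)
  then show ?thesis by (simp add: P_def Q_def)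
qed

lemma emeasure_lborel_affine_image:
  fixes A :: "real set"
  assumes c: "c > 0" and A: "A \<in> sets borel"
  shows "(\<lambda>x. c * x + d) ` A \<in> sets borel"
    and "emeasure lborel ((\<lambda>x. c * x + d) ` A) = ennreal c * emeasure lborel A"
proof -
  have im: "(\<lambda>x. c * x + d) ` A = (\<lambda>y. (y - d) / c) -` A"
  proof (intro set_eqI iffI)
    fix y assume "y \<in> (\<lambda>y. (y - d) / c) -` A"
    then show "y \<in> (\<lambda>x. c * x + d) ` A" using c by (intro image_eqI[of _ _ "(y - d) / c"]) auto
  qed (use c in auto)
  have m: "(\<lambda>y. (y - d) / c) \<in> borel_measurable borel" by measurable
  show S: "(\<lambda>x. c * x + d) ` A \<in> sets borel"
    unfolding im using measurable_sets[OF m A] by simp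
  have "emeasure lborel ((\<lambda>x. c * x + d) ` A) = (\<integral>\<^sup>+x. indicator ((\<lambda>x. c * x + d) ` A) x \<partial>lborel)"
    using S by simp
  also have "\<dots> = \<bar>c\<bar> * (\<integral>\<^sup>+x. indicator ((\<lambda>x. c * x + d) ` A) (d + c * x) \<partial>lborel)"
    using S c by (intro nn_integral_real_affine) auto
  also have "(\<lambda>x. indicator ((\<lambda>x. c * x + d) ` A) (d + c * x)) = (indicator A :: real \<Rightarrow> ennreal)"
    using c by (auto simp: fun_eq_iff indicator_def image_iff add.commute)
  finally show "emeasure lborel ((\<lambda>x. c * x + d) ` A) = ennreal c * emeasure lborel A"
    using A c by simp
qed

text \<open>Two translates of the scaled sets, one to the left and one to the right of a common
  point, fit into the Minkowski combination.\<close>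

lemma brunn_minkowski_real_compact:
  fixes A B C :: "real set"
  assumes A: "compact A" "A \<noteq> {}" and B: "compact B" "B \<noteq> {}" and C: "C \<in> sets borel"
    and t: "0 < t" "t < 1"
    and sub: "\<And>a b. a \<in> A \<Longrightarrow> b \<in> B \<Longrightarrow> (1 - t) * a + t * b \<in> C"
  shows "ennreal (1 - t) * emeasure lborel A + ennreal t * emeasure lborel B \<le> emeasure lborel C"
proof -
  obtain a1 where a1: "a1 \<in> A" "\<And>a. a \<in> A \<Longrightarrow> a \<le> a1" using compact_attains_sup[OF A] by blast
  obtain b0 where b0: "b0 \<in> B" "\<And>b. b \<in> B \<Longrightarrow> b0 \<le> b" using compact_attains_inf[OF B] by blast
  have bor: "A \<in> sets borel" "B \<in> sets borel" using A B by (auto intro: borel_compact)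
  let ?z = "(1 - t) * a1 + t * b0"
  let ?A = "(\<lambda>x. (1 - t) * x + t * b0) ` A" and ?B = "(\<lambda>x. t * x + (1 - t) * a1) ` B"
  have mA: "?A \<in> sets borel" "emeasure lborel ?A = ennreal (1 - t) * emeasure lborel A"
    and mB: "?B \<in> sets borel" "emeasure lborel ?B = ennreal t * emeasure lborel B"
    using emeasure_lborel_affine_image[of "1 - t" A "t * b0"]
      emeasure_lborel_affine_image[of t B "(1 - t) * a1"] t bor by simp_all
  have le: "x \<le> ?z" if "x \<in> ?A" for x using that a1 t by auto
  have ge: "?z \<le> x" if "x \<in> ?B" for x using that b0 t by auto
  have "?A \<inter> ?B \<subseteq> {?z}" 
  proof
    fix x assume "x \<in> ?A \<inter> ?B"
    then have "x \<le> ?z" "?z \<le> x" using le ge by blast+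
    then show "x \<in> {?z}" by simp
  qed
  then have "emeasure lborel (?A \<inter> ?B) \<le> emeasure lborel {?z}" by (intro emeasure_mono) auto
  then have "emeasure lborel (?A \<inter> ?B) = 0" by simp
  then have "emeasure lborel ?A + emeasure lborel ?B = emeasure lborel (?A \<union> ?B)"
    using mA mB emeasure_Un_Int[of ?A lborel ?B] by auto
  also have "\<dots> \<le> emeasure lborel C"
  proof (rule emeasure_mono)
    have "(1 - t) * a + t * b0 \<in> C" if "a \<in> A" for a using sub[OF that b0(1)] .
    moreover have "t * b + (1 - t) * a1 \<in> C" if "b \<in> B" for b
      using sub[OF a1(1) that] by (simp only: add.commute)
    ultimately show "?A \<union> ?B \<subseteq> C" by blast
  qed (use C in simp)
  finally show ?thesis unfolding mA(2) mB(2) .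
qed

lemma bounded_borel_inner_compact:
  fixes A :: "real set"
  assumes A: "A \<in> sets borel" "bounded A" "A \<noteq> {}" and e: "e > 0"
  obtains S where "compact S" "S \<noteq> {}" "S \<subseteq> A" "emeasure lborel A \<le> emeasure lborel S + ennreal e"
proof -
  obtain T where T: "closed T" "T \<subseteq> A" "emeasure lebesgue (A - T) < ennreal e"
    using sets_lebesgue_inner_closed[of A e thesis] A e by auto
  obtain a where a: "a \<in> A" using A by auto
  \<comment> \<open>The closed inner set \<open>T\<close> may be empty; the extra point secures the
    nonemptiness that the compact case asks for.\<close>
  define S where "S = insert a T"
  have S: "compact S" "S \<noteq> {}" "S \<subseteq> A" "T \<subseteq> S"
    using T a A bounded_subset[OF \<open>bounded A\<close>] by (auto simp: S_def compact_eq_bounded_closed)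
  have Sb: "S \<in> sets borel" using S by (auto intro: borel_compact)
  have "emeasure lborel (A - S) = emeasure lebesgue (A - S)" using A Sb by simp
  also have "\<dots> \<le> emeasure lebesgue (A - T)" using S T A by (intro emeasure_mono) (auto intro!: sets_completionI_sets)
  also have "\<dots> \<le> ennreal e" using T by simp
  finally have 1: "emeasure lborel (A - S) \<le> ennreal e" .
  have "emeasure lborel A = emeasure lborel (S \<union> (A - S))" using S by (simp add: Un_absorb1)
  also have "\<dots> \<le> emeasure lborel S + emeasure lborel (A - S)"
    using A Sb by (intro emeasure_subadditive) auto
  also have "\<dots> \<le> emeasure lborel S + ennreal e" using 1 by (intro add_left_mono)
  finally show ?thesis using S that by blast
qed

lemma brunn_minkowski_real:
  fixes A B C :: "real set"
  assumes A: "A \<in> sets borel" "bounded A" "A \<noteq> {}" and B: "B \<in> sets borel" "bounded B" "B \<noteq> {}"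
    and C: "C \<in> sets borel"
    and t: "0 < t" "t < 1"
    and sub: "\<And>a b. a \<in> A \<Longrightarrow> b \<in> B \<Longrightarrow> (1 - t) * a + t * b \<in> C"
  shows "ennreal (1 - t) * emeasure lborel A + ennreal t * emeasure lborel B \<le> emeasure lborel C"
proof (rule ennreal_le_epsilon)
  fix e :: real assume e: "e > 0"
  obtain S where S: "compact S" "S \<noteq> {}" "S \<subseteq> A" "emeasure lborel A \<le> emeasure lborel S + ennreal e"
    using bounded_borel_inner_compact[OF A e] .
  obtain T where T: "compact T" "T \<noteq> {}" "T \<subseteq> B" "emeasure lborel B \<le> emeasure lborel T + ennreal e"
    using bounded_borel_inner_compact[OF B e] .
  have "ennreal (1 - t) * emeasure lborel A + ennreal t * emeasure lborel B
      \<le> ennreal (1 - t) * (emeasure lborel S + ennreal e) + ennreal t * (emeasure lborel T + ennreal e)"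
    using S T by (intro add_mono mult_left_mono) auto
  also have "\<dots> = (ennreal (1 - t) * emeasure lborel S + ennreal t * emeasure lborel T)
      + (ennreal (1 - t) * ennreal e + ennreal t * ennreal e)"
    by (simp add: distrib_left ac_simps)
  also have "ennreal (1 - t) * ennreal e + ennreal t * ennreal e = ennreal e"
    using t e by (simp add: ennreal_mult[symmetric] ennreal_plus[symmetric] algebra_simps del: ennreal_plus)
  also have "ennreal (1 - t) * emeasure lborel S + ennreal t * emeasure lborel T \<le> emeasure lborel C"
    using S T sub by (intro brunn_minkowski_real_compact C t) auto
  finally show "ennreal (1 - t) * emeasure lborel A + ennreal t * emeasure lborel B \<le> emeasure lborel C + ennreal e"
    by (simp add: add_right_mono)
qed

section \<open>The Prekopa-Leindler inequality\<close>

text \<open>\<open>f x\<close> is the length of the set of levels \<open>s > 0\<close> below it,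
  including the value infinity; Fubini then exchanges the two integrations.\<close>

lemma layer_cake:
  fixes f :: "real \<Rightarrow> ennreal"
  assumes [measurable]: "f \<in> borel_measurable borel"
  shows "(\<integral>\<^sup>+x. f x \<partial>lborel) = (\<integral>\<^sup>+s. indicator {0<..} s * emeasure lborel {x. ennreal s < f x} \<partial>lborel)"
proof -
  have 1: "f x = (\<integral>\<^sup>+s. indicator {0<..} s * indicator {s. ennreal s < f x} s \<partial>lborel)" for x
  proof -
    have "(\<integral>\<^sup>+s. indicator {0<..} s * indicator {s. ennreal s < f x} s \<partial>lborel)
        = (\<integral>\<^sup>+s. indicator {s. 0 < s \<and> ennreal s < f x} s \<partial>lborel)"
      by (intro nn_integral_cong) (auto simp: indicator_def)
    also have "\<dots> = emeasure lborel {s. 0 < s \<and> ennreal s < f x}" by (subst nn_integral_indicator) auto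
    also have "\<dots> = f x"
    proof (cases "f x")
      case (real r)
      then have "{s. 0 < s \<and> ennreal s < f x} = {0<..<r}" by (auto simp: ennreal_less_iff)
      then show ?thesis using real by simp
    next
      case top
      then have "{s. 0 < s \<and> ennreal s < f x} = {0<..}" by auto
      moreover have "emeasure lborel {0::real<..} = top"
      proof (rule ccontr)
        assume "emeasure lborel {0::real<..} \<noteq> top"
        then obtain r where r: "emeasure lborel {0::real<..} = ennreal r" "r \<ge> 0"
          by (cases "emeasure lborel {0::real<..}") auto
        have "ennreal (r + 1) = emeasure lborel {0<..<r + 1}" using r by simp
        also have "\<dots> \<le> emeasure lborel {0::real<..}" by (intro emeasure_mono) auto
        finally show False using r by simp
      qed
      ultimately show ?thesis using top by simp
    qed
    finally show ?thesis by simp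
  qed
  have "(\<integral>\<^sup>+x. f x \<partial>lborel) = (\<integral>\<^sup>+x. (\<integral>\<^sup>+s. indicator {0<..} s * indicator {s. ennreal s < f x} s \<partial>lborel) \<partial>lborel)"
    using 1 by simp
  also have "\<dots> = (\<integral>\<^sup>+s. (\<integral>\<^sup>+x. indicator {0<..} s * indicator {s. ennreal s < f x} s \<partial>lborel) \<partial>lborel)"
    by (rule lborel_pair.Fubini') measurable
  also have "\<dots> = (\<integral>\<^sup>+s. indicator {0<..} s * emeasure lborel {x. ennreal s < f x} \<partial>lborel)"
  proof (intro nn_integral_cong)
    fix s :: real
    have "(\<integral>\<^sup>+x. indicator {0<..} s * indicator {s. ennreal s < f x} s \<partial>lborel)
       = indicator {0<..} s * (\<integral>\<^sup>+x. indicator {x. ennreal s < f x} x \<partial>lborel)"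
      by (subst nn_integral_cmult[symmetric]) (auto simp: indicator_def intro!: nn_integral_cong)
    then show "(\<integral>\<^sup>+x. indicator {0<..} s * indicator {s. ennreal s < f x} s \<partial>lborel)
       = indicator {0<..} s * emeasure lborel {x. ennreal s < f x}"
      by (subst (asm) nn_integral_indicator) auto
  qed
  finally show ?thesis .
qed

lemma geometric_mean_gt:
  fixes \<alpha> \<beta> s t :: real
  assumes "0 < s" "s < \<alpha>" "s < \<beta>" "0 < t" "t < 1"
  shows "s < \<alpha> powr (1 - t) * \<beta> powr t"
proof -
  have "s = s powr (1 - t) * s powr t" using assms by (simp add: powr_add[symmetric])
  also have "\<dots> < \<alpha> powr (1 - t) * \<beta> powr t"
    using assms by (intro mult_strict_mono powr_less_mono2) auto
  finally show ?thesis .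
qed

lemma geometric_mean_scale:
  fixes x y P Q t :: real
  assumes "0 \<le> x" "0 \<le> y" "0 \<le> P" "0 \<le> Q"
  shows "(P * x) powr (1 - t) * (Q * y) powr t = P powr (1 - t) * Q powr t * (x powr (1 - t) * y powr t)"
  using assms by (simp add: powr_mult mult_ac)

text \<open>Since both suprema equal 1, the superlevel sets of \<open>f\<close> and \<open>g\<close>
  are nonempty for the same levels \<open>s < 1\<close>. Brunn-Minkowski therefore applies level by
  level, and integration over \<open>s\<close> even yields an arithmetic mean. The hypothesis
  \<open>cond\<close> speaks of real lower bounds, a form that still makes sense where the functions
  are infinite.\<close>

lemma prekopa_leindler_real_normalized:
  fixes f g h :: "real \<Rightarrow> ennreal"
  assumes [measurable]: "f \<in> borel_measurable borel" "g \<in> borel_measurable borel" "h \<in> borel_measurable borel"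
    and t: "0 < t" "t < 1"
    and cond: "\<And>x y \<alpha> \<beta>. \<lbrakk>0 < \<alpha>; 0 < \<beta>; ennreal \<alpha> \<le> f x; ennreal \<beta> \<le> g y\<rbrakk>
      \<Longrightarrow> ennreal (\<alpha> powr (1 - t) * \<beta> powr t) \<le> h ((1 - t) * x + t * y)"
    and supp: "\<And>x. x \<notin> {-R..R} \<Longrightarrow> f x = 0" "\<And>x. x \<notin> {-R..R} \<Longrightarrow> g x = 0"
    and f1: "\<And>x. f x \<le> 1" "\<And>s. s < 1 \<Longrightarrow> \<exists>x. s < f x"
    and g1: "\<And>x. g x \<le> 1" "\<And>s. s < 1 \<Longrightarrow> \<exists>x. s < g x"
  shows "ennreal (1 - t) * (\<integral>\<^sup>+x. f x \<partial>lborel) + ennreal t * (\<integral>\<^sup>+x. g x \<partial>lborel) \<le> (\<integral>\<^sup>+x. h x \<partial>lborel)"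
proof -
  have lvl: "ennreal (1 - t) * (indicator {0<..} s * emeasure lborel {x. ennreal s < f x})
      + ennreal t * (indicator {0<..} s * emeasure lborel {x. ennreal s < g x})
      \<le> indicator {0<..} s * emeasure lborel {x. ennreal s < h x}" for s :: real
  proof (cases "0 < s \<and> s < 1")
    case True
    have bd: "bounded {x. ennreal s < k x}" if "\<And>x. x \<notin> {-R..R} \<Longrightarrow> k x = 0" for k :: "real \<Rightarrow> ennreal"
    proof (rule bounded_subset[of "{-R..R}"])
      show "{x. ennreal s < k x} \<subseteq> {-R..R}"
      proof
        fix x assume "x \<in> {x. ennreal s < k x}"
        then have "k x \<noteq> 0" by auto
        with that show "x \<in> {-R..R}" by blast
      qed
    qed simp
    have "ennreal s < 1" using True by (simp add: ennreal_less_one_iff)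
    then have ne: "{x. ennreal s < f x} \<noteq> {}" "{x. ennreal s < g x} \<noteq> {}" using f1(2) g1(2) by auto
    have "ennreal (1 - t) * emeasure lborel {x. ennreal s < f x} + ennreal t * emeasure lborel {x. ennreal s < g x}
      \<le> emeasure lborel {x. ennreal s < h x}"
    proof (rule brunn_minkowski_real[OF _ bd[OF supp(1)] ne(1) _ bd[OF supp(2)] ne(2) _ t])
      fix x y assume xy: "x \<in> {x. ennreal s < f x}" "y \<in> {x. ennreal s < g x}"
      obtain a where a: "f x = ennreal a" "a \<ge> 0"
        using f1(1)[of x] by (cases "f x") (auto simp: top_unique)
      obtain b where b: "g y = ennreal b" "b \<ge> 0"
        using g1(1)[of y] by (cases "g y") (auto simp: top_unique)
      have ab: "s < a" "s < b" using xy a b True by (auto simp: ennreal_less_iff)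
      have "s < a powr (1 - t) * b powr t" using geometric_mean_gt ab True t by blast
      then have "ennreal s < ennreal (a powr (1 - t) * b powr t)" using True by (simp add: ennreal_less_iff)
      also have "\<dots> \<le> h ((1 - t) * x + t * y)" using a b ab True by (intro cond) auto
      finally show "(1 - t) * x + t * y \<in> {x. ennreal s < h x}" by simp
    qed measurable
    then show ?thesis using True by simp
  next
    \<comment> \<open>Levels \<open>s \<le> 0\<close> are cut off by the indicator, and for
      \<open>s \<ge> 1\<close> the superlevel sets of \<open>f\<close> and \<open>g\<close> are
      empty.\<close>
    case False
    have "emeasure lborel {x. ennreal s < k x} = 0" if "\<And>x. k x \<le> 1" "s \<ge> 1" for k :: "real \<Rightarrow> ennreal"
    proof -
      have "(1::ennreal) \<le> ennreal s" using that(2) by simp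
      then have "{x. ennreal s < k x} = {}" using that(1) by (auto simp: not_less intro: order.trans[of _ 1])
      then show ?thesis by simp
    qed
    then show ?thesis using False f1(1) g1(1) by (cases "s \<ge> 1") auto
  qed
  have m: "(\<lambda>s. emeasure lborel {x. ennreal s < k x}) \<in> borel_measurable borel"
    if [measurable]: "k \<in> borel_measurable borel" for k :: "real \<Rightarrow> ennreal"
    by measurable
  have [measurable]: "(\<lambda>s. emeasure lborel {x. ennreal s < f x}) \<in> borel_measurable borel"
    "(\<lambda>s. emeasure lborel {x. ennreal s < g x}) \<in> borel_measurable borel" by (rule m; measurable)+
  have "ennreal (1 - t) * (\<integral>\<^sup>+x. f x \<partial>lborel) + ennreal t * (\<integral>\<^sup>+x. g x \<partial>lborel)
      = (\<integral>\<^sup>+s. ennreal (1 - t) * (indicator {0<..} s * emeasure lborel {x. ennreal s < f x})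
      + ennreal t * (indicator {0<..} s * emeasure lborel {x. ennreal s < g x}) \<partial>lborel)"
    by (simp add: layer_cake[of f] layer_cake[of g] nn_integral_add nn_integral_cmult)
  also have "\<dots> \<le> (\<integral>\<^sup>+s. indicator {0<..} s * emeasure lborel {x. ennreal s < h x} \<partial>lborel)"
    by (intro nn_integral_mono lvl)
  also have "\<dots> = (\<integral>\<^sup>+x. h x \<partial>lborel)" by (simp add: layer_cake[of h])
  finally show ?thesis .
qed

lemma ennreal_le_mult_iff:
  assumes "s > 0"
  shows "ennreal (s * x) \<le> y \<longleftrightarrow> ennreal x \<le> y * ennreal (1 / s)"
proof (cases y)
  case (real r)
  then show ?thesis using assms
    by (cases "x \<ge> 0") (auto simp: ennreal_mult''[symmetric] field_simps ennreal_neg mult_nonneg_nonpos)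
next
  case top
  then show ?thesis using assms by (simp add: ennreal_top_mult)
qed

text \<open>Dividing \<open>f\<close> and \<open>g\<close> by their suprema, and \<open>h\<close> by
  the geometric mean \<open>c\<close> of these suprema, preserves the hypothesis and gives the
  normalized case. The suprema are finite by the bound \<open>N\<close> and positive because the
  integrals are. AM-GM finally replaces the arithmetic mean by the geometric one.\<close>

lemma prekopa_leindler_real_bounded:
  fixes f g h :: "real \<Rightarrow> ennreal"
  assumes [measurable]: "f \<in> borel_measurable borel" "g \<in> borel_measurable borel" "h \<in> borel_measurable borel"
    and t: "0 < t" "t < 1"
    and cond: "\<And>x y \<alpha> \<beta>. \<lbrakk>0 < \<alpha>; 0 < \<beta>; ennreal \<alpha> \<le> f x; ennreal \<beta> \<le> g y\<rbrakk>
      \<Longrightarrow> ennreal (\<alpha> powr (1 - t) * \<beta> powr t) \<le> h ((1 - t) * x + t * y)"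
    and supp: "\<And>x. x \<notin> {-R..R} \<Longrightarrow> f x = 0" "\<And>x. x \<notin> {-R..R} \<Longrightarrow> g x = 0"
    and bound: "\<And>x. f x \<le> ennreal N" "\<And>x. g x \<le> ennreal N"
    and \<alpha>\<beta>: "0 < \<alpha>" "0 < \<beta>" "ennreal \<alpha> \<le> (\<integral>\<^sup>+x. f x \<partial>lborel)" "ennreal \<beta> \<le> (\<integral>\<^sup>+x. g x \<partial>lborel)"
  shows "ennreal (\<alpha> powr (1 - t) * \<beta> powr t) \<le> (\<integral>\<^sup>+x. h x \<partial>lborel)"
proof -
  have ex: "\<exists>s>0. (SUP x. k x) = ennreal s"
    if b: "\<And>x. k x \<le> ennreal N" and i: "0 < a" "ennreal a \<le> (\<integral>\<^sup>+x. k x \<partial>lborel)"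
    for k :: "real \<Rightarrow> ennreal" and a
  proof -
    have "(SUP x. k x) \<le> ennreal N" using b by (intro SUP_least) auto
    then obtain s where s: "(SUP x. k x) = ennreal s" "s \<ge> 0" by (cases "SUP x. k x") (auto simp: top_unique)
    have "s \<noteq> 0"
    proof
      assume "s = 0"
      then have "k x = 0" for x using s SUP_upper[of x UNIV k] by simp
      then show False using i by simp
    qed
    with s(2) have "s > 0" by simp
    then show ?thesis using s(1) by blast
  qed
  obtain s where s: "s > 0" "(SUP x. f x) = ennreal s" using ex[of f] bound \<alpha>\<beta> by blast
  obtain r where r: "r > 0" "(SUP x. g x) = ennreal r" using ex[of g] bound \<alpha>\<beta> by blast
  have top: "k x * ennreal (1 / s) \<le> 1" if "s > 0" "(SUP x. k x) = ennreal s" for k :: "real \<Rightarrow> ennreal" and x s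
  proof -
    have "k x * ennreal (1 / s) \<le> ennreal s * ennreal (1 / s)"
      using that SUP_upper[of x UNIV k] by (intro mult_right_mono) auto
    then show ?thesis using that by (simp add: ennreal_mult''[symmetric])
  qed
  have sup: "\<exists>x. u < k x * ennreal (1 / s)"
    if "s > 0" "(SUP x. k x) = ennreal s" "u < 1" for k :: "real \<Rightarrow> ennreal" and u s
  proof -
    obtain v where v: "u = ennreal v" "0 \<le> v" "v < 1" using \<open>u < 1\<close> by (cases u) (auto simp: ennreal_less_one_iff)
    have "s * v < s" using v that(1) by simp
    then have "ennreal (s * v) < (SUP x. k x)" using v that by (simp add: ennreal_less_iff)
    then obtain x where x: "ennreal (s * v) < k x" by (auto simp: less_SUP_iff)
    have "\<not> k x * ennreal (1 / s) \<le> ennreal v"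
    proof
      assume "k x * ennreal (1 / s) \<le> ennreal v"
      then have "ennreal s * (k x * ennreal (1 / s)) \<le> ennreal s * ennreal v" by (intro mult_left_mono) auto
      moreover have "ennreal s * (k x * ennreal (1 / s)) = k x * ennreal (s * (1 / s))"
        using that(1) by (subst ennreal_mult'') (auto simp: mult_ac)
      ultimately have "k x \<le> ennreal (s * v)" using that(1) v by (simp add: ennreal_mult''[symmetric])
      with x show False by simp
    qed
    then show ?thesis using v by (auto simp: not_le)
  qed
  define c where "c = s powr (1 - t) * r powr t"
  have c: "c > 0" using s r by (simp add: c_def)
  have "ennreal (1 - t) * (\<integral>\<^sup>+x. f x * ennreal (1 / s) \<partial>lborel) + ennreal t * (\<integral>\<^sup>+x. g x * ennreal (1 / r) \<partial>lborel)
      \<le> (\<integral>\<^sup>+x. h x * ennreal (1 / c) \<partial>lborel)"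
  proof (rule prekopa_leindler_real_normalized[OF _ _ _ t, where R = R])
    fix x y a b :: real
    assume ab: "0 < a" "0 < b" "ennreal a \<le> f x * ennreal (1 / s)" "ennreal b \<le> g y * ennreal (1 / r)"
    then have "ennreal (s * a) \<le> f x" "ennreal (r * b) \<le> g y" using s r by (simp_all add: ennreal_le_mult_iff)
    then have "ennreal ((s * a) powr (1 - t) * (r * b) powr t) \<le> h ((1 - t) * x + t * y)"
      using ab s r by (intro cond) auto
    then have "ennreal (c * (a powr (1 - t) * b powr t)) \<le> h ((1 - t) * x + t * y)"
      using ab s r by (subst (asm) geometric_mean_scale) (auto simp: c_def)
    then show "ennreal (a powr (1 - t) * b powr t) \<le> h ((1 - t) * x + t * y) * ennreal (1 / c)"
      using c by (simp add: ennreal_le_mult_iff)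
  qed (use supp top[OF s] top[OF r] sup[OF s] sup[OF r] in auto)
  also have "(\<integral>\<^sup>+x. f x * ennreal (1 / s) \<partial>lborel) = (\<integral>\<^sup>+x. f x \<partial>lborel) * ennreal (1 / s)"
    by (rule nn_integral_multc) measurable
  also have "(\<integral>\<^sup>+x. g x * ennreal (1 / r) \<partial>lborel) = (\<integral>\<^sup>+x. g x \<partial>lborel) * ennreal (1 / r)"
    by (rule nn_integral_multc) measurable
  also have "(\<integral>\<^sup>+x. h x * ennreal (1 / c) \<partial>lborel) = (\<integral>\<^sup>+x. h x \<partial>lborel) * ennreal (1 / c)"
    by (rule nn_integral_multc) measurable
  finally have *: "ennreal (1 - t) * ((\<integral>\<^sup>+x. f x \<partial>lborel) * ennreal (1 / s))
      + ennreal t * ((\<integral>\<^sup>+x. g x \<partial>lborel) * ennreal (1 / r)) \<le> (\<integral>\<^sup>+x. h x \<partial>lborel) * ennreal (1 / c)" .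
  have 1: "ennreal (\<alpha> / s) \<le> (\<integral>\<^sup>+x. f x \<partial>lborel) * ennreal (1 / s)"
    "ennreal (\<beta> / r) \<le> (\<integral>\<^sup>+x. g x \<partial>lborel) * ennreal (1 / r)"
    using \<alpha>\<beta> s r by (simp_all add: ennreal_le_mult_iff[symmetric])
  have "ennreal ((\<alpha> / s) powr (1 - t) * (\<beta> / r) powr t) \<le> ennreal ((1 - t) * (\<alpha> / s) + t * (\<beta> / r))"
    using \<alpha>\<beta> s r t by (intro ennreal_leI weighted_am_gm) auto
  also have "\<dots> = ennreal (1 - t) * ennreal (\<alpha> / s) + ennreal t * ennreal (\<beta> / r)"
    using \<alpha>\<beta> s r t by (simp add: ennreal_mult''[symmetric] ennreal_plus[symmetric] del: ennreal_plus)
  also have "\<dots> \<le> ennreal (1 - t) * ((\<integral>\<^sup>+x. f x \<partial>lborel) * ennreal (1 / s))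
      + ennreal t * ((\<integral>\<^sup>+x. g x \<partial>lborel) * ennreal (1 / r))"
    using 1 by (intro add_mono mult_left_mono) auto
  also note *
  finally have "ennreal (c * ((\<alpha> / s) powr (1 - t) * (\<beta> / r) powr t)) \<le> (\<integral>\<^sup>+x. h x \<partial>lborel)"
    using c by (simp add: ennreal_le_mult_iff)
  moreover have "c * ((\<alpha> / s) powr (1 - t) * (\<beta> / r) powr t) = \<alpha> powr (1 - t) * \<beta> powr t"
    unfolding c_def using \<alpha>\<beta> s r by (intro geometric_mean_normalize[symmetric]) auto
  ultimately show ?thesis by simp
qed

text \<open>\<open>f\<close> and \<open>g\<close> are truncated in value and in domain, while
  \<open>h\<close> stays as it is. By monotone convergence the truncated integrals eventually exceed
  \<open>q * \<alpha>\<close> and \<open>q * \<beta>\<close> for any \<open>q < 1\<close>. The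
  geometric mean is homogeneous of degree one, so only a factor \<open>q\<close> is lost, and
  \<open>q\<close> may tend to 1.\<close>

lemma prekopa_leindler_real:
  fixes f g h :: "real \<Rightarrow> ennreal"
  assumes [measurable]: "f \<in> borel_measurable borel" "g \<in> borel_measurable borel" "h \<in> borel_measurable borel"
    and t: "0 < t" "t < 1"
    and cond: "\<And>x y \<alpha> \<beta>. \<lbrakk>0 < \<alpha>; 0 < \<beta>; ennreal \<alpha> \<le> f x; ennreal \<beta> \<le> g y\<rbrakk>
      \<Longrightarrow> ennreal (\<alpha> powr (1 - t) * \<beta> powr t) \<le> h ((1 - t) * x + t * y)"
    and \<alpha>\<beta>: "0 < \<alpha>" "0 < \<beta>" "ennreal \<alpha> \<le> (\<integral>\<^sup>+x. f x \<partial>lborel)" "ennreal \<beta> \<le> (\<integral>\<^sup>+x. g x \<partial>lborel)"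
  shows "ennreal (\<alpha> powr (1 - t) * \<beta> powr t) \<le> (\<integral>\<^sup>+x. h x \<partial>lborel)"
proof -
  define tr where "tr k n x = min (k x) (ennreal (real n)) * indicator {-real n..real n} x"
    for k :: "real \<Rightarrow> ennreal" and n :: nat and x :: real
  have tr_m: "tr k n \<in> borel_measurable borel" if "k \<in> borel_measurable borel" for k n
    using that unfolding tr_def[abs_def] by measurable
  have tr_le: "tr k n x \<le> k x" "tr k n x \<le> ennreal (real n)" for k n x
    by (auto simp: tr_def indicator_def)
  have tr_supp: "tr k n x = 0" if "x \<notin> {-real n..real n}" for k n x using that by (auto simp: tr_def)
  have mono_tr: "tr k m x \<le> tr k n x" if "m \<le> n" for k m n x
    unfolding tr_def using that by (intro mult_mono min.mono ennreal_leI) (auto simp: indicator_def)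
  have inc: "incseq (tr k)" for k
    using mono_tr by (auto simp: incseq_def le_fun_def)
  have sup_tr: "(SUP n. tr k n x) = k x" for k x
  proof (rule antisym)
    show "(SUP n. tr k n x) \<le> k x" by (intro SUP_least tr_le)
    show "k x \<le> (SUP n. tr k n x)"
    proof (rule dense_le)
      fix y assume y: "y < k x"
      then obtain r where r: "y = ennreal r" "r \<ge> 0" by (cases y) (use y in auto)
      obtain n :: nat where n: "max r \<bar>x\<bar> \<le> real n" using real_arch_simple by blast
      have "y \<le> min (k x) (ennreal (real n))"
        using y n r by (intro min.boundedI) (simp_all add: ennreal_leI less_imp_le)
      moreover have "x \<in> {-real n..real n}" using n by auto
      ultimately have "y \<le> tr k n x" by (simp add: tr_def)
      then show "y \<le> (SUP n. tr k n x)" by (rule SUP_upper2[OF UNIV_I])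
    qed
  qed
  have conv: "\<exists>n0. \<forall>n\<ge>n0. ennreal (q * a) \<le> (\<integral>\<^sup>+x. tr k n x \<partial>lborel)"
    if k: "k \<in> borel_measurable borel" and a: "0 < a" "ennreal a \<le> (\<integral>\<^sup>+x. k x \<partial>lborel)" and q: "0 < q" "q < 1"
    for k a q
  proof -
    have "(\<integral>\<^sup>+x. k x \<partial>lborel) = (SUP n. \<integral>\<^sup>+x. tr k n x \<partial>lborel)"
      using nn_integral_monotone_convergence_SUP[OF inc[of k], of lborel] tr_m[OF k] by (simp add: sup_tr)
    moreover have "ennreal (q * a) < ennreal a" using a q by (simp add: ennreal_less_iff)
    ultimately have "ennreal (q * a) < (SUP n. \<integral>\<^sup>+x. tr k n x \<partial>lborel)" using a by auto
    then obtain n where n: "ennreal (q * a) < (\<integral>\<^sup>+x. tr k n x \<partial>lborel)" by (auto simp: less_SUP_iff)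
    have "ennreal (q * a) \<le> (\<integral>\<^sup>+x. tr k m x \<partial>lborel)" if "n \<le> m" for m
    proof -
      have "(\<integral>\<^sup>+x. tr k n x \<partial>lborel) \<le> (\<integral>\<^sup>+x. tr k m x \<partial>lborel)" by (intro nn_integral_mono mono_tr that)
      with n show ?thesis by (meson order.strict_implies_order order.trans)
    qed
    then show ?thesis by blast
  qed
  have step: "ennreal (q * (\<alpha> powr (1 - t) * \<beta> powr t)) \<le> (\<integral>\<^sup>+x. h x \<partial>lborel)" if q: "0 < q" "q < 1" for q
  proof -
    obtain n1 where n1: "\<And>n. n \<ge> n1 \<Longrightarrow> ennreal (q * \<alpha>) \<le> (\<integral>\<^sup>+x. tr f n x \<partial>lborel)"
      using conv[of f \<alpha> q] \<alpha>\<beta> q by auto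
    obtain n2 where n2: "\<And>n. n \<ge> n2 \<Longrightarrow> ennreal (q * \<beta>) \<le> (\<integral>\<^sup>+x. tr g n x \<partial>lborel)"
      using conv[of g \<beta> q] \<alpha>\<beta> q by auto
    define n where "n = max n1 n2"
    have "ennreal ((q * \<alpha>) powr (1 - t) * (q * \<beta>) powr t) \<le> (\<integral>\<^sup>+x. h x \<partial>lborel)"
    proof (rule prekopa_leindler_real_bounded[OF _ _ _ t, where R = "real n" and N = "real n"])
      fix x y a b :: real
      assume ab: "0 < a" "0 < b" "ennreal a \<le> tr f n x" "ennreal b \<le> tr g n y"
      show "ennreal (a powr (1 - t) * b powr t) \<le> h ((1 - t) * x + t * y)"
        by (rule cond[OF ab(1,2) order.trans[OF ab(3) tr_le(1)] order.trans[OF ab(4) tr_le(1)]])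
    next
      show "ennreal (q * \<alpha>) \<le> (\<integral>\<^sup>+x. tr f n x \<partial>lborel)" "ennreal (q * \<beta>) \<le> (\<integral>\<^sup>+x. tr g n x \<partial>lborel)"
        by (auto intro!: n1 n2 simp: n_def)
    qed (use \<alpha>\<beta> q tr_m in \<open>auto simp: tr_supp intro: tr_le\<close>)
    moreover have "(q * \<alpha>) powr (1 - t) * (q * \<beta>) powr t = q * (\<alpha> powr (1 - t) * \<beta> powr t)"
      using q \<alpha>\<beta> by (subst geometric_mean_scale) (auto simp: powr_add[symmetric])
    ultimately show ?thesis by simp
  qed
  show ?thesis
  proof (cases "\<integral>\<^sup>+x. h x \<partial>lborel")
    case (real r)
    have "\<alpha> powr (1 - t) * \<beta> powr t \<le> r"
    proof (rule field_le_mult_one_interval)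
      fix q :: real assume "0 < q" "q < 1"
      then show "q * (\<alpha> powr (1 - t) * \<beta> powr t) \<le> r" using step[of q] real by simp
    qed
    then show ?thesis using real by (simp add: ennreal_leI)
  qed simp
qed

section \<open>Multiplicative Prekopa-Leindler, from the half-line to Euclidean space\<close>

lemma nn_integral_exp_substitution:
  fixes f :: "real \<Rightarrow> ennreal"
  assumes [measurable]: "f \<in> borel_measurable borel"
  shows "(\<integral>\<^sup>+x. f x * indicator {0<..} x \<partial>lborel) = (\<integral>\<^sup>+s. f (exp s) * ennreal (exp s) \<partial>lborel)"
proof -
  have 1: "(SUP n. F n x) = G x"
    if ev: "\<And>m. m \<ge> n0 \<Longrightarrow> F m x = G x" and le: "\<And>m. F m x \<le> G x"
    for F :: "nat \<Rightarrow> real \<Rightarrow> ennreal" and G x n0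
  proof (rule antisym)
    show "(SUP n. F n x) \<le> G x" by (intro SUP_least le)
    show "G x \<le> (SUP n. F n x)" using SUP_upper[of n0 UNIV "\<lambda>n. F n x"] ev[of n0] by simp
  qed
  \<comment> \<open>Exhaustion by compact intervals, on which the substitution rule is applied:
    \<open>exp\<close> maps \<open>[-n, n]\<close> onto \<open>[exp (- n), exp n]\<close>.\<close>
  let ?F = "\<lambda>n::nat. \<lambda>x. f x * indicator {exp (- real n)..exp (real n)} x"
  let ?G = "\<lambda>n::nat. \<lambda>s. f (exp s) * ennreal (exp s) * indicator {- real n..real n} s"
  have supF: "(SUP n. ?F n x) = f x * indicator {0<..} x" for x
  proof (cases "x > 0")
    case True
    obtain n0 :: nat where n0: "\<bar>ln x\<bar> \<le> real n0" using real_arch_simple by blast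
    have "?F m x = f x * indicator {0<..} x" if "m \<ge> n0" for m
    proof -
      have "\<bar>ln x\<bar> \<le> real m" using n0 that by (meson of_nat_le_iff order.trans)
      then have "- real m \<le> ln x" "ln x \<le> real m" by auto
      then have "exp (- real m) \<le> x" "x \<le> exp (real m)"
        using True by (metis exp_le_cancel_iff exp_ln)+
      then show ?thesis using True by simp
    qed
    then show ?thesis by (rule 1) (use True in \<open>auto simp: indicator_def\<close>)
  next
    case False
    then have "x \<notin> {exp (- real n)..exp (real n)}" for n
      using less_le_trans[OF exp_gt_zero[of "- real n"], of x] by auto
    then show ?thesis using False by simp
  qed
  have supG: "(SUP n. ?G n s) = f (exp s) * ennreal (exp s)" for s
  proof -
    obtain n0 :: nat where n0: "\<bar>s\<bar> \<le> real n0" using real_arch_simple by blast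
    have "?G m s = f (exp s) * ennreal (exp s)" if "m \<ge> n0" for m
    proof -
      have "\<bar>s\<bar> \<le> real m" using n0 that by (meson of_nat_le_iff order.trans)
      then have "s \<in> {- real m..real m}" by auto
      then show ?thesis by simp
    qed
    then show ?thesis by (rule 1) (auto simp: indicator_def)
  qed
  have incF: "incseq ?F" and incG: "incseq ?G"
    unfolding incseq_def le_fun_def
    by (auto intro!: mult_left_mono simp: indicator_def intro: order.trans[of "exp (- real n)" "exp (- real m)" for m n]
        order.trans[of _ "exp (real m)" for m])
  have eq: "(\<integral>\<^sup>+x. ?F n x \<partial>lborel) = (\<integral>\<^sup>+s. ?G n s \<partial>lborel)" for n
  proof (cases "n = 0")
    \<comment> \<open>For \<open>n = 0\<close> both intervals shrink to a point and both integrals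
      vanish; the substitution rule is left to nondegenerate intervals.\<close>
    case True
    have "(\<integral>\<^sup>+x. ?F n x \<partial>lborel) = (\<integral>\<^sup>+x. f 1 * indicator {1} (x::real) \<partial>lborel)"
      using True by (intro nn_integral_cong) (auto simp: indicator_def)
    moreover have "(\<integral>\<^sup>+x. ?G n x \<partial>lborel) = (\<integral>\<^sup>+x. f 1 * indicator {0} (x::real) \<partial>lborel)"
      using True by (intro nn_integral_cong) (auto simp: indicator_def)
    ultimately show ?thesis by (simp add: nn_integral_cmult)
  next
    case False
    then show ?thesis
      by (intro nn_integral_substitution_aux[where g = exp])
        (auto intro!: derivative_eq_intros continuous_intros)
  qed
  have "(\<integral>\<^sup>+x. f x * indicator {0<..} x \<partial>lborel) = (SUP n. \<integral>\<^sup>+x. ?F n x \<partial>lborel)"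
    using nn_integral_monotone_convergence_SUP[OF incF, of lborel] by (simp add: supF)
  also have "\<dots> = (SUP n. \<integral>\<^sup>+s. ?G n s \<partial>lborel)" by (simp add: eq)
  also have "\<dots> = (\<integral>\<^sup>+s. f (exp s) * ennreal (exp s) \<partial>lborel)"
    using nn_integral_monotone_convergence_SUP[OF incG, of lborel] by (simp add: supG)
  finally show ?thesis .
qed

text \<open>The substitution x = exp s turns geometric means of the arguments into convex
  combinations. The Jacobian is harmless: its logarithm is linear in s, so it contributes the same
  factor to both sides of the hypothesis.\<close>

lemma prekopa_leindler_pos_real:
  fixes f g h :: "real \<Rightarrow> ennreal"
  assumes [measurable]: "f \<in> borel_measurable borel" "g \<in> borel_measurable borel" "h \<in> borel_measurable borel"
    and t: "0 < t" "t < 1"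
    and cond: "\<And>x y \<alpha> \<beta>. \<lbrakk>0 < x; 0 < y; 0 < \<alpha>; 0 < \<beta>; ennreal \<alpha> \<le> f x; ennreal \<beta> \<le> g y\<rbrakk>
      \<Longrightarrow> ennreal (\<alpha> powr (1 - t) * \<beta> powr t) \<le> h (x powr (1 - t) * y powr t)"
    and \<alpha>\<beta>: "0 < \<alpha>" "0 < \<beta>" "ennreal \<alpha> \<le> (\<integral>\<^sup>+x. f x * indicator {0<..} x \<partial>lborel)"
      "ennreal \<beta> \<le> (\<integral>\<^sup>+x. g x * indicator {0<..} x \<partial>lborel)"
  shows "ennreal (\<alpha> powr (1 - t) * \<beta> powr t) \<le> (\<integral>\<^sup>+x. h x * indicator {0<..} x \<partial>lborel)"
proof -
  have m: "(\<lambda>x. k (exp x) * ennreal (exp x)) \<in> borel_measurable borel"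
    if "k \<in> borel_measurable borel" for k :: "real \<Rightarrow> ennreal"
    using that by measurable
  show ?thesis
    unfolding nn_integral_exp_substitution[OF assms(3)]
  proof (rule prekopa_leindler_real[OF _ _ _ t _ \<alpha>\<beta>(1,2)
        \<alpha>\<beta>(3)[unfolded nn_integral_exp_substitution[OF assms(1)]]
        \<alpha>\<beta>(4)[unfolded nn_integral_exp_substitution[OF assms(2)]]])
    fix x y a b :: real
    assume ab: "0 < a" "0 < b" "ennreal a \<le> f (exp x) * ennreal (exp x)" "ennreal b \<le> g (exp y) * ennreal (exp y)"
    have *: "ennreal a \<le> k * ennreal (exp x) \<longleftrightarrow> ennreal (a * exp (- x)) \<le> k" for a x k
      using ennreal_le_mult_iff[of "exp (- x)" a k] by (simp add: exp_minus mult.commute inverse_eq_divide)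
    have e: "exp ((1 - t) * x + t * y) = exp x powr (1 - t) * exp y powr t"
      by (simp add: powr_def exp_add)
    have "ennreal ((a * exp (- x)) powr (1 - t) * (b * exp (- y)) powr t) \<le> h (exp x powr (1 - t) * exp y powr t)"
      using ab by (intro cond) (simp_all add: *)
    moreover have "(a * exp (- x)) powr (1 - t) * (b * exp (- y)) powr t
        = (a powr (1 - t) * b powr t) * exp (- ((1 - t) * x + t * y))"
    proof -
      have "exp (- x) powr (1 - t) * exp (- y) powr t = exp (- ((1 - t) * x + t * y))"
        by (simp add: powr_def exp_add[symmetric] algebra_simps)
      then show ?thesis using ab by (simp add: powr_mult mult_ac)
    qed
    ultimately have "ennreal ((a powr (1 - t) * b powr t) * exp (- ((1 - t) * x + t * y)))
        \<le> h (exp x powr (1 - t) * exp y powr t)" by (simp only:)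
    then show "ennreal (a powr (1 - t) * b powr t)
        \<le> h (exp ((1 - t) * x + t * y)) * ennreal (exp ((1 - t) * x + t * y))"
      by (subst *) (simp only: e)
  qed (rule m assms)+
qed

lemma nn_integral_real_split_sign:
  fixes f :: "real \<Rightarrow> ennreal"
  assumes [measurable]: "f \<in> borel_measurable borel"
  shows "(\<integral>\<^sup>+x. f x \<partial>lborel)
    = (\<integral>\<^sup>+x. f x * indicator {0<..} x \<partial>lborel) + (\<integral>\<^sup>+x. f (- x) * indicator {0<..} x \<partial>lborel)"
proof -
  have "(\<integral>\<^sup>+x. f x \<partial>lborel) = (\<integral>\<^sup>+x. f x * indicator {0<..} x + f x * indicator {..<0} x \<partial>lborel)"
    by (rule nn_integral_cong_AE, rule AE_mp[OF AE_lborel_singleton[of 0]]) (auto simp: indicator_def)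
  also have "\<dots> = (\<integral>\<^sup>+x. f x * indicator {0<..} x \<partial>lborel) + (\<integral>\<^sup>+x. f x * indicator {..<0} x \<partial>lborel)"
    by (rule nn_integral_add) auto
  also have "(\<integral>\<^sup>+x. f x * indicator {..<0} x \<partial>lborel)
      = \<bar>-1::real\<bar> * (\<integral>\<^sup>+x. f (0 + (-1) * x) * indicator {..<0} (0 + (-1) * x :: real) \<partial>lborel)"
    by (rule nn_integral_real_affine) auto
  also have "\<dots> = (\<integral>\<^sup>+x. f (- x) * indicator {0<..} x \<partial>lborel)"
    by (auto intro!: nn_integral_cong simp: indicator_def)
  finally show ?thesis .
qed

lemma ennreal_half_le:
  assumes "0 < \<alpha>" "ennreal \<alpha> \<le> a + b"
  shows "ennreal (\<alpha> / 2) \<le> a \<or> ennreal (\<alpha> / 2) \<le> b"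
proof (rule ccontr)
  assume "\<not> ?thesis"
  then have lt: "a < ennreal (\<alpha> / 2)" "b < ennreal (\<alpha> / 2)" by auto
  then obtain r s where rs: "a = ennreal r" "0 \<le> r" "b = ennreal s" "0 \<le> s"
    by (cases a; cases b) auto
  then show False using lt assms by (auto simp: ennreal_less_iff ennreal_plus[symmetric] simp del: ennreal_plus)
qed

text \<open>One of the two half-lines carries at least half of the integral of \<open>f\<close>, and
  likewise for \<open>g\<close>. The hypothesis leaves the sign of \<open>z\<close> free, so this
  one pair of half-lines bounds the integral of \<open>h\<close> on both half-lines, and the two
  halves add up.\<close>

lemma prekopa_leindler_mult_real:
  fixes f g h :: "real \<Rightarrow> ennreal"
  assumes m[measurable]: "f \<in> borel_measurable borel" "g \<in> borel_measurable borel" "h \<in> borel_measurable borel"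
    and t: "0 < t" "t < 1"
    and cond: "\<And>x y z \<alpha> \<beta>. \<lbrakk>x \<noteq> 0; y \<noteq> 0; \<bar>z\<bar> = \<bar>x\<bar> powr (1 - t) * \<bar>y\<bar> powr t; 0 < \<alpha>; 0 < \<beta>;
      ennreal \<alpha> \<le> f x; ennreal \<beta> \<le> g y\<rbrakk> \<Longrightarrow> ennreal (\<alpha> powr (1 - t) * \<beta> powr t) \<le> h z"
    and \<alpha>\<beta>: "0 < \<alpha>" "0 < \<beta>" "ennreal \<alpha> \<le> (\<integral>\<^sup>+x. f x \<partial>lborel)" "ennreal \<beta> \<le> (\<integral>\<^sup>+x. g x \<partial>lborel)"
  shows "ennreal (\<alpha> powr (1 - t) * \<beta> powr t) \<le> (\<integral>\<^sup>+x. h x \<partial>lborel)"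
proof -
  have half: "\<exists>\<sigma>\<in>{1,-1::real}. ennreal (a / 2) \<le> (\<integral>\<^sup>+x. k (\<sigma> * x) * indicator {0<..} x \<partial>lborel)"
    if k: "k \<in> borel_measurable borel" and a: "0 < a" "ennreal a \<le> (\<integral>\<^sup>+x. k x \<partial>lborel)" for k a
    using ennreal_half_le[OF a(1) a(2)[unfolded nn_integral_real_split_sign[OF k]]] by auto
  obtain \<sigma> where \<sigma>: "\<sigma> \<in> {1,-1::real}" "ennreal (\<alpha> / 2) \<le> (\<integral>\<^sup>+x. f (\<sigma> * x) * indicator {0<..} x \<partial>lborel)"
    using half[OF m(1) \<alpha>\<beta>(1,3)] by blast
  obtain \<tau> where \<tau>: "\<tau> \<in> {1,-1::real}" "ennreal (\<beta> / 2) \<le> (\<integral>\<^sup>+x. g (\<tau> * x) * indicator {0<..} x \<partial>lborel)"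
    using half[OF m(2) \<alpha>\<beta>(2,4)] by blast
  have s: "ennreal ((\<alpha> / 2) powr (1 - t) * (\<beta> / 2) powr t) \<le> (\<integral>\<^sup>+x. h (\<epsilon> * x) * indicator {0<..} x \<partial>lborel)"
    if \<epsilon>: "\<epsilon> \<in> {1,-1::real}" for \<epsilon>
  proof (rule prekopa_leindler_pos_real[OF _ _ _ t _ _ _ \<sigma>(2) \<tau>(2)])
    fix x y a b :: real
    assume "0 < x" "0 < y" "0 < a" "0 < b" "ennreal a \<le> f (\<sigma> * x)" "ennreal b \<le> g (\<tau> * y)"
    then show "ennreal (a powr (1 - t) * b powr t) \<le> h (\<epsilon> * (x powr (1 - t) * y powr t))"
      using \<epsilon> \<sigma>(1) \<tau>(1) by (intro cond[of "\<sigma> * x" "\<tau> * y"]) (auto simp: abs_mult)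
  qed (use \<alpha>\<beta> in auto)
  have "(\<alpha> / 2) powr (1 - t) * (\<beta> / 2) powr t = \<alpha> powr (1 - t) * \<beta> powr t / 2"
  proof -
    have "(1/2 * \<alpha>) powr (1 - t) * (1/2 * \<beta>) powr t = (1/2) powr (1 - t) * (1/2) powr t * (\<alpha> powr (1 - t) * \<beta> powr t)"
      using \<alpha>\<beta> by (intro geometric_mean_scale) auto
    also have "(1/2) powr (1 - t) * (1/2) powr t = (1/2 :: real)" by (simp only: powr_add[symmetric]) simp
    finally show ?thesis by simp
  qed
  then have half_mean: "\<alpha> powr (1 - t) * \<beta> powr t = (\<alpha> / 2) powr (1 - t) * (\<beta> / 2) powr t + (\<alpha> / 2) powr (1 - t) * (\<beta> / 2) powr t"
    by linarith
  have "ennreal (\<alpha> powr (1 - t) * \<beta> powr t)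
      = ennreal ((\<alpha> / 2) powr (1 - t) * (\<beta> / 2) powr t + (\<alpha> / 2) powr (1 - t) * (\<beta> / 2) powr t)"
    by (rule arg_cong[OF half_mean])
  also have "\<dots> = ennreal ((\<alpha> / 2) powr (1 - t) * (\<beta> / 2) powr t) + ennreal ((\<alpha> / 2) powr (1 - t) * (\<beta> / 2) powr t)"
    by (rule ennreal_plus) auto
  also have "\<dots> \<le> (\<integral>\<^sup>+x. h x * indicator {0<..} x \<partial>lborel) + (\<integral>\<^sup>+x. h (- x) * indicator {0<..} x \<partial>lborel)"
    using s[of 1] s[of "-1"] by (intro add_mono) auto
  also have "\<dots> = (\<integral>\<^sup>+x. h x \<partial>lborel)" by (rule nn_integral_real_split_sign[symmetric]) measurable
  finally show ?thesis .
qed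

text \<open>Induction on the set of coordinates: when coordinate \<open>i\<close> is fixed to
  \<open>u\<close>, \<open>v\<close>, \<open>w\<close>, the induction hypothesis says that the
  integrals over the remaining coordinates satisfy the hypothesis of the one-dimensional
  case.\<close>

lemma prekopa_leindler_mult_PiM:
  fixes f g h :: "('i \<Rightarrow> real) \<Rightarrow> ennreal"
  assumes I: "finite I" and t: "0 < t" "t < 1"
    and "f \<in> borel_measurable (\<Pi>\<^sub>M i\<in>I. lborel)" "g \<in> borel_measurable (\<Pi>\<^sub>M i\<in>I. lborel)" "h \<in> borel_measurable (\<Pi>\<^sub>M i\<in>I. lborel)"
    and "\<And>x y z \<alpha> \<beta>. \<lbrakk>\<And>i. i \<in> I \<Longrightarrow> x i \<noteq> 0 \<and> y i \<noteq> 0 \<and> \<bar>z i\<bar> = \<bar>x i\<bar> powr (1 - t) * \<bar>y i\<bar> powr t;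
      \<And>i. i \<notin> I \<Longrightarrow> x i = y i \<and> y i = z i; 0 < \<alpha>; 0 < \<beta>;
      ennreal \<alpha> \<le> f x; ennreal \<beta> \<le> g y\<rbrakk> \<Longrightarrow> ennreal (\<alpha> powr (1 - t) * \<beta> powr t) \<le> h z"
    and "0 < \<alpha>" "0 < \<beta>" "ennreal \<alpha> \<le> (\<integral>\<^sup>+x. f x \<partial>(\<Pi>\<^sub>M i\<in>I. lborel))" "ennreal \<beta> \<le> (\<integral>\<^sup>+x. g x \<partial>(\<Pi>\<^sub>M i\<in>I. lborel))"
  shows "ennreal (\<alpha> powr (1 - t) * \<beta> powr t) \<le> (\<integral>\<^sup>+x. h x \<partial>(\<Pi>\<^sub>M i\<in>I. lborel))"
  using I assms(4-)
proof (induction I arbitrary: f g h \<alpha> \<beta> rule: finite_induct)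
  case empty
  interpret product_sigma_finite "\<lambda>_::'i. lborel :: real measure" ..
  \<comment> \<open>An integral over the empty product is the value at its only point, so the claim
    is the hypothesis for three equal arguments.\<close>
  show ?case using empty.prems by (simp add: nn_integral_empty)
next
  case (insert i I)
  interpret product_sigma_finite "\<lambda>_::'i. lborel :: real measure" ..
  interpret I: finite_product_sigma_finite "\<lambda>_::'i. lborel :: real measure" I by standard (rule insert)
  note [measurable] = insert.prems(1-3)
  have upd: "(\<lambda>x. k (x(i := u))) \<in> borel_measurable (\<Pi>\<^sub>M i\<in>I. lborel)"
    if [measurable]: "k \<in> borel_measurable (\<Pi>\<^sub>M i\<in>insert i I. lborel)" for k :: "('i \<Rightarrow> real) \<Rightarrow> ennreal" and u
    by measurable
  have F: "(\<lambda>u. \<integral>\<^sup>+x. k (x(i := u)) \<partial>(\<Pi>\<^sub>M i\<in>I. lborel)) \<in> borel_measurable borel"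
    if [measurable]: "k \<in> borel_measurable (\<Pi>\<^sub>M i\<in>insert i I. lborel)" for k :: "('i \<Rightarrow> real) \<Rightarrow> ennreal"
    by measurable
  note fubini = product_nn_integral_insert_rev[OF insert.hyps]
  show ?case
    unfolding fubini[OF insert.prems(3)]
  proof (rule prekopa_leindler_mult_real[OF F[OF insert.prems(1)] F[OF insert.prems(2)] F[OF insert.prems(3)] t _
        insert.prems(5,6) insert.prems(7)[unfolded fubini[OF insert.prems(1)]]
        insert.prems(8)[unfolded fubini[OF insert.prems(2)]]])
    fix u v w a b :: real
    assume uvw: "u \<noteq> 0" "v \<noteq> 0" "\<bar>w\<bar> = \<bar>u\<bar> powr (1 - t) * \<bar>v\<bar> powr t"
      and ab: "0 < a" "0 < b" "ennreal a \<le> (\<integral>\<^sup>+x. f (x(i := u)) \<partial>(\<Pi>\<^sub>M i\<in>I. lborel))"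
        "ennreal b \<le> (\<integral>\<^sup>+x. g (x(i := v)) \<partial>(\<Pi>\<^sub>M i\<in>I. lborel))"
    show "ennreal (a powr (1 - t) * b powr t) \<le> (\<integral>\<^sup>+x. h (x(i := w)) \<partial>(\<Pi>\<^sub>M i\<in>I. lborel))"
    proof (rule insert.IH[OF upd[OF insert.prems(1)] upd[OF insert.prems(2)] upd[OF insert.prems(3)] _ ab])
      fix x y z :: "'i \<Rightarrow> real" and a b :: real
      assume xyz: "\<And>j. j \<in> I \<Longrightarrow> x j \<noteq> 0 \<and> y j \<noteq> 0 \<and> \<bar>z j\<bar> = \<bar>x j\<bar> powr (1 - t) * \<bar>y j\<bar> powr t"
        "\<And>j. j \<notin> I \<Longrightarrow> x j = y j \<and> y j = z j"
        and ab: "0 < a" "0 < b" "ennreal a \<le> f (x(i := u))" "ennreal b \<le> g (y(i := v))"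
      show "ennreal (a powr (1 - t) * b powr t) \<le> h (z(i := w))"
        by (rule insert.prems(4)[OF _ _ ab]) (use xyz uvw in auto)
    qed
  qed
qed

lemma prekopa_leindler_mult_euclidean:
  fixes f g h :: "'a::euclidean_space \<Rightarrow> ennreal"
  assumes m[measurable]: "f \<in> borel_measurable borel" "g \<in> borel_measurable borel" "h \<in> borel_measurable borel"
    and t: "0 < t" "t < 1"
    and cond: "\<And>x y z \<alpha> \<beta>. \<lbrakk>\<And>b. b \<in> Basis \<Longrightarrow> x \<bullet> b \<noteq> 0 \<and> y \<bullet> b \<noteq> 0 \<and> \<bar>z \<bullet> b\<bar> = \<bar>x \<bullet> b\<bar> powr (1 - t) * \<bar>y \<bullet> b\<bar> powr t;
      0 < \<alpha>; 0 < \<beta>; ennreal \<alpha> \<le> f x; ennreal \<beta> \<le> g y\<rbrakk> \<Longrightarrow> ennreal (\<alpha> powr (1 - t) * \<beta> powr t) \<le> h z"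
    and \<alpha>\<beta>: "0 < \<alpha>" "0 < \<beta>" "ennreal \<alpha> \<le> (\<integral>\<^sup>+x. f x \<partial>lborel)" "ennreal \<beta> \<le> (\<integral>\<^sup>+x. g x \<partial>lborel)"
  shows "ennreal (\<alpha> powr (1 - t) * \<beta> powr t) \<le> (\<integral>\<^sup>+x. h x \<partial>lborel)"
proof -
  let ?S = "\<lambda>v::'a \<Rightarrow> real. \<Sum>b\<in>Basis. v b *\<^sub>R b"
  have S: "?S \<in> measurable (\<Pi>\<^sub>M b\<in>Basis. lborel) borel" by measurable
  have int: "(\<integral>\<^sup>+x. k x \<partial>lborel) = (\<integral>\<^sup>+v. k (?S v) \<partial>(\<Pi>\<^sub>M b\<in>Basis. lborel))"
    if [measurable]: "k \<in> borel_measurable borel" for k :: "'a \<Rightarrow> ennreal"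
    by (subst lborel_eq) (subst nn_integral_distr[OF S], simp_all)
  have mS: "(\<lambda>v. k (?S v)) \<in> borel_measurable (\<Pi>\<^sub>M b\<in>Basis. lborel)"
    if "k \<in> borel_measurable borel" for k :: "'a \<Rightarrow> ennreal"
    by (rule measurable_compose[OF S that])
  have coord: "?S v \<bullet> b = v b" if "b \<in> Basis" for v b
    using that by (simp add: inner_sum_left inner_Basis if_distrib cong: if_cong)
  show ?thesis
    unfolding int[OF m(3)]
  proof (rule prekopa_leindler_mult_PiM[OF finite_Basis t mS[OF m(1)] mS[OF m(2)] mS[OF m(3)] _ \<alpha>\<beta>(1,2)
        \<alpha>\<beta>(3)[unfolded int[OF m(1)]] \<alpha>\<beta>(4)[unfolded int[OF m(2)]]])
    fix x y z :: "'a \<Rightarrow> real" and a b :: real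
    assume xyz: "\<And>i. i \<in> Basis \<Longrightarrow> x i \<noteq> 0 \<and> y i \<noteq> 0 \<and> \<bar>z i\<bar> = \<bar>x i\<bar> powr (1 - t) * \<bar>y i\<bar> powr t"
      and ab: "0 < a" "0 < b" "ennreal a \<le> f (?S x)" "ennreal b \<le> g (?S y)"
    show "ennreal (a powr (1 - t) * b powr t) \<le> h (?S z)"
      by (rule cond[OF _ ab]) (use xyz coord in simp)
  qed
qed

section \<open>Orthonormal coordinates and volumes of diagonal images\<close>

lemma orthogonal_transformation_continuous_on:
  fixes T :: "'a::euclidean_space \<Rightarrow> 'a"
  assumes "orthogonal_transformation T"
  shows "continuous_on S T"
  using orthogonal_transformation_linear[OF assms]
  by (intro linear_continuous_on) (simp add: linear_conv_bounded_linear)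

text \<open>Up to a null set an open set is a disjoint union of balls, and these are mapped to balls of
  the same radius.\<close>

lemma emeasure_orthogonal_image_open:
  fixes T :: "'a::euclidean_space \<Rightarrow> 'a"
  assumes T: "orthogonal_transformation T" and S: "open S"
  shows "emeasure lebesgue (T ` S) = emeasure lebesgue S"
proof -
  have lin: "linear T" and inj: "inj T"
    using T by (auto intro: orthogonal_transformation_linear orthogonal_transformation_inj)
  define K where "K = {(x, r). 0 < r \<and> ball x r \<subseteq> S}"
  have cov: "\<exists>i. i \<in> K \<and> x \<in> ball (fst i) (snd i) \<and> snd i < d" if x: "x \<in> S" and d: "0 < d" for x d
  proof -
    obtain r where r: "r > 0" "ball x r \<subseteq> S" using S x open_contains_ball by blast
    have "(x, min r (d / 2)) \<in> K" using r d by (auto simp: K_def)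
    then show ?thesis using r d by (intro exI[of _ "(x, min r (d / 2))"]) auto
  qed
  obtain C where C: "countable C" "C \<subseteq> K"
    "pairwise (\<lambda>i j. disjnt (ball (fst i) (snd i)) (ball (fst j) (snd j))) C"
    "negligible (S - (\<Union>i\<in>C. ball (fst i) (snd i)))"
    using Vitali_covering_theorem_balls[of S K fst snd, OF cov] by blast
  define U where "U = (\<Union>i\<in>C. ball (fst i) (snd i))"
  have US: "U \<subseteq> S" using C(2) by (fastforce simp: U_def K_def)
  have TU: "T ` U = (\<Union>i\<in>C. ball (T (fst i)) (snd i))"
    using image_orthogonal_transformation_ball[OF T] by (auto simp: U_def image_UN)
  have pos: "snd i > 0" if "i \<in> C" for i using that C(2) by (auto simp: K_def)
  have "emeasure lebesgue U = (\<integral>\<^sup>+i. emeasure lebesgue (ball (fst i) (snd i)) \<partial>count_space C)"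
    unfolding U_def using C(3)
    by (intro emeasure_UN_countable C(1)) (auto simp: disjoint_family_on_def pairwise_def disjnt_def)
  also have "\<dots> = (\<integral>\<^sup>+i. emeasure lebesgue (ball (T (fst i)) (snd i)) \<partial>count_space C)"
    using pos by (intro nn_integral_cong) (simp add: emeasure_ball less_imp_le)
  also have "\<dots> = emeasure lebesgue (T ` U)"
    unfolding TU
  proof (rule emeasure_UN_countable[symmetric, OF _ C(1)])
    show "disjoint_family_on (\<lambda>i. ball (T (fst i)) (snd i)) C"
      unfolding disjoint_family_on_def
    proof (intro ballI impI)
      fix i j assume "i \<in> C" "j \<in> C" "i \<noteq> j"
      then have "ball (fst i) (snd i) \<inter> ball (fst j) (snd j) = {}"
        using C(3) by (auto simp: pairwise_def disjnt_def)
      then have "T ` ball (fst i) (snd i) \<inter> T ` ball (fst j) (snd j) = {}"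
        using inj by (metis image_Int image_empty)
      then show "ball (T (fst i)) (snd i) \<inter> ball (T (fst j)) (snd j) = {}"
        by (simp add: image_orthogonal_transformation_ball[OF T])
    qed
  qed auto
  finally have eq: "emeasure lebesgue U = emeasure lebesgue (T ` U)" .
  have null: "S - U \<in> null_sets lebesgue" using C(4) by (simp add: U_def negligible_iff_null_sets)
  have "negligible (T ` (S - U))"
    using C(4) lin by (intro negligible_differentiable_image_negligible)
      (auto simp: U_def linear_imp_differentiable_on)
  then have null': "T ` (S - U) \<in> null_sets lebesgue" by (simp add: negligible_iff_null_sets)
  have "open U" "open (T ` U)" unfolding TU by (auto simp: U_def)
  then have meas: "U \<in> sets lebesgue" "T ` U \<in> sets lebesgue" by (auto intro: sets_completionI_sets)
  have "S = U \<union> (S - U)" using US by auto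
  then have S_eq: "emeasure lebesgue S = emeasure lebesgue U"
    using emeasure_Un_null_set[OF meas(1) null] by simp
  have "T ` S = T ` U \<union> T ` (S - U)" using US by auto
  then have "emeasure lebesgue (T ` S) = emeasure lebesgue (T ` U)"
    using emeasure_Un_null_set[OF meas(2) null'] by simp
  then show ?thesis using S_eq eq by simp
qed

text \<open>\<open>lborel\<close> is determined by its values on boxes, and the preimage of a box
  under \<open>T\<close> is open, so the open case is enough.\<close>

lemma lborel_distr_orthogonal:
  fixes T :: "'a::euclidean_space \<Rightarrow> 'a"
  assumes T: "orthogonal_transformation T"
  shows "distr lborel borel T = lborel"
proof (rule lborel_eqI[symmetric])
  have cont: "continuous_on UNIV T" using T by (rule orthogonal_transformation_continuous_on)
  then have meas: "T \<in> borel_measurable lborel" by (simp add: borel_measurable_continuous_onI)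
  fix l u :: 'a assume lu: "\<And>b. b \<in> Basis \<Longrightarrow> l \<bullet> b \<le> u \<bullet> b"
  have "open (T -` box l u)" using cont by (simp add: continuous_on_open_vimage open_box)
  then have "emeasure lebesgue (T ` (T -` box l u)) = emeasure lebesgue (T -` box l u)"
    by (rule emeasure_orthogonal_image_open[OF T])
  moreover have "T ` (T -` box l u) = box l u"
    using orthogonal_transformation_surj[OF T] by (simp add: surj_image_vimage_eq)
  moreover have "T -` box l u \<in> sets borel" using \<open>open (T -` box l u)\<close> by simp
  ultimately have "emeasure lborel (T -` box l u) = emeasure lborel (box l u)" by simp
  moreover have "emeasure (distr lborel borel T) (box l u) = emeasure lborel (T -` box l u)"
    using meas by (subst emeasure_distr) auto
  ultimately show "emeasure (distr lborel borel T) (box l u) = ennreal (\<Prod>b\<in>Basis. (u - l) \<bullet> b)"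
    using lu by (simp add: emeasure_lborel_box)
qed simp

definition frame_map :: "('n::finite \<Rightarrow> real^'n) \<Rightarrow> real^'n \<Rightarrow> real^'n" where
  "frame_map e v = (\<Sum>i\<in>UNIV. v $ i *\<^sub>R e i)"

lemma frame_map_inner:
  assumes "orthonormal_basis e"
  shows "frame_map e v \<bullet> e i = v $ i"
proof -
  have "frame_map e v \<bullet> e i = (\<Sum>j\<in>UNIV. if j = i then v $ j else 0)"
    unfolding frame_map_def inner_sum_left using assms
    by (intro sum.cong) (auto simp: orthonormal_basis_def)
  then show ?thesis by simp
qed

lemma frame_map_orthogonal:
  assumes "orthonormal_basis e"
  shows "orthogonal_transformation (frame_map e)"
  unfolding orthogonal_transformation_def
proof (intro conjI allI)
  show "linear (frame_map e)"
    by (rule linearI) (simp_all add: frame_map_def scaleR_add_left sum.distrib scaleR_sum_right)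
  fix v w
  have "frame_map e v \<bullet> frame_map e w = (\<Sum>i\<in>UNIV. w $ i * (frame_map e v \<bullet> e i))"
    unfolding frame_map_def[of e w] by (simp add: inner_sum_right)
  then show "frame_map e v \<bullet> frame_map e w = v \<bullet> w"
    unfolding frame_map_inner[OF assms] by (simp add: inner_vec_def mult.commute)
qed

lemma orthonormal_expansion:
  assumes "orthonormal_basis e"
  shows "x = (\<Sum>i\<in>UNIV. (x \<bullet> e i) *\<^sub>R e i)"
proof -
  obtain v where v: "x = frame_map e v"
    using orthogonal_transformation_surj[OF frame_map_orthogonal[OF assms]] by (metis surjD)
  show ?thesis unfolding v frame_map_inner[OF assms] by (simp add: frame_map_def)
qed

lemma orthonormal_inner:
  assumes "orthonormal_basis e"
  shows "x \<bullet> y = (\<Sum>i\<in>UNIV. (x \<bullet> e i) * (y \<bullet> e i))"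
  by (subst orthonormal_expansion[OF assms, of y]) (simp add: inner_sum_right mult.commute)

lemma orthonormal_eqI:
  assumes "orthonormal_basis e" "\<And>i. x \<bullet> e i = y \<bullet> e i"
  shows "x = y"
  using orthonormal_expansion[OF assms(1), of x] orthonormal_expansion[OF assms(1), of y] assms(2) by simp

lemma nn_integral_frame_map:
  assumes e: "orthonormal_basis e" and f: "f \<in> borel_measurable borel"
  shows "(\<integral>\<^sup>+v. f (frame_map e v) \<partial>lborel) = (\<integral>\<^sup>+x. f x \<partial>lborel)"
proof -
  have "frame_map e \<in> measurable lborel borel"
    by (simp add: borel_measurable_continuous_onI orthogonal_transformation_continuous_on frame_map_orthogonal[OF e])
  then have "(\<integral>\<^sup>+v. f (frame_map e v) \<partial>lborel) = (\<integral>\<^sup>+x. f x \<partial>distr lborel borel (frame_map e))"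
    using f by (subst nn_integral_distr) auto
  then show ?thesis by (simp add: lborel_distr_orthogonal[OF frame_map_orthogonal[OF e]])
qed

lemma borel_measurable_frame_map:
  assumes e: "orthonormal_basis e" and f: "f \<in> borel_measurable borel"
  shows "(\<lambda>v. f (frame_map e v)) \<in> borel_measurable borel"
proof -
  have "frame_map e \<in> measurable borel borel"
    by (simp add: borel_measurable_continuous_onI orthogonal_transformation_continuous_on frame_map_orthogonal[OF e])
  from measurable_compose[OF this f] show ?thesis .
qed

lemma prekopa_leindler_orthonormal:
  fixes f g h :: "real^'n \<Rightarrow> ennreal"
  assumes e: "orthonormal_basis e"
    and m: "f \<in> borel_measurable borel" "g \<in> borel_measurable borel" "h \<in> borel_measurable borel"
    and t: "0 < t" "t < 1"
    and cond: "\<And>x y z \<alpha> \<beta>. \<lbrakk>\<And>i. x \<bullet> e i \<noteq> 0 \<and> y \<bullet> e i \<noteq> 0 \<and> \<bar>z \<bullet> e i\<bar> = \<bar>x \<bullet> e i\<bar> powr (1 - t) * \<bar>y \<bullet> e i\<bar> powr t;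
      0 < \<alpha>; 0 < \<beta>; ennreal \<alpha> \<le> f x; ennreal \<beta> \<le> g y\<rbrakk> \<Longrightarrow> ennreal (\<alpha> powr (1 - t) * \<beta> powr t) \<le> h z"
    and \<alpha>\<beta>: "0 < \<alpha>" "0 < \<beta>" "ennreal \<alpha> \<le> (\<integral>\<^sup>+x. f x \<partial>lborel)" "ennreal \<beta> \<le> (\<integral>\<^sup>+x. g x \<partial>lborel)"
  shows "ennreal (\<alpha> powr (1 - t) * \<beta> powr t) \<le> (\<integral>\<^sup>+x. h x \<partial>lborel)"
proof -
  note mf = borel_measurable_frame_map[OF e]
  have "ennreal (\<alpha> powr (1 - t) * \<beta> powr t) \<le> (\<integral>\<^sup>+v. h (frame_map e v) \<partial>lborel)"
  proof (rule prekopa_leindler_mult_euclidean[OF mf[OF m(1)] mf[OF m(2)] mf[OF m(3)] t _ \<alpha>\<beta>(1,2)])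
    show "ennreal \<alpha> \<le> (\<integral>\<^sup>+v. f (frame_map e v) \<partial>lborel)" "ennreal \<beta> \<le> (\<integral>\<^sup>+v. g (frame_map e v) \<partial>lborel)"
      using \<alpha>\<beta>(3,4) by (simp_all add: nn_integral_frame_map[OF e] m)
  next
    fix x y z :: "real^'n" and a b :: real
    assume xyz: "\<And>b. b \<in> Basis \<Longrightarrow> x \<bullet> b \<noteq> 0 \<and> y \<bullet> b \<noteq> 0 \<and> \<bar>z \<bullet> b\<bar> = \<bar>x \<bullet> b\<bar> powr (1 - t) * \<bar>y \<bullet> b\<bar> powr t"
      and ab: "0 < a" "0 < b" "ennreal a \<le> f (frame_map e x)" "ennreal b \<le> g (frame_map e y)"
    show "ennreal (a powr (1 - t) * b powr t) \<le> h (frame_map e z)"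
    proof (rule cond[OF _ ab])
      fix i :: 'n
      show "frame_map e x \<bullet> e i \<noteq> 0 \<and> frame_map e y \<bullet> e i \<noteq> 0 \<and>
        \<bar>frame_map e z \<bullet> e i\<bar> = \<bar>frame_map e x \<bullet> e i\<bar> powr (1 - t) * \<bar>frame_map e y \<bullet> e i\<bar> powr t"
        using xyz[of "axis i 1"] by (simp add: frame_map_inner[OF e] axis_in_Basis_iff inner_axis)
    qed
  qed
  then show ?thesis by (simp add: nn_integral_frame_map[OF e m(3)])
qed

definition diag_map :: "('n::finite \<Rightarrow> real^'n) \<Rightarrow> ('n \<Rightarrow> real) \<Rightarrow> real^'n \<Rightarrow> real^'n" where
  "diag_map e d x = (\<Sum>i\<in>UNIV. (d i * (x \<bullet> e i)) *\<^sub>R e i)"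

lemma diag_map_inner:
  assumes "orthonormal_basis e"
  shows "diag_map e d x \<bullet> e i = d i * (x \<bullet> e i)"
  using frame_map_inner[OF assms, of "\<chi> i. d i * (x \<bullet> e i)" i] by (simp add: frame_map_def diag_map_def)

lemma linear_diag_map: "linear (diag_map e d)"
  by (rule linearI)
    (simp_all add: diag_map_def inner_add_left distrib_left scaleR_add_left sum.distrib scaleR_sum_right mult_ac)

lemma measure_diag_map_image:
  fixes S :: "(real^'n) set"
  assumes e: "orthonormal_basis e" and S: "compact S" and d: "\<And>i. d i \<noteq> 0"
  shows "measure lebesgue (diag_map e d ` S) = (\<Prod>i\<in>UNIV. \<bar>d i\<bar>) * measure lebesgue S"
proof -
  have cont: "continuous_on UNIV (diag_map e d)"
    by (simp add: linear_continuous_on linear_conv_bounded_linear[symmetric] linear_diag_map)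
  have inj: "inj (diag_map e d)"
    by (rule injI, rule orthonormal_eqI[OF e]) (metis d diag_map_inner[OF e] mult_cancel_left)
  have bor: "S \<in> sets borel" "diag_map e d ` S \<in> sets borel"
    using S compact_continuous_image[OF continuous_on_subset[OF cont] S] by (auto intro: borel_compact)
  have pre: "indicator (diag_map e d ` S) (diag_map e d x) = (indicator S x :: ennreal)" for x
    using inj by (auto simp: indicator_def inj_image_mem_iff)
  \<comment> \<open>\<open>T\<close> is the same scaling in the standard basis, conjugate to
    \<open>diag_map e d\<close> by the isometry \<open>frame_map e\<close>. It is written in the
    shape of \<open>lborel_affine_euclidean\<close>, including the zero translation.\<close>
  define T :: "real^'n \<Rightarrow> real^'n" where "T x = 0 + (\<Sum>j\<in>Basis. (d (axis_index j) * (x \<bullet> j)) *\<^sub>R j)" for x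
  have T: "T v $ i = d i * v $ i" for v i
  proof -
    have "T v \<bullet> axis i 1 = (\<Sum>j::real^'n\<in>Basis. if j = axis i 1 then d i * v $ i else 0)"
      unfolding T_def add_0 inner_sum_left
    proof (intro sum.cong refl)
      fix j :: "real^'n" assume "j \<in> Basis"
      then have "j \<bullet> axis i 1 = (if j = axis i 1 then 1 else 0)" by (simp add: inner_Basis)
      then show "(d (axis_index j) * (v \<bullet> j)) *\<^sub>R j \<bullet> axis i 1 = (if j = axis i 1 then d i * v $ i else 0)"
        by (auto simp: inner_axis[of v])
    qed
    also have "\<dots> = d i * v $ i" by (subst sum.delta) auto
    finally show ?thesis by (simp add: inner_axis)
  qed
  have conj: "diag_map e d (frame_map e v) = frame_map e (T v)" for v
    by (simp add: diag_map_def frame_map_inner[OF e]) (simp add: frame_map_def T)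
  have Tm: "T \<in> measurable lborel borel" unfolding T_def by measurable
  have prod: "(\<Prod>j\<in>Basis. \<bar>d (axis_index (j::real^'n))\<bar>) = (\<Prod>i\<in>UNIV. \<bar>d i\<bar>)"
    by (rule prod.reindex_bij_witness[of _ "\<lambda>i. axis i 1" axis_index]) (auto simp: axis_index[symmetric])
  have aff: "lborel = density (distr lborel borel T) (\<lambda>_. ennreal (\<Prod>i\<in>UNIV. \<bar>d i\<bar>))"
    using lborel_affine_euclidean[of "\<lambda>j::real^'n. d (axis_index j)" 0] d
    unfolding T_def[symmetric] prod by (simp add: prod_ennreal)
  have mI: "(\<lambda>v. indicator (diag_map e d ` S) (frame_map e v) :: ennreal) \<in> borel_measurable borel"
    by (rule borel_measurable_frame_map[OF e]) (use bor in auto)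
  have "emeasure lborel (diag_map e d ` S) = (\<integral>\<^sup>+x. indicator (diag_map e d ` S) x \<partial>lborel)"
    using bor by simp
  also have "\<dots> = (\<integral>\<^sup>+v. indicator (diag_map e d ` S) (frame_map e v) \<partial>lborel)"
    by (rule nn_integral_frame_map[symmetric, OF e]) (use bor in auto)
  also have "\<dots> = (\<integral>\<^sup>+v. ennreal (\<Prod>i\<in>UNIV. \<bar>d i\<bar>) * indicator (diag_map e d ` S) (frame_map e (T v)) \<partial>lborel)"
    using mI Tm measurable_compose[OF Tm mI]
    by (subst aff) (simp add: nn_integral_density nn_integral_distr nn_integral_cmult)
  also have "\<dots> = ennreal (\<Prod>i\<in>UNIV. \<bar>d i\<bar>) * (\<integral>\<^sup>+v. indicator S (frame_map e v) \<partial>lborel)"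
    using borel_measurable_frame_map[OF e, of "indicator S"] bor
    by (subst nn_integral_cmult[symmetric]) (simp_all add: conj[symmetric] pre)
  also have "(\<integral>\<^sup>+v. indicator S (frame_map e v) \<partial>lborel) = emeasure lborel S"
    using bor by (subst nn_integral_frame_map[OF e]) auto
  finally have "emeasure lborel (diag_map e d ` S) = ennreal (\<Prod>i\<in>UNIV. \<bar>d i\<bar>) * emeasure lborel S" .
  then show ?thesis using bor
    by (simp add: measure_def enn2real_mult prod_nonneg)
qed

section \<open>Monomial weights and equality\<close>

text \<open>If the quantile function of \<open>R\<close> is at most the geometric mean of those of \<open>P\<close> and \<open>Q\<close>, then the
  means satisfy the same inequality by Hoelder; so the reverse inequality between the means forces
  equality in Hoelder, i.e. proportional quantile functions.\<close>

lemma quantile_holder_equality: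
  fixes P Q R :: "real measure"
  assumes P: "real_distribution P" and Q: "real_distribution Q" and R: "real_distribution R"
    and suppP: "AE x in P. 0 < x \<and> x \<le> B" and suppQ: "AE x in Q. 0 < x \<and> x \<le> B"
    and suppR: "AE x in R. 0 < x \<and> x \<le> B"
    and t: "0 < t" "t < 1"
    and comp: "\<And>x y p. \<lbrakk>0 < x; 0 < y; 0 < p; p < 1; p \<le> cdf P x; p \<le> cdf Q y\<rbrakk>
      \<Longrightarrow> p \<le> cdf R (x powr (1 - t) * y powr t)"
    and mean: "(\<integral>x. x \<partial>P) powr (1 - t) * (\<integral>x. x \<partial>Q) powr t \<le> (\<integral>x. x \<partial>R)"
  shows "(\<integral>x. x \<partial>R) = (\<integral>x. x \<partial>P) powr (1 - t) * (\<integral>x. x \<partial>Q) powr t"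
    and "0 < (\<integral>x. x \<partial>P)" and "0 < (\<integral>x. x \<partial>Q)"
    and "Q = distr P borel (\<lambda>x. (\<integral>x. x \<partial>Q) / (\<integral>x. x \<partial>P) * x)"
proof -
  interpret P: cdf_distribution P using P by (simp add: cdf_distribution_def)
  interpret Q: cdf_distribution Q using Q by (simp add: cdf_distribution_def)
  interpret R: cdf_distribution R using R by (simp add: cdf_distribution_def)
  \<comment> \<open>The quantile functions realise all three distributions on one probability space,
    the unit interval, where they can be compared pointwise.\<close>
  define \<Omega> where "\<Omega> = restrict_space lborel {0<..<1::real}"
  interpret \<Omega>: prob_space \<Omega>
    by (auto simp: \<Omega>_def emeasure_restrict_space space_restrict_space intro!: prob_spaceI)
  have sp: "space \<Omega> = {0<..<1}" by (simp add: \<Omega>_def space_restrict_space)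
  define q where "q M p = Inf {x. p \<le> cdf M x}" for M :: "real measure" and p
  have meas_eq: "borel_measurable \<Omega> = borel_measurable (restrict_space borel {0<..<1::real})"
    unfolding \<Omega>_def by (intro measurable_cong_sets sets_restrict_space_cong) auto
  have meas[measurable]: "q P \<in> borel_measurable \<Omega>" "q Q \<in> borel_measurable \<Omega>" "q R \<in> borel_measurable \<Omega>"
    unfolding meas_eq q_def[abs_def] using P.measurable_CI Q.measurable_CI R.measurable_CI by simp_all
  have dist: "distr \<Omega> borel (q P) = P" "distr \<Omega> borel (q Q) = Q" "distr \<Omega> borel (q R) = R"
    unfolding \<Omega>_def q_def[abs_def] by (rule P.distr_I_eq_M Q.distr_I_eq_M R.distr_I_eq_M)+
  have AE_q: "AE p in \<Omega>. 0 < q M p \<and> q M p \<le> B"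
    if d: "distr \<Omega> borel (q M) = M" and "q M \<in> borel_measurable \<Omega>" and s: "AE x in M. 0 < x \<and> x \<le> B" for M
  proof -
    have "AE x in distr \<Omega> borel (q M). 0 < x \<and> x \<le> B" using s by (subst d)
    then show ?thesis using that(2) by (subst (asm) AE_distr_iff) auto
  qed
  note AEs = AE_q[OF dist(1) meas(1) suppP] AE_q[OF dist(2) meas(2) suppQ] AE_q[OF dist(3) meas(3) suppR]
  have int: "integrable \<Omega> (q M)" if "AE p in \<Omega>. 0 < q M p \<and> q M p \<le> B" "q M \<in> borel_measurable \<Omega>" for M
    by (rule \<Omega>.integrable_const_bound[where B = B]) (use that in auto)
  note ints = int[OF AEs(1) meas(1)] int[OF AEs(2) meas(2)] int[OF AEs(3) meas(3)]
  have mean_q: "(\<integral>x. x \<partial>M) = (\<integral>p. q M p \<partial>\<Omega>)"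
    if d: "distr \<Omega> borel (q M) = M" and "q M \<in> borel_measurable \<Omega>" for M
    using integral_distr[OF that(2), of "\<lambda>x. x"] by (simp add: d)
  define mP mQ mR where "mP = (\<integral>x. x \<partial>P)" and "mQ = (\<integral>x. x \<partial>Q)" and "mR = (\<integral>x. x \<partial>R)"
  have mq: "mP = (\<integral>p. q P p \<partial>\<Omega>)" "mQ = (\<integral>p. q Q p \<partial>\<Omega>)" "mR = (\<integral>p. q R p \<partial>\<Omega>)"
    unfolding mP_def mQ_def mR_def using mean_q dist meas by auto
  have pos: "0 < (\<integral>p. q M p \<partial>\<Omega>)"
    if A: "AE p in \<Omega>. 0 < q M p \<and> q M p \<le> B" and i: "integrable \<Omega> (q M)" for M
  proof -
    have nn: "AE p in \<Omega>. 0 \<le> q M p" using A by auto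
    have "(\<integral>p. q M p \<partial>\<Omega>) \<noteq> 0"
    proof
      assume "(\<integral>p. q M p \<partial>\<Omega>) = 0"
      then have "AE p in \<Omega>. q M p = 0" using integral_nonneg_eq_0_iff_AE[OF i nn] by simp
      with A have "AE p in \<Omega>. False" by eventually_elim auto
      then show False using \<Omega>.AE_False by simp
    qed
    moreover have "0 \<le> (\<integral>p. q M p \<partial>\<Omega>)" by (rule integral_nonneg_AE[OF nn])
    ultimately show ?thesis by simp
  qed
  have mpos: "0 < mP" "0 < mQ" unfolding mq by (rule pos[OF AEs(1) ints(1)] pos[OF AEs(2) ints(2)])+
  then show "0 < (\<integral>x. x \<partial>P)" "0 < (\<integral>x. x \<partial>Q)" by (simp_all add: mP_def mQ_def)
  define G where "G = mP powr (1 - t) * mQ powr t"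
  have G: "0 < G" using mpos by (simp add: G_def)
  \<comment> \<open>Almost everywhere \<open>D\<close> is at least 0, by the quantile inequality
    followed by AM-GM. Its integral is \<open>1 - mR / G\<close>, which the assumption on the means
    makes at most 0. So both inequalities are equalities almost everywhere.\<close>
  define D where "D p = (1 - t) * (q P p / mP) + t * (q Q p / mQ) - q R p / G" for p
  have le: "AE p in \<Omega>. q R p / G \<le> (q P p / mP) powr (1 - t) * (q Q p / mQ) powr t"
    using AEs(1) AEs(2) AE_space
  proof eventually_elim
    case (elim p)
    then have p: "0 < p" "p < 1" by (auto simp: sp)
    \<comment> \<open>The Galois connection between a distribution function and its quantile
      function turns \<open>comp\<close> into an inequality between quantiles at the same
      \<open>p\<close>.\<close>
    have inv: "p \<le> cdf P x \<longleftrightarrow> q P p \<le> x" "p \<le> cdf Q x \<longleftrightarrow> q Q p \<le> x" "p \<le> cdf R x \<longleftrightarrow> q R p \<le> x" for x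
      unfolding q_def by (rule P.pseudoinverse[OF p] Q.pseudoinverse[OF p] R.pseudoinverse[OF p])+
    have "p \<le> cdf P (q P p)" unfolding inv by (rule order.refl)
    moreover have "p \<le> cdf Q (q Q p)" unfolding inv by (rule order.refl)
    ultimately have "p \<le> cdf R (q P p powr (1 - t) * q Q p powr t)" using comp elim p by blast
    then have "q R p \<le> q P p powr (1 - t) * q Q p powr t" unfolding inv(3) .
    also have "\<dots> = G * ((q P p / mP) powr (1 - t) * (q Q p / mQ) powr t)"
      unfolding G_def using elim mpos by (intro geometric_mean_normalize) auto
    finally show ?case using G by (simp add: divide_le_eq mult.commute)
  qed
  have D_nn: "AE p in \<Omega>. 0 \<le> D p"
    using le AEs(1) AEs(2)
  proof eventually_elim
    case (elim p)
    have "(q P p / mP) powr (1 - t) * (q Q p / mQ) powr t \<le> (1 - t) * (q P p / mP) + t * (q Q p / mQ)"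
      using elim mpos t by (intro weighted_am_gm) auto
    then show ?case using elim by (simp add: D_def)
  qed
  have D_int: "integrable \<Omega> D" unfolding D_def[abs_def] using ints by auto
  have "(\<integral>p. D p \<partial>\<Omega>) = (1 - t) * (mP / mP) + t * (mQ / mQ) - mR / G"
    unfolding D_def mq using ints by simp
  then have ID: "(\<integral>p. D p \<partial>\<Omega>) = 1 - mR / G" using mpos by simp
  have "0 \<le> (\<integral>p. D p \<partial>\<Omega>)" by (rule integral_nonneg_AE[OF D_nn])
  moreover have "1 \<le> mR / G" using mean G by (simp add: G_def mP_def mQ_def mR_def)
  ultimately have one: "mR / G = 1" and D0: "(\<integral>p. D p \<partial>\<Omega>) = 0" using ID by auto
  from one show "(\<integral>x. x \<partial>R) = (\<integral>x. x \<partial>P) powr (1 - t) * (\<integral>x. x \<partial>Q) powr t"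
    using G by (simp add: G_def mP_def mQ_def mR_def)
  have D0': "AE p in \<Omega>. D p = 0" using integral_nonneg_eq_0_iff_AE[OF D_int D_nn] D0 by simp
  have ratio: "AE p in \<Omega>. q Q p = mQ / mP * q P p"
    using D0' le AEs(1) AEs(2)
  proof eventually_elim
    case (elim p)
    have "(q P p / mP) powr (1 - t) * (q Q p / mQ) powr t \<le> (1 - t) * (q P p / mP) + t * (q Q p / mQ)"
      using elim mpos t by (intro weighted_am_gm) auto
    then have "(q P p / mP) powr (1 - t) * (q Q p / mQ) powr t = (1 - t) * (q P p / mP) + t * (q Q p / mQ)"
      using elim by (simp add: D_def)
    then have "q P p / mP = q Q p / mQ"
      by (rule weighted_am_gm_eq[OF _ _ t, rotated -1]) (use elim mpos in simp_all)
    then show ?case using mpos by (simp add: field_simps)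
  qed
  have "Q = distr \<Omega> borel (q Q)" by (simp add: dist)
  also have "\<dots> = distr \<Omega> borel (\<lambda>p. mQ / mP * q P p)"
    by (rule distr_cong_AE) (use ratio in auto)
  also have "\<dots> = distr (distr \<Omega> borel (q P)) borel (\<lambda>x. mQ / mP * x)"
    by (subst distr_distr) (auto simp: comp_def)
  finally show "Q = distr P borel (\<lambda>x. (\<integral>x. x \<partial>Q) / (\<integral>x. x \<partial>P) * x)" by (simp add: dist mP_def mQ_def)
qed

text \<open>The monomial weight \<open>\<Prod>i. \<bar>x\<^sub>i\<bar> powr a\<^sub>i\<close>, except that a vanishing coordinate contributes
  the factor \<open>1\<close> because \<open>ln 0 = 0\<close>; such points form a null set.\<close>

definition coord_weight :: "('n::finite \<Rightarrow> real^'n) \<Rightarrow> ('n \<Rightarrow> real) \<Rightarrow> real^'n \<Rightarrow> real" where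
  "coord_weight e a x = exp (\<Sum>i\<in>UNIV. a i * ln \<bar>x \<bullet> e i\<bar>)"

definition weighted_measure :: "('n::finite \<Rightarrow> real^'n) \<Rightarrow> ('n \<Rightarrow> real) \<Rightarrow> (real^'n) measure" where
  "weighted_measure e a = density lborel (\<lambda>x. ennreal (coord_weight e a x))"

text \<open>A relation rather than a function because the signs of the coordinates of
  \<open>z\<close> are free.\<close>

definition geometric_mean_point ::
  "('n::finite \<Rightarrow> real^'n) \<Rightarrow> real \<Rightarrow> real^'n \<Rightarrow> real^'n \<Rightarrow> real^'n \<Rightarrow> bool" where
  "geometric_mean_point e t x y z \<longleftrightarrow>
    (\<forall>i. x \<bullet> e i \<noteq> 0 \<and> y \<bullet> e i \<noteq> 0 \<and> \<bar>z \<bullet> e i\<bar> = \<bar>x \<bullet> e i\<bar> powr (1 - t) * \<bar>y \<bullet> e i\<bar> powr t)"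

lemma coord_weight_pos [simp]: "0 < coord_weight e a x"
  by (simp add: coord_weight_def)

lemma coord_weight_nonneg [simp]: "0 \<le> coord_weight e a x"
  by (simp add: coord_weight_def)

lemma coord_weight_measurable [measurable]: "coord_weight e a \<in> borel_measurable borel"
  unfolding coord_weight_def[abs_def] by measurable

lemma coord_weight_add: "coord_weight e (\<lambda>i. a i + b i) x = coord_weight e a x * coord_weight e b x"
  by (simp add: coord_weight_def distrib_right sum.distrib exp_add)

lemma coord_weight_zero [simp]: "coord_weight e (\<lambda>_. 0) x = 1"
  by (simp add: coord_weight_def)

text \<open>The logarithm of the weight is linear in the logarithms of the absolute coordinates, and
  a geometric mean of points combines these affinely.\<close>

lemma coord_weight_geometric_mean:
  assumes "geometric_mean_point e t x y z"
  shows "coord_weight e a z = coord_weight e a x powr (1 - t) * coord_weight e a y powr t"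
proof -
  have "ln \<bar>z \<bullet> e i\<bar> = (1 - t) * ln \<bar>x \<bullet> e i\<bar> + t * ln \<bar>y \<bullet> e i\<bar>" for i
  proof -
    have "x \<bullet> e i \<noteq> 0" "y \<bullet> e i \<noteq> 0" "\<bar>z \<bullet> e i\<bar> = \<bar>x \<bullet> e i\<bar> powr (1 - t) * \<bar>y \<bullet> e i\<bar> powr t"
      using assms by (auto simp: geometric_mean_point_def)
    then show ?thesis by (simp add: ln_mult ln_powr)
  qed
  then have "(\<Sum>i\<in>UNIV. a i * ln \<bar>z \<bullet> e i\<bar>)
      = (1 - t) * (\<Sum>i\<in>UNIV. a i * ln \<bar>x \<bullet> e i\<bar>) + t * (\<Sum>i\<in>UNIV. a i * ln \<bar>y \<bullet> e i\<bar>)"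
    by (simp add: distrib_left sum.distrib sum_distrib_left mult_ac)
  then show ?thesis by (simp add: coord_weight_def powr_def exp_add)
qed

lemma coord_weight_bounded:
  assumes e: "orthonormal_basis e" and S: "bounded S" and a: "\<And>i. 0 \<le> a i"
  shows "\<exists>B>0. \<forall>x\<in>S. coord_weight e a x \<le> B"
proof -
  obtain r where r: "\<And>x. x \<in> S \<Longrightarrow> norm x \<le> r" using S by (auto simp: bounded_iff)
  \<comment> \<open>Taking \<open>R\<close> at least 1 makes \<open>ln R\<close> nonnegative, which
    covers vanishing coordinates, where the logarithm has the value 0.\<close>
  define R where "R = max r 1"
  have "coord_weight e a x \<le> exp (\<Sum>i\<in>UNIV. a i * ln R)" if x: "x \<in> S" for x
    unfolding coord_weight_def exp_le_cancel_iff
  proof (intro sum_mono mult_left_mono a)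
    fix i
    have "e i \<bullet> e i = 1" using e by (simp add: orthonormal_basis_def)
    then have "norm (e i) = 1" by (simp add: norm_eq_sqrt_inner)
    then have "\<bar>x \<bullet> e i\<bar> \<le> R" using Cauchy_Schwarz_ineq2[of x "e i"] r[OF x] by (simp add: R_def)
    then show "ln \<bar>x \<bullet> e i\<bar> \<le> ln R" by (cases "x \<bullet> e i = 0") (auto simp: R_def)
  qed
  then show ?thesis by (intro exI[of _ "exp (\<Sum>i\<in>UNIV. a i * ln R)"]) simp
qed

lemma sets_weighted_measure [simp, measurable_cong]: "sets (weighted_measure e a) = sets borel"
  by (simp add: weighted_measure_def)

lemma space_weighted_measure [simp]: "space (weighted_measure e a) = UNIV"
  by (simp add: weighted_measure_def)

lemma weighted_measure_zero: "weighted_measure e (\<lambda>_. 0) = lborel"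
  by (simp add: weighted_measure_def density_1)

lemma emeasure_weighted_measure:
  assumes "S \<in> sets borel"
  shows "emeasure (weighted_measure e a) S = (\<integral>\<^sup>+x. ennreal (coord_weight e a x) * indicator S x \<partial>lborel)"
  unfolding weighted_measure_def using assms by (subst emeasure_density) auto

lemma nn_integral_weighted_measure:
  assumes S: "S \<in> sets borel"
  shows "(\<integral>\<^sup>+x. ennreal (coord_weight e l x) * indicator S x \<partial>weighted_measure e a)
    = emeasure (weighted_measure e (\<lambda>i. a i + l i)) S"
proof -
  have "(\<integral>\<^sup>+x. ennreal (coord_weight e l x) * indicator S x \<partial>weighted_measure e a)
      = (\<integral>\<^sup>+x. ennreal (coord_weight e a x) * (ennreal (coord_weight e l x) * indicator S x) \<partial>lborel)"
    unfolding weighted_measure_def using S by (subst nn_integral_density) auto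
  then show ?thesis
    by (simp add: emeasure_weighted_measure[OF S] coord_weight_add ennreal_mult mult.assoc)
qed

lemma emeasure_weighted_measure_finite:
  assumes e: "orthonormal_basis e" and S: "S \<in> sets borel" "bounded S" and a: "\<And>i. 0 \<le> a i"
  shows "emeasure (weighted_measure e a) S < \<infinity>"
proof -
  obtain B where B: "0 < B" "\<And>x. x \<in> S \<Longrightarrow> coord_weight e a x \<le> B"
    using coord_weight_bounded[of e S a, OF e S(2) a] by auto
  have "emeasure (weighted_measure e a) S \<le> (\<integral>\<^sup>+x. ennreal B * indicator S x \<partial>lborel)"
    unfolding emeasure_weighted_measure[OF S(1)] using B
    by (intro nn_integral_mono) (auto simp: indicator_def ennreal_leI)
  also have "\<dots> = ennreal B * emeasure lborel S" using S by (simp add: nn_integral_cmult)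
  also have "\<dots> < \<infinity>" using emeasure_bounded_finite[OF S(2)] by (simp add: ennreal_mult_less_top)
  finally show ?thesis .
qed

text \<open>Suprema of weights will be read off from null superlevel sets. This lets them be
  compared across different exponents \<open>a\<close>.\<close>

lemma weighted_measure_null_iff:
  assumes S: "S \<in> sets borel"
  shows "emeasure (weighted_measure e a) S = 0 \<longleftrightarrow> emeasure lborel S = 0"
proof -
  have "emeasure (weighted_measure e a) S = 0
      \<longleftrightarrow> (AE x in lborel. ennreal (coord_weight e a x) * indicator S x = 0)"
    unfolding emeasure_weighted_measure[OF S] using S by (subst nn_integral_0_iff_AE) auto
  also have "\<dots> \<longleftrightarrow> (AE x in lborel. x \<notin> S)"
    using coord_weight_pos[of e a] by (intro AE_cong) (simp add: indicator_def less_le)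
  also have "\<dots> \<longleftrightarrow> emeasure lborel S = 0" using S by (subst AE_iff_measurable[of S]) auto
  finally show ?thesis .
qed

section \<open>The weighted inequality and the inheritance of equality\<close>

lemma weighted_prekopa_leindler:
  assumes e: "orthonormal_basis e" and a: "\<And>i. 0 \<le> a i" and t: "0 < t" "t < 1"
    and S: "S \<in> sets borel" "bounded S" and T: "T \<in> sets borel" "bounded T" and U: "U \<in> sets borel" "bounded U"
    and sub: "\<And>x y z. \<lbrakk>x \<in> S; y \<in> T; geometric_mean_point e t x y z\<rbrakk> \<Longrightarrow> z \<in> U"
  shows "measure (weighted_measure e a) S powr (1 - t) * measure (weighted_measure e a) T powr t
    \<le> measure (weighted_measure e a) U"
proof (cases "measure (weighted_measure e a) S = 0 \<or> measure (weighted_measure e a) T = 0")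
  case True
  then show ?thesis by auto
next
  case False
  let ?\<mu> = "weighted_measure e a"
  let ?f = "\<lambda>S x. ennreal (coord_weight e a x) * indicator S x"
  have em: "ennreal (measure ?\<mu> S) = (\<integral>\<^sup>+x. ?f S x \<partial>lborel)" if "S \<in> sets borel" "bounded S" for S
    using emeasure_weighted_measure_finite[OF e that a] emeasure_weighted_measure[OF that(1), of e a]
    by (simp add: emeasure_eq_ennreal_measure less_top)
  have meas: "?f S \<in> borel_measurable borel" if "S \<in> sets borel" for S
    using that by measurable
  have pos: "0 < measure ?\<mu> S" "0 < measure ?\<mu> T" using False by (auto simp: zero_less_measure_iff)
  have "ennreal (measure ?\<mu> S powr (1 - t) * measure ?\<mu> T powr t) \<le> (\<integral>\<^sup>+x. ?f U x \<partial>lborel)"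
  proof (rule prekopa_leindler_orthonormal[OF e meas[OF S(1)] meas[OF T(1)] meas[OF U(1)] t _ pos])
    fix x y z \<alpha> \<beta>
    assume xyz: "\<And>i. x \<bullet> e i \<noteq> 0 \<and> y \<bullet> e i \<noteq> 0 \<and> \<bar>z \<bullet> e i\<bar> = \<bar>x \<bullet> e i\<bar> powr (1 - t) * \<bar>y \<bullet> e i\<bar> powr t"
      and ab: "0 < \<alpha>" "0 < \<beta>" "ennreal \<alpha> \<le> ?f S x" "ennreal \<beta> \<le> ?f T y"
    then have g: "geometric_mean_point e t x y z" by (simp add: geometric_mean_point_def)
    have x: "x \<in> S" "\<alpha> \<le> coord_weight e a x" and y: "y \<in> T" "\<beta> \<le> coord_weight e a y"
      using ab by (cases "x \<in> S"; cases "y \<in> T"; simp)+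
    have "z \<in> U" using sub g x y by blast
    moreover have "\<alpha> powr (1 - t) * \<beta> powr t \<le> coord_weight e a z"
      unfolding coord_weight_geometric_mean[OF g] using x y ab t
      by (intro mult_mono powr_mono2) auto
    ultimately show "ennreal (\<alpha> powr (1 - t) * \<beta> powr t) \<le> ?f U z" by (simp add: ennreal_leI)
  qed (use em S T in auto)
  then show ?thesis by (simp add: em[OF U, symmetric])
qed

text \<open>\<open>quantile_holder_equality\<close> is applied to the laws \<open>D X\<close> of the
  weight \<open>l\<close> on \<open>S\<close>, \<open>T\<close> and \<open>U\<close>. Given equality
  for \<open>a\<close>, the inequality on sublevel sets becomes its hypothesis on quantiles. The
  inequality for the exponents \<open>a + l\<close> becomes its hypothesis on means, since the mean
  of \<open>D X\<close> is the quotient of the two weighted measures of \<open>X\<close>. The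
  constant \<open>c\<close> is the quotient of the means, hence the factor between the laws.\<close>

lemma weighted_equality_inherit:
  fixes S T U :: "(real^'n) set"
  assumes e: "orthonormal_basis e" and a: "\<And>i. 0 \<le> a i" and l: "\<And>i. 0 \<le> l i" and t: "0 < t" "t < 1"
    and S: "S \<in> sets borel" "bounded S" and T: "T \<in> sets borel" "bounded T" and U: "U \<in> sets borel" "bounded U"
    and sub: "\<And>x y z. \<lbrakk>x \<in> S; y \<in> T; geometric_mean_point e t x y z\<rbrakk> \<Longrightarrow> z \<in> U"
    and pos: "0 < measure (weighted_measure e a) S" "0 < measure (weighted_measure e a) T"
    and eq: "measure (weighted_measure e a) U
      = measure (weighted_measure e a) S powr (1 - t) * measure (weighted_measure e a) T powr t"
  defines "b \<equiv> (\<lambda>i. a i + l i)"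
  defines "c \<equiv> (measure (weighted_measure e b) T / measure (weighted_measure e a) T)
    / (measure (weighted_measure e b) S / measure (weighted_measure e a) S)"
  shows "0 < measure (weighted_measure e b) S" and "0 < measure (weighted_measure e b) T"
    and "measure (weighted_measure e b) U
      = measure (weighted_measure e b) S powr (1 - t) * measure (weighted_measure e b) T powr t"
    and "emeasure lborel {x \<in> T. c * r < coord_weight e l x} = 0 \<longleftrightarrow> emeasure lborel {x \<in> S. r < coord_weight e l x} = 0"
proof -
  let ?\<mu> = "weighted_measure e a" and ?\<nu> = "weighted_measure e b" and ?w = "coord_weight e l"
  have b: "0 \<le> b i" for i using a l by (simp add: b_def)
  have Upos: "0 < measure ?\<mu> U" using pos by (simp add: eq)
  have bnd: "bounded (S \<union> T \<union> U)" using S T U by simp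
  obtain B where B: "\<And>x. x \<in> S \<union> T \<union> U \<Longrightarrow> ?w x \<le> B"
    using coord_weight_bounded[of e "S \<union> T \<union> U" l, OF e bnd l] by auto
  define D where "D X = distr (uniform_measure ?\<mu> X) borel ?w" for X
  have fin: "emeasure ?\<mu> X < \<infinity>" if "X \<in> sets borel" "bounded X" for X
    using emeasure_weighted_measure_finite[OF e that a] .
  have em: "emeasure ?\<mu> X = ennreal (measure ?\<mu> X)" if "X \<in> sets borel" "bounded X" for X
    using fin[OF that] by (simp add: emeasure_eq_ennreal_measure less_top)
  have em': "emeasure ?\<nu> X = ennreal (measure ?\<nu> X)" if "X \<in> sets borel" "bounded X" for X
    using emeasure_weighted_measure_finite[OF e that b] by (simp add: emeasure_eq_ennreal_measure less_top)
  have D_dist: "real_distribution (D X)" if X: "X \<in> sets borel" "bounded X" "0 < measure ?\<mu> X" for X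
  proof -
    have "prob_space (uniform_measure ?\<mu> X)"
      using em[OF X(1,2)] X by (intro prob_space_uniform_measure) auto
    then have "prob_space (D X)" unfolding D_def by (rule prob_space.prob_space_distr) simp
    then show ?thesis by (simp add: real_distribution_def real_distribution_axioms_def D_def)
  qed
  have D_meas: "measure (D X) A = measure ?\<mu> (X \<inter> ?w -` A) / measure ?\<mu> X"
    if X: "X \<in> sets borel" "bounded X" "0 < measure ?\<mu> X" and A: "A \<in> sets borel" for X A
  proof -
    have "?w -` A \<in> sets borel" using measurable_sets[OF coord_weight_measurable A, of e l] by simp
    then have "measure (uniform_measure ?\<mu> X) (?w -` A) = measure ?\<mu> (X \<inter> ?w -` A) / measure ?\<mu> X"
      using em[OF X(1,2)] X by (intro measure_uniform_measure) auto
    then show ?thesis unfolding D_def using A by (subst measure_distr) auto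
  qed
  have D_cdf: "cdf (D X) x = measure ?\<mu> {y \<in> X. ?w y \<le> x} / measure ?\<mu> X"
    if X: "X \<in> sets borel" "bounded X" "0 < measure ?\<mu> X" for X x
  proof -
    have "X \<inter> ?w -` {..x} = {y \<in> X. ?w y \<le> x}" by auto
    then show ?thesis unfolding cdf_def by (subst D_meas[OF X]) auto
  qed
  have D_AE: "AE x in D X. 0 < x \<and> x \<le> B" if X: "X \<in> sets borel" "X \<subseteq> S \<union> T \<union> U" for X
  proof -
    have "AE x in uniform_measure ?\<mu> X. 0 < ?w x \<and> ?w x \<le> B"
      by (rule AE_uniform_measureI) (use X B in auto)
    then show ?thesis unfolding D_def by (subst AE_distr_iff) auto
  qed
  have D_mean: "(\<integral>x. x \<partial>D X) = measure ?\<nu> X / measure ?\<mu> X"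
    if X: "X \<in> sets borel" "bounded X" "0 < measure ?\<mu> X" for X
  proof -
    have "(\<integral>x. x \<partial>D X) = (\<integral>x. ?w x \<partial>uniform_measure ?\<mu> X)"
      unfolding D_def by (subst integral_distr) auto
    also have "\<dots> = enn2real (\<integral>\<^sup>+x. ennreal (?w x) \<partial>uniform_measure ?\<mu> X)"
      by (rule integral_eq_nn_integral) auto
    also have "(\<integral>\<^sup>+x. ennreal (?w x) \<partial>uniform_measure ?\<mu> X)
        = (\<integral>\<^sup>+x. ennreal (?w x) * indicator X x \<partial>?\<mu>) / emeasure ?\<mu> X"
      using X by (intro nn_integral_uniform_measure) auto
    also have "\<dots> = ennreal (measure ?\<nu> X) / ennreal (measure ?\<mu> X)"
      unfolding nn_integral_weighted_measure[OF X(1)] b_def[symmetric] em'[OF X(1,2)] em[OF X(1,2)] ..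
    also have "\<dots> = ennreal (measure ?\<nu> X / measure ?\<mu> X)" using X by (intro divide_ennreal) auto
    finally show ?thesis by (simp add: measure_nonneg)
  qed
  have comp: "p \<le> cdf (D U) (x powr (1 - t) * y powr t)"
    if xy: "0 < x" "0 < y" and p: "0 < p" "p < 1" and px: "p \<le> cdf (D S) x" and py: "p \<le> cdf (D T) y" for x y p
  proof -
    have level: "{z \<in> X. ?w z \<le> x} \<in> sets borel" "bounded {z \<in> X. ?w z \<le> x}"
      if "X \<in> sets borel" "bounded X" for X x
      using that by (auto intro: bounded_subset)
    have 1: "p * measure ?\<mu> S \<le> measure ?\<mu> {z \<in> S. ?w z \<le> x}"
      using px pos by (simp add: D_cdf[OF S pos(1)] le_divide_eq)
    have 2: "p * measure ?\<mu> T \<le> measure ?\<mu> {z \<in> T. ?w z \<le> y}"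
      using py pos by (simp add: D_cdf[OF T pos(2)] le_divide_eq)
    \<comment> \<open>Equality for \<open>a\<close> enters here: a fraction \<open>p\<close> of
      \<open>S\<close> and of \<open>T\<close> has the fraction \<open>p\<close> of \<open>U\<close>
      as its geometric mean, so weighted Prekopa-Leindler yields a sublevel set with at least that
      fraction of \<open>U\<close>.\<close>
    have "p * measure ?\<mu> U = (p * measure ?\<mu> S) powr (1 - t) * (p * measure ?\<mu> T) powr t"
      unfolding eq using p pos by (subst geometric_mean_scale) (auto simp: powr_add[symmetric])
    also have "\<dots> \<le> measure ?\<mu> {z \<in> S. ?w z \<le> x} powr (1 - t) * measure ?\<mu> {z \<in> T. ?w z \<le> y} powr t"
      using 1 2 p t by (intro mult_mono powr_mono2) auto
    also have "\<dots> \<le> measure ?\<mu> {z \<in> U. ?w z \<le> x powr (1 - t) * y powr t}"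
    proof (rule weighted_prekopa_leindler[OF e a t level[OF S] level[OF T] level[OF U]])
      fix u v z
      assume u: "u \<in> {z \<in> S. ?w z \<le> x}" and v: "v \<in> {z \<in> T. ?w z \<le> y}" and g: "geometric_mean_point e t u v z"
      have "z \<in> U" using sub u v g by blast
      moreover have "?w z \<le> x powr (1 - t) * y powr t"
        unfolding coord_weight_geometric_mean[OF g] using u v t by (intro mult_mono powr_mono2) auto
      ultimately show "z \<in> {z \<in> U. ?w z \<le> x powr (1 - t) * y powr t}" by simp
    qed
    finally show ?thesis using Upos by (simp add: D_cdf[OF U Upos] le_divide_eq)
  qed
  have "measure ?\<nu> S powr (1 - t) * measure ?\<nu> T powr t \<le> measure ?\<nu> U"
    by (rule weighted_prekopa_leindler[OF e b t S T U sub])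
  then have "(measure ?\<nu> S / measure ?\<mu> S) powr (1 - t) * (measure ?\<nu> T / measure ?\<mu> T) powr t \<le> measure ?\<nu> U / measure ?\<mu> U"
    unfolding eq using pos by (simp add: powr_divide divide_right_mono)
  then have mean: "(\<integral>x. x \<partial>D S) powr (1 - t) * (\<integral>x. x \<partial>D T) powr t \<le> (\<integral>x. x \<partial>D U)"
    by (simp add: D_mean[OF S pos(1)] D_mean[OF T pos(2)] D_mean[OF U Upos])
  note Q = quantile_holder_equality[OF D_dist[OF S pos(1)] D_dist[OF T pos(2)] D_dist[OF U Upos]
      D_AE[OF S(1)] D_AE[OF T(1)] D_AE[OF U(1)] t comp mean]
  have Q1: "(\<integral>x. x \<partial>D U) = (\<integral>x. x \<partial>D S) powr (1 - t) * (\<integral>x. x \<partial>D T) powr t" by (rule Q(1)) auto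
  have Q2: "0 < (\<integral>x. x \<partial>D S)" by (rule Q(2)) auto
  have Q3: "0 < (\<integral>x. x \<partial>D T)" by (rule Q(3)) auto
  have Q4: "D T = distr (D S) borel (\<lambda>x. (\<integral>x. x \<partial>D T) / (\<integral>x. x \<partial>D S) * x)" by (rule Q(4)) auto
  show nS: "0 < measure ?\<nu> S" and nT: "0 < measure ?\<nu> T"
    using Q2 Q3 pos by (auto simp: D_mean[OF S pos(1)] D_mean[OF T pos(2)] zero_less_divide_iff)
  have "measure ?\<nu> U / measure ?\<mu> U = (measure ?\<nu> S / measure ?\<mu> S) powr (1 - t) * (measure ?\<nu> T / measure ?\<mu> T) powr t"
    using Q1 by (simp add: D_mean[OF S pos(1)] D_mean[OF T pos(2)] D_mean[OF U Upos])
  also have "\<dots> = measure ?\<nu> S powr (1 - t) * measure ?\<nu> T powr t / measure ?\<mu> U"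
    unfolding eq using pos by (simp add: powr_divide)
  finally show "measure ?\<nu> U = measure ?\<nu> S powr (1 - t) * measure ?\<nu> T powr t" using Upos by simp
  have c: "c = (\<integral>x. x \<partial>D T) / (\<integral>x. x \<partial>D S)"
    by (simp add: c_def D_mean[OF S pos(1)] D_mean[OF T pos(2)])
  have cpos: "0 < c" using Q2 Q3 by (simp add: c)
  \<comment> \<open>Of the proportionality of the laws only the masses beyond corresponding levels
    are retained; they detect the essential suprema of the weight.\<close>
  have "measure (D T) {c * r<..} = measure (distr (D S) borel (\<lambda>x. c * x)) {c * r<..}"
    using Q4 by (simp add: c)
  also have "\<dots> = measure (D S) ((\<lambda>x. c * x) -` {c * r<..} \<inter> space (D S))"
    by (rule measure_distr) (auto simp: D_def)
  also have "(\<lambda>x. c * x) -` {c * r<..} \<inter> space (D S) = {r<..}" using cpos by (auto simp: D_def)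
  finally have mr: "measure (D T) {c * r<..} = measure (D S) {r<..}" .
  have lev: "emeasure lborel {x \<in> X. s < ?w x} = 0 \<longleftrightarrow> measure (D X) {s<..} = 0"
    if X: "X \<in> sets borel" "bounded X" "0 < measure ?\<mu> X" for X s
  proof -
    have 1: "X \<inter> ?w -` {s<..} = {x \<in> X. s < ?w x}" by auto
    have 2: "{x \<in> X. s < ?w x} \<in> sets borel" "bounded {x \<in> X. s < ?w x}"
      using X by (auto intro: bounded_subset)
    have "measure (D X) {s<..} = measure ?\<mu> {x \<in> X. s < ?w x} / measure ?\<mu> X"
      unfolding 1[symmetric] by (rule D_meas[OF X]) simp
    then have "measure (D X) {s<..} = 0 \<longleftrightarrow> emeasure ?\<mu> {x \<in> X. s < ?w x} = 0"
      using X em[OF 2] by auto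
    then show ?thesis using weighted_measure_null_iff[OF 2(1), of e a] by simp
  qed
  show "emeasure lborel {x \<in> T. c * r < ?w x} = 0 \<longleftrightarrow> emeasure lborel {x \<in> S. r < ?w x} = 0"
    using mr lev[OF S pos(1)] lev[OF T pos(2)] by simp
qed

section \<open>Unconditional bodies and their \<open>L\<^sub>0\<close>-sum\<close>

lemma inner_hyperplane_reflection:
  assumes "orthonormal_basis e"
  shows "hyperplane_reflection (e i) x \<bullet> e j = (if i = j then - (x \<bullet> e j) else x \<bullet> e j)"
  using assms by (simp add: hyperplane_reflection_def orthonormal_basis_def inner_diff_left)

text \<open>The coordinates are changed one at a time. Since the new value of coordinate
  \<open>j\<close> is at most the old one in modulus, the new point lies on the segment from the
  current point to its reflection in the hyperplane of \<open>e j\<close>.\<close>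

lemma unconditional_dominated:
  fixes K :: "(real^'n) set"
  assumes e: "orthonormal_basis e" and K: "convex K" "unconditional e K"
    and x: "x \<in> K" and y: "\<And>i. \<bar>y \<bullet> e i\<bar> \<le> \<bar>x \<bullet> e i\<bar>"
  shows "y \<in> K"
proof -
  define z where "z I = frame_map e (\<chi> i. if i \<in> I then y \<bullet> e i else x \<bullet> e i)" for I
  have z: "z I \<bullet> e i = (if i \<in> I then y \<bullet> e i else x \<bullet> e i)" for I i
    by (simp add: z_def frame_map_inner[OF e])
  have "z I \<in> K" if "finite I" for I
    using that
  proof induction
    case empty
    have "z {} = x" by (rule orthonormal_eqI[OF e]) (simp add: z)
    then show ?case using x by simp
  next
    case (insert j I)
    let ?r = "hyperplane_reflection (e j) (z I)"
    have r: "?r \<in> K" using K(2) insert.IH by (auto simp: unconditional_def)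
    show ?case
    proof (cases "x \<bullet> e j = 0")
      case True
      then have "z (insert j I) = z I"
        using y[of j] by (intro orthonormal_eqI[OF e]) (auto simp: z)
      then show ?thesis using insert.IH by simp
    next
      case False
      define s where "s = (1 + (y \<bullet> e j) / (x \<bullet> e j)) / 2"
      have "\<bar>(y \<bullet> e j) / (x \<bullet> e j)\<bar> \<le> 1" using y[of j] False by (simp add: abs_divide)
      then have "- 1 \<le> (y \<bullet> e j) / (x \<bullet> e j)" "(y \<bullet> e j) / (x \<bullet> e j) \<le> 1" by linarith+
      then have s: "0 \<le> s" "s \<le> 1" by (simp_all add: s_def)
      have sj: "s * (x \<bullet> e j) + (1 - s) * - (x \<bullet> e j) = y \<bullet> e j" using False by (simp add: s_def field_simps)
      have "z (insert j I) = s *\<^sub>R z I + (1 - s) *\<^sub>R ?r"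
      proof (rule orthonormal_eqI[OF e])
        fix i
        show "z (insert j I) \<bullet> e i = (s *\<^sub>R z I + (1 - s) *\<^sub>R ?r) \<bullet> e i"
          using sj insert.hyps
          by (cases "i = j") (simp_all add: inner_add_left inner_hyperplane_reflection[OF e] z, simp add: algebra_simps)
      qed
      then show ?thesis using convexD_alt[OF K(1) r insert.IH s] by (simp add: add.commute)
    qed
  qed
  from this[of UNIV] have "z UNIV \<in> K" by simp
  moreover have "z UNIV = y" by (rule orthonormal_eqI[OF e]) (simp add: z)
  ultimately show ?thesis by simp
qed

definition unconditional_body :: "('n::finite \<Rightarrow> real^'n) \<Rightarrow> (real^'n) set \<Rightarrow> bool" where
  "unconditional_body e K \<longleftrightarrow> convex_body K \<and> unconditional e K"

lemma unconditional_bodyD: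
  assumes "unconditional_body e K"
  shows "compact K" "convex K" "interior K \<noteq> {}" "unconditional e K" "closed K" "bounded K"
    "K \<in> sets borel" "K \<noteq> {}"
  using assms
  by (auto simp: unconditional_body_def convex_body_def compact_imp_closed compact_imp_bounded borel_compact)

lemma orthonormal_norm:
  assumes "orthonormal_basis e"
  shows "norm (e i) = 1"
  using assms by (simp add: orthonormal_basis_def norm_eq_sqrt_inner)

lemma orthonormal_coord_le_norm:
  assumes "orthonormal_basis e"
  shows "\<bar>x \<bullet> e i\<bar> \<le> norm x"
  using Cauchy_Schwarz_ineq2[of x "e i"] orthonormal_norm[OF assms, of i] by simp

lemma unconditional_body_contains_cube:
  fixes K :: "(real^'n) set"
  assumes e: "orthonormal_basis e" and K: "unconditional_body e K"
  shows "\<exists>\<eta>>0. \<forall>x. (\<forall>i. \<bar>x \<bullet> e i\<bar> \<le> \<eta>) \<longrightarrow> x \<in> K"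
proof -
  note K' = unconditional_bodyD[OF K]
  obtain p where "p \<in> interior K" using K'(3) by auto
  then obtain r where r: "r > 0" "ball p r \<subseteq> K" by (meson mem_interior)
  \<comment> \<open>The interior point \<open>p\<close> is moved away from every coordinate
    hyperplane by \<open>\<eta>\<close>. The total displacement is at most n times
    \<open>\<eta>\<close>, i.e. \<open>r / 2\<close>, so the new point stays in the ball and
    dominates the cube of half-width \<open>\<eta>\<close>.\<close>
  define \<eta> where "\<eta> = r / (2 * real CARD('n))"
  have eta: "\<eta> > 0" using r by (simp add: \<eta>_def)
  define \<sigma> where "\<sigma> i = (if p \<bullet> e i < 0 then -\<eta> else \<eta>)" for i
  define p' where "p' = p + frame_map e (\<chi> i. \<sigma> i)"
  have "norm (frame_map e (\<chi> i. \<sigma> i)) \<le> (\<Sum>i\<in>(UNIV::'n set). \<eta>)"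
    unfolding frame_map_def
    by (rule sum_norm_le) (use eta in \<open>simp add: orthonormal_norm[OF e] \<sigma>_def\<close>)
  also have "\<dots> < r" using r by (simp add: \<eta>_def)
  finally have "p' \<in> ball p r" by (simp add: p'_def dist_norm norm_minus_commute)
  then have p': "p' \<in> K" using r by auto
  have c: "\<eta> \<le> \<bar>p' \<bullet> e i\<bar>" for i
    using eta by (auto simp: p'_def inner_add_left frame_map_inner[OF e] \<sigma>_def)
  have "x \<in> K" if "\<forall>i. \<bar>x \<bullet> e i\<bar> \<le> \<eta>" for x
    by (rule unconditional_dominated[OF e K'(2,4) p']) (use that c order.trans in blast)
  then show ?thesis using eta by blast
qed

section \<open>Support functions\<close>

lemma support_function_ge:
  assumes "compact K" "x \<in> K"
  shows "u \<bullet> x \<le> support_function K u"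
proof -
  have "bounded ((\<bullet>) u ` K)"
    by (intro compact_imp_bounded compact_continuous_image assms continuous_intros)
  then have "bdd_above ((\<bullet>) u ` K)" by (rule bounded_imp_bdd_above)
  then show ?thesis unfolding support_function_def using assms(2) by (intro cSUP_upper) auto
qed

lemma support_function_le:
  assumes "K \<noteq> {}" "\<And>x. x \<in> K \<Longrightarrow> u \<bullet> x \<le> c"
  shows "support_function K u \<le> c"
  unfolding support_function_def using assms by (intro cSUP_least) auto

lemma support_function_attained:
  assumes "compact K" "K \<noteq> {}"
  obtains x where "x \<in> K" "support_function K u = u \<bullet> x"
proof -
  have "\<exists>x\<in>K. \<forall>y\<in>K. u \<bullet> y \<le> u \<bullet> x"
    by (intro continuous_attains_sup assms continuous_intros)
  then obtain x where x: "x \<in> K" "\<And>y. y \<in> K \<Longrightarrow> u \<bullet> y \<le> u \<bullet> x" by blast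
  then have "support_function K u = u \<bullet> x"
    using support_function_ge[OF assms(1) x(1), of u] support_function_le[OF assms(2) x(2)]
    by (intro antisym) auto
  with x that show ?thesis by blast
qed

lemma support_function_scaleR:
  assumes K: "compact K" "K \<noteq> {}" and c: "0 \<le> c"
  shows "support_function K (c *\<^sub>R u) = c * support_function K u"
proof (rule antisym)
  show "support_function K (c *\<^sub>R u) \<le> c * support_function K u"
    using K c by (intro support_function_le) (auto intro!: mult_left_mono support_function_ge)
  obtain x where "x \<in> K" "support_function K u = u \<bullet> x" using support_function_attained[OF K] .
  then show "c * support_function K u \<le> support_function K (c *\<^sub>R u)"
    using support_function_ge[OF K(1), of x "c *\<^sub>R u"] by simp
qed

lemma support_function_lipschitz:
  assumes K: "compact K" "K \<noteq> {}" and r: "\<And>x. x \<in> K \<Longrightarrow> norm x \<le> r"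
  shows "\<bar>support_function K u - support_function K v\<bar> \<le> r * norm (u - v)"
proof -
  have "support_function K u - support_function K v \<le> r * norm (u - v)" for u v
  proof -
    obtain x where x: "x \<in> K" "support_function K u = u \<bullet> x" using support_function_attained[OF K] .
    have "u \<bullet> x - v \<bullet> x \<le> norm (u - v) * norm x"
      using norm_cauchy_schwarz[of "u - v" x] by (simp add: inner_diff_left)
    also have "\<dots> \<le> r * norm (u - v)" using mult_right_mono[OF r[OF x(1)], of "norm (u - v)"] by (simp add: mult.commute)
    finally show ?thesis using support_function_ge[OF K(1) x(1), of v] x(2) by linarith
  qed
  from this[of u v] this[of v u] show ?thesis by (simp add: norm_minus_commute abs_le_iff)
qed

lemma support_function_continuous_on:
  assumes K: "compact K" "K \<noteq> {}"
  shows "continuous_on S (support_function K)"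
proof -
  obtain r where r: "0 < r" "\<And>x. x \<in> K \<Longrightarrow> norm x \<le> r"
    using compact_imp_bounded[OF K(1)] bounded_pos by blast
  show ?thesis
    unfolding continuous_on_iff
  proof (intro ballI allI impI)
    fix u and \<epsilon> :: real assume "0 < \<epsilon>"
    then show "\<exists>d>0. \<forall>v\<in>S. dist v u < d \<longrightarrow> dist (support_function K v) (support_function K u) < \<epsilon>"
    proof (intro exI[of _ "\<epsilon> / r"] conjI ballI impI)
      fix v assume "dist v u < \<epsilon> / r"
      then have "r * norm (v - u) < \<epsilon>" using r by (simp add: dist_norm pos_less_divide_eq mult.commute)
      then show "dist (support_function K v) (support_function K u) < \<epsilon>"
        using support_function_lipschitz[OF K r(2), of v u] by (simp add: dist_real_def)
    qed (use r in auto)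
  qed
qed

text \<open>The signs of the coordinates of \<open>x\<close> can be adapted to those of
  \<open>u\<close> without leaving \<open>K\<close>.\<close>

lemma sum_abs_le_support_function:
  fixes K :: "(real^'n) set"
  assumes e: "orthonormal_basis e" and K: "unconditional_body e K" and x: "x \<in> K"
  shows "(\<Sum>i\<in>UNIV. \<bar>u \<bullet> e i\<bar> * \<bar>x \<bullet> e i\<bar>) \<le> support_function K u"
proof -
  note K' = unconditional_bodyD[OF K]
  define y where "y = frame_map e (\<chi> i. if u \<bullet> e i < 0 then - \<bar>x \<bullet> e i\<bar> else \<bar>x \<bullet> e i\<bar>)"
  have y: "y \<bullet> e i = (if u \<bullet> e i < 0 then - \<bar>x \<bullet> e i\<bar> else \<bar>x \<bullet> e i\<bar>)" for i
    by (simp add: y_def frame_map_inner[OF e])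
  have "y \<in> K" by (rule unconditional_dominated[OF e K'(2,4) x]) (simp add: y)
  then have "u \<bullet> y \<le> support_function K u" by (rule support_function_ge[OF K'(1)])
  moreover have "u \<bullet> y = (\<Sum>i\<in>UNIV. \<bar>u \<bullet> e i\<bar> * \<bar>x \<bullet> e i\<bar>)"
    unfolding orthonormal_inner[OF e, of u y] by (intro sum.cong) (auto simp: y)
  ultimately show ?thesis by simp
qed

lemma inner_le_sum_abs:
  assumes "orthonormal_basis e"
  shows "x \<bullet> u \<le> (\<Sum>i\<in>UNIV. \<bar>u \<bullet> e i\<bar> * \<bar>x \<bullet> e i\<bar>)"
  unfolding orthonormal_inner[OF assms, of x u]
  by (intro sum_mono) (metis abs_ge_self abs_mult mult.commute)

lemma support_function_pos:
  fixes K :: "(real^'n) set"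
  assumes e: "orthonormal_basis e" and K: "unconditional_body e K" and u: "u \<noteq> 0"
  shows "0 < support_function K u"
proof -
  obtain \<eta> where eta: "\<eta> > 0" "\<And>x. (\<forall>i. \<bar>x \<bullet> e i\<bar> \<le> \<eta>) \<Longrightarrow> x \<in> K"
    using unconditional_body_contains_cube[OF e K] by blast
  define x where "x = (\<eta> / norm u) *\<^sub>R u"
  have "\<bar>x \<bullet> e i\<bar> \<le> \<eta>" for i
    using order.trans[OF orthonormal_coord_le_norm[OF e, of x i], of \<eta>] eta u by (simp add: x_def)
  then have "u \<bullet> x \<le> support_function K u"
    using eta unconditional_bodyD(1)[OF K] by (intro support_function_ge) auto
  moreover have "0 < u \<bullet> x" using eta u by (simp add: x_def)
  ultimately show ?thesis by simp
qed

lemma holder_weighted_coords: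
  fixes p x y :: "'i::finite \<Rightarrow> real"
  assumes t: "0 < t" "t < 1" and p: "\<And>i. 0 \<le> p i" and xy: "\<And>i. 0 \<le> x i" "\<And>i. 0 \<le> y i"
  shows "(\<Sum>i\<in>UNIV. p i * (x i powr (1 - t) * y i powr t))
    \<le> (\<Sum>i\<in>UNIV. p i * x i) powr (1 - t) * (\<Sum>i\<in>UNIV. p i * y i) powr t"
    and "(\<Sum>i\<in>UNIV. p i * (x i powr (1 - t) * y i powr t))
      = (\<Sum>i\<in>UNIV. (p i * x i) powr (1 - t) * (p i * y i) powr t)"
proof -
  have "p i * (x i powr (1 - t) * y i powr t) = (p i * x i) powr (1 - t) * (p i * y i) powr t" for i
    using geometric_mean_scale[OF xy(1)[of i] xy(2)[of i] p[of i] p[of i], of t] p[of i] t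
    by (cases "p i = 0") (simp_all add: powr_add[symmetric])
  then show eq: "(\<Sum>i\<in>UNIV. p i * (x i powr (1 - t) * y i powr t))
      = (\<Sum>i\<in>UNIV. (p i * x i) powr (1 - t) * (p i * y i) powr t)" by simp
  show "(\<Sum>i\<in>UNIV. p i * (x i powr (1 - t) * y i powr t))
    \<le> (\<Sum>i\<in>UNIV. p i * x i) powr (1 - t) * (\<Sum>i\<in>UNIV. p i * y i) powr t"
    unfolding eq using t p xy by (intro holder_sum) auto
qed

section \<open>The \<open>L_0\<close>-sum of unconditional bodies\<close>

lemma coordinate_geometric_mean_in_L0_sum:
  fixes K L :: "(real^'n) set"
  assumes e: "orthonormal_basis e" and K: "unconditional_body e K" and L: "unconditional_body e L"
    and t: "0 < t" "t < 1" and x: "x \<in> K" and y: "y \<in> L"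
    and z: "\<And>i. \<bar>z \<bullet> e i\<bar> \<le> \<bar>x \<bullet> e i\<bar> powr (1 - t) * \<bar>y \<bullet> e i\<bar> powr t"
  shows "z \<in> L0_sum t K L"
  unfolding L0_sum_def
proof (intro CollectI ballI)
  fix u :: "real^'n" assume "u \<in> sphere 0 1"
  have "z \<bullet> u \<le> (\<Sum>i\<in>UNIV. \<bar>u \<bullet> e i\<bar> * \<bar>z \<bullet> e i\<bar>)" by (rule inner_le_sum_abs[OF e])
  also have "\<dots> \<le> (\<Sum>i\<in>UNIV. \<bar>u \<bullet> e i\<bar> * (\<bar>x \<bullet> e i\<bar> powr (1 - t) * \<bar>y \<bullet> e i\<bar> powr t))"
    using z by (intro sum_mono mult_left_mono) auto
  also have "\<dots> \<le> (\<Sum>i\<in>UNIV. \<bar>u \<bullet> e i\<bar> * \<bar>x \<bullet> e i\<bar>) powr (1 - t) * (\<Sum>i\<in>UNIV. \<bar>u \<bullet> e i\<bar> * \<bar>y \<bullet> e i\<bar>) powr t"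
    using t by (intro holder_weighted_coords) auto
  also have "\<dots> \<le> support_function K u powr (1 - t) * support_function L u powr t"
    using t sum_abs_le_support_function[OF e K x] sum_abs_le_support_function[OF e L y]
    by (intro mult_mono powr_mono2) (auto intro!: sum_nonneg)
  finally show "z \<bullet> u \<le> support_function K u powr (1 - t) * support_function L u powr t" .
qed

lemma convex_L0_sum: "convex (L0_sum t K L)"
proof -
  have "L0_sum t K L = (\<Inter>u\<in>sphere 0 1. {x. u \<bullet> x \<le> support_function K u powr (1 - t) * support_function L u powr t})"
    by (auto simp: L0_sum_def inner_commute)
  then show ?thesis by (auto intro!: convex_INT convex_halfspace_le)
qed

lemma closed_L0_sum: "closed (L0_sum t K L)"
proof -
  have "L0_sum t K L = (\<Inter>u\<in>sphere 0 1. {x. u \<bullet> x \<le> support_function K u powr (1 - t) * support_function L u powr t})"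
    by (auto simp: L0_sum_def inner_commute)
  then show ?thesis by (auto intro!: closed_INT closed_halfspace_le)
qed

lemma bounded_L0_sum:
  assumes e: "orthonormal_basis e" and K: "unconditional_body e K" and L: "unconditional_body e L"
    and t: "0 < t" "t < 1"
  shows "bounded (L0_sum t K L)"
proof -
  have "\<exists>r. \<forall>u\<in>sphere 0 1. support_function K u \<le> r" if K: "unconditional_body e K" for K
  proof -
    note K' = unconditional_bodyD[OF K]
    obtain r where r: "\<And>x. x \<in> K \<Longrightarrow> norm x \<le> r" using K'(6) by (auto simp: bounded_iff)
    have "support_function K u \<le> r" if "u \<in> sphere 0 1" for u
    proof (rule support_function_le[OF K'(8)])
      fix x assume "x \<in> K"
      then show "u \<bullet> x \<le> r" using norm_cauchy_schwarz[of u x] r[of x] that by simp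
    qed
    then show ?thesis by blast
  qed
  from this[OF K] this[OF L] obtain r s where
    r: "\<And>u. u \<in> sphere 0 1 \<Longrightarrow> support_function K u \<le> r" and
    s: "\<And>u. u \<in> sphere 0 1 \<Longrightarrow> support_function L u \<le> s" by blast
  have "norm x \<le> \<bar>r\<bar> powr (1 - t) * \<bar>s\<bar> powr t" if x: "x \<in> L0_sum t K L" for x
  proof (cases "x = 0")
    case False
    define u where "u = x /\<^sub>R norm x"
    have u: "u \<in> sphere 0 1" "u \<noteq> 0" using False by (auto simp: u_def)
    have "norm x = x \<bullet> u" using False by (simp add: u_def power2_norm_eq_inner[symmetric] power2_eq_square)
    also have "\<dots> \<le> support_function K u powr (1 - t) * support_function L u powr t"
      using x u by (auto simp: L0_sum_def)
    also have "\<dots> \<le> \<bar>r\<bar> powr (1 - t) * \<bar>s\<bar> powr t"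
      using t r[OF u(1)] s[OF u(1)] support_function_pos[OF e K u(2)] support_function_pos[OF e L u(2)]
      by (intro mult_mono powr_mono2) auto
    finally show ?thesis .
  qed simp
  then show ?thesis by (auto simp: bounded_iff)
qed

text \<open>Both sides are homogeneous of degree one in \<open>u\<close>, because the exponents add
  up to 1; so the condition on the sphere extends to all nonzero directions.\<close>

lemma L0_sum_inner_le:
  assumes K: "unconditional_body e K" and L: "unconditional_body e L"
    and x: "x \<in> L0_sum t K L" and u: "u \<noteq> 0"
  shows "x \<bullet> u \<le> support_function K u powr (1 - t) * support_function L u powr t"
proof -
  note K' = unconditional_bodyD[OF K] and L' = unconditional_bodyD[OF L]
  define v where "v = u /\<^sub>R norm u"
  have v: "v \<in> sphere 0 1" "u = norm u *\<^sub>R v" using u by (auto simp: v_def)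
  have h: "support_function K u = norm u * support_function K v" "support_function L u = norm u * support_function L v"
    using support_function_scaleR[OF K'(1,8), of "norm u" v] support_function_scaleR[OF L'(1,8), of "norm u" v] v(2)
    by simp_all
  have "x \<bullet> v \<le> support_function K v powr (1 - t) * support_function L v powr t"
    using x v by (auto simp: L0_sum_def)
  then have "norm u * (x \<bullet> v) \<le> norm u * (support_function K v powr (1 - t) * support_function L v powr t)"
    by (intro mult_left_mono) auto
  moreover have "norm u * (x \<bullet> v) = x \<bullet> u" by (subst v(2)) simp
  moreover have "norm u * (support_function K v powr (1 - t) * support_function L v powr t)
      = support_function K u powr (1 - t) * support_function L u powr t"
    unfolding h using u by (simp add: powr_mult powr_add[symmetric] mult_ac)
  ultimately show ?thesis by simp
qed

lemma measure_lebesgue_eq_weighted_zero: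
  assumes "S \<in> sets borel"
  shows "measure lebesgue S = measure (weighted_measure e (\<lambda>_. 0)) S"
  using assms by (simp add: weighted_measure_zero measure_completion)

lemma unconditional_body_measure_pos:
  assumes "unconditional_body e K"
  shows "0 < measure lebesgue K"
proof -
  note K' = unconditional_bodyD[OF assms]
  have "\<not> negligible (interior K)" using K'(3) by (intro open_not_negligible) auto
  then have "\<not> negligible K" using negligible_subset interior_subset by blast
  moreover have "K \<in> lmeasurable" using K'(1) by (rule lmeasurable_compact)
  ultimately have "measure lebesgue K \<noteq> 0" using negligible_iff_measure by blast
  then show ?thesis by (simp add: zero_less_measure_iff)
qed

section \<open>Diagonal relation of the bodies\<close>

definition nonvanishing :: "('n::finite \<Rightarrow> real^'n) \<Rightarrow> (real^'n) set" where
  "nonvanishing e = {x. \<forall>i. x \<bullet> e i \<noteq> 0}"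

text \<open>In logarithmic coordinates this is the exponential of the support function of the image
  of \<open>K\<close>. Points with a vanishing coordinate are excluded because
  \<open>coord_weight\<close> does not agree with the monomial there and might exceed its
  supremum.\<close>

definition weight_sup :: "('n::finite \<Rightarrow> real^'n) \<Rightarrow> ('n \<Rightarrow> real) \<Rightarrow> (real^'n) set \<Rightarrow> real" where
  "weight_sup e l K = (SUP x\<in>K \<inter> nonvanishing e. coord_weight e l x)"

lemma open_nonvanishing_superlevel:
  "open {x \<in> nonvanishing e. r < coord_weight e l x}"
proof -
  have o: "open (nonvanishing e)"
  proof -
    have "nonvanishing e = (\<Inter>i\<in>UNIV. - {x. e i \<bullet> x = 0})" by (auto simp: nonvanishing_def inner_commute)
    then show ?thesis by (auto intro!: open_INT closed_hyperplane simp: open_Compl)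
  qed
  have c: "continuous_on (nonvanishing e) (coord_weight e l)"
    unfolding coord_weight_def[abs_def] nonvanishing_def by (intro continuous_intros) auto
  have "{x \<in> nonvanishing e. r < coord_weight e l x} = nonvanishing e \<inter> coord_weight e l -` {r<..}" by auto
  then show ?thesis using continuous_open_preimage[OF c o, of "{r<..}"] by simp
qed

lemma negligible_vanishing:
  assumes "orthonormal_basis e"
  shows "negligible (- nonvanishing e)"
proof -
  have "- nonvanishing e = (\<Union>i\<in>UNIV. {x. e i \<bullet> x = 0})" by (auto simp: nonvanishing_def inner_commute)
  moreover have "e i \<noteq> 0" for i using orthonormal_norm[OF assms, of i] by auto
  ultimately show ?thesis by (auto intro!: negligible_Union negligible_hyperplane)
qed

text \<open>\<open>K\<close> is contained in the closure of its interior, so a nonvanishing point of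
  weight above \<open>r\<close> comes with a nonempty open set of such points inside
  \<open>K\<close>. The points with a vanishing coordinate form a null set.\<close>

lemma superlevel_null_iff:
  fixes K :: "(real^'n) set"
  assumes e: "orthonormal_basis e" and K: "unconditional_body e K"
  shows "emeasure lborel {x \<in> K. r < coord_weight e l x} = 0
    \<longleftrightarrow> (\<forall>x\<in>K \<inter> nonvanishing e. coord_weight e l x \<le> r)"
proof -
  note K' = unconditional_bodyD[OF K]
  let ?A = "{x \<in> K. r < coord_weight e l x}" and ?O = "{x \<in> nonvanishing e. r < coord_weight e l x}"
  have A: "?A \<in> sets borel" using K'(7) by auto
  then have A_null: "emeasure lborel ?A = 0 \<longleftrightarrow> negligible ?A"
    by (simp add: negligible_iff_emeasure0 sets_completionI_sets)
  show ?thesis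
    unfolding A_null
  proof
    assume N: "negligible ?A"
    show "\<forall>x\<in>K \<inter> nonvanishing e. coord_weight e l x \<le> r"
    proof (rule ccontr)
      assume "\<not> ?thesis"
      then obtain x where x: "x \<in> K" "x \<in> ?O" by auto
      have "closure (interior K) = closure K" using K'(2,3) by (rule convex_closure_interior)
      then have "x \<in> closure (interior K)" using x(1) closure_subset by auto
      then have "?O \<inter> interior K \<noteq> {}"
        using x(2) open_Int_closure_eq_empty[OF open_nonvanishing_superlevel] by blast
      moreover have "open (?O \<inter> interior K)" by (intro open_Int open_nonvanishing_superlevel open_interior)
      ultimately have "\<not> negligible (?O \<inter> interior K)" by (intro open_not_negligible)
      moreover have "?O \<inter> interior K \<subseteq> ?A" using interior_subset by auto
      ultimately show False using N negligible_subset by blast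
    qed
  next
    assume "\<forall>x\<in>K \<inter> nonvanishing e. coord_weight e l x \<le> r"
    then have "?A \<subseteq> - nonvanishing e" by (auto simp: not_le[symmetric])
    then show "negligible ?A" using negligible_vanishing[OF e] negligible_subset by blast
  qed
qed

lemma nonvanishing_point:
  fixes K :: "(real^'n) set"
  assumes e: "orthonormal_basis e" and K: "unconditional_body e K"
  obtains x where "x \<in> K" "\<And>i. 0 < x \<bullet> e i"
proof -
  obtain \<eta> where eta: "\<eta> > 0" "\<And>x. (\<forall>i. \<bar>x \<bullet> e i\<bar> \<le> \<eta>) \<Longrightarrow> x \<in> K"
    using unconditional_body_contains_cube[OF e K] by blast
  show ?thesis
    by (rule that[of "frame_map e (\<chi> i. \<eta>)"]) (use eta in \<open>auto simp: frame_map_inner[OF e]\<close>)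
qed

context
  fixes e :: "'n::finite \<Rightarrow> real^'n" and K :: "(real^'n) set" and l :: "'n \<Rightarrow> real"
  assumes e: "orthonormal_basis e" and K: "unconditional_body e K" and l: "\<forall>i. 0 \<le> l i"
begin

lemma weight_sup_le_iff: "weight_sup e l K \<le> r \<longleftrightarrow> (\<forall>x\<in>K \<inter> nonvanishing e. coord_weight e l x \<le> r)"
proof -
  have "\<exists>B>0. \<forall>x\<in>K. coord_weight e l x \<le> B"
    by (rule coord_weight_bounded[OF e unconditional_bodyD(6)[OF K]]) (use l in simp)
  then have bdd: "bdd_above (coord_weight e l ` (K \<inter> nonvanishing e))" by (auto intro: bdd_aboveI2)
  obtain x where "x \<in> K" "\<And>i. 0 < x \<bullet> e i" using nonvanishing_point[OF e K] by blast
  then have "x \<in> K \<inter> nonvanishing e" by (auto simp: nonvanishing_def less_le)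
  then have ne: "K \<inter> nonvanishing e \<noteq> {}" by blast
  show ?thesis unfolding weight_sup_def by (rule cSUP_le_iff[OF ne bdd])
qed

lemma coord_weight_le_weight_sup: "x \<in> K \<Longrightarrow> x \<in> nonvanishing e \<Longrightarrow> coord_weight e l x \<le> weight_sup e l K"
  using weight_sup_le_iff[of "weight_sup e l K"] by auto

lemma weight_sup_pos: "0 < weight_sup e l K"
proof -
  obtain x where "x \<in> K" "\<And>i. 0 < x \<bullet> e i" using nonvanishing_point[OF e K] by blast
  then have "x \<in> K" "x \<in> nonvanishing e" by (auto simp: nonvanishing_def less_le)
  then show ?thesis using coord_weight_le_weight_sup coord_weight_pos[of e l x] by (meson less_le_trans)
qed

lemma superlevel_null_iff_weight_sup:
  "emeasure lborel {x \<in> K. r < coord_weight e l x} = 0 \<longleftrightarrow> weight_sup e l K \<le> r"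
  using superlevel_null_iff[OF e K] weight_sup_le_iff by simp

end

lemma coord_weight_scale: "coord_weight e (\<lambda>i. c * l i) x = coord_weight e l x powr c"
  by (simp add: coord_weight_def powr_def sum_distrib_left mult_ac)

lemma weight_sup_scale:
  assumes e: "orthonormal_basis e" and K: "unconditional_body e K" and l: "\<forall>i. 0 \<le> l i" and c: "0 \<le> c"
  shows "weight_sup e (\<lambda>i. c * l i) K = weight_sup e l K powr c"
proof -
  have cl: "\<forall>i. 0 \<le> c * l i" using l c by simp
  have le: "weight_sup e (\<lambda>i. c * l i) K \<le> weight_sup e l K powr c"
    unfolding weight_sup_le_iff[OF e K cl] coord_weight_scale
    using c coord_weight_le_weight_sup[OF e K l] by (intro ballI powr_mono2) auto
  show ?thesis
  proof (cases "c = 0")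
    \<comment> \<open>The general case inverts the power with exponent \<open>1 / c\<close>; for
      \<open>c = 0\<close> the weight is constantly 1.\<close>
    case True
    obtain x where x: "x \<in> K" "\<And>i. 0 < x \<bullet> e i" using nonvanishing_point[OF e K] by blast
    then have "x \<in> nonvanishing e" by (auto simp: nonvanishing_def less_le)
    from coord_weight_le_weight_sup[OF e K cl x(1) this] show ?thesis
      using le True weight_sup_pos[OF e K l] by (simp add: coord_weight_scale)
  next
    case False
    then have c: "c > 0" using c by simp
    have "weight_sup e l K \<le> weight_sup e (\<lambda>i. c * l i) K powr (1 / c)"
      unfolding weight_sup_le_iff[OF e K l]
    proof
      fix x assume "x \<in> K \<inter> nonvanishing e"
      then have "coord_weight e l x powr c \<le> weight_sup e (\<lambda>i. c * l i) K"
        using coord_weight_le_weight_sup[OF e K cl, of x] by (simp add: coord_weight_scale)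
      then have "(coord_weight e l x powr c) powr (1 / c) \<le> weight_sup e (\<lambda>i. c * l i) K powr (1 / c)"
        using c by (intro powr_mono2) auto
      then show "coord_weight e l x \<le> weight_sup e (\<lambda>i. c * l i) K powr (1 / c)"
        using c by (simp add: powr_powr)
    qed
    then have "weight_sup e l K powr c \<le> (weight_sup e (\<lambda>i. c * l i) K powr (1 / c)) powr c"
      using c weight_sup_pos[OF e K l] by (intro powr_mono2) auto
    also have "\<dots> = weight_sup e (\<lambda>i. c * l i) K"
      using c weight_sup_pos[OF e K cl] by (simp add: powr_powr)
    finally show ?thesis using le by simp
  qed
qed

lemma real_eq_mult_of_le_iff:
  fixes s s' c :: real
  assumes "\<And>r. s' \<le> c * r \<longleftrightarrow> s \<le> r" "0 < c"
  shows "s' = c * s"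
proof (rule antisym)
  show "s' \<le> c * s" using assms(1)[of s] by simp
  have "s \<le> s' / c" using assms(1)[of "s' / c"] assms(2) by simp
  then show "c * s \<le> s'" using assms(2) by (simp add: pos_le_divide_eq mult.commute)
qed

text \<open>Equality for the volume is inherited by all monomial weights; comparing the weights
  \<open>a\<close> and \<open>a + l\<close> shows that the ratio of the suprema is multiplicative in \<open>l\<close>.\<close>

lemma weight_sup_ratio_multiplicative:
  fixes K L :: "(real^'n) set"
  assumes e: "orthonormal_basis e" and K: "unconditional_body e K" and L: "unconditional_body e L"
    and t: "0 < t" "t < 1"
    and eq: "measure lebesgue (L0_sum t K L) = measure lebesgue K powr (1 - t) * measure lebesgue L powr t"
    and a: "\<forall>i. 0 \<le> a i" and l: "\<forall>i. 0 \<le> l i"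
  shows "weight_sup e (\<lambda>i. a i + l i) L / weight_sup e (\<lambda>i. a i + l i) K
    = (weight_sup e a L / weight_sup e a K) * (weight_sup e l L / weight_sup e l K)"
proof -
  note K' = unconditional_bodyD[OF K] and L' = unconditional_bodyD[OF L]
  let ?m = "\<lambda>a. measure (weighted_measure e a)"
  have U: "L0_sum t K L \<in> sets borel" "bounded (L0_sum t K L)"
    by (rule borel_closed[OF closed_L0_sum] bounded_L0_sum[OF e K L t])+
  have sub: "z \<in> L0_sum t K L" if "x \<in> K" "y \<in> L" "geometric_mean_point e t x y z" for x y z
    by (rule coordinate_geometric_mean_in_L0_sum[OF e K L t that(1,2)])
      (use that(3) in \<open>simp add: geometric_mean_point_def\<close>)
  have zero: "measure lebesgue K = ?m (\<lambda>_. 0) K" "measure lebesgue L = ?m (\<lambda>_. 0) L"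
    "measure lebesgue (L0_sum t K L) = ?m (\<lambda>_. 0) (L0_sum t K L)"
    by (rule measure_lebesgue_eq_weighted_zero[OF K'(7)] measure_lebesgue_eq_weighted_zero[OF L'(7)]
        measure_lebesgue_eq_weighted_zero[OF U(1)])+
  have pos0: "0 < ?m (\<lambda>_. 0) K" "0 < ?m (\<lambda>_. 0) L"
    using unconditional_body_measure_pos[OF K] unconditional_body_measure_pos[OF L] by (simp_all add: zero)
  have eq0: "?m (\<lambda>_. 0) (L0_sum t K L) = ?m (\<lambda>_. 0) K powr (1 - t) * ?m (\<lambda>_. 0) L powr t"
    using eq by (simp add: zero)
  note inh = weighted_equality_inherit[OF e _ _ t K'(7,6) L'(7,6) U]
  have base: "0 < ?m a K \<and> 0 < ?m a L \<and> ?m a (L0_sum t K L) = ?m a K powr (1 - t) * ?m a L powr t"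
    if a: "\<forall>i. 0 \<le> a i" for a
  proof -
    have "0 < ?m (\<lambda>i. 0 + a i) K" by (rule inh(1)[OF _ _ _ pos0 eq0]) (use a sub in auto)
    moreover have "0 < ?m (\<lambda>i. 0 + a i) L" by (rule inh(2)[OF _ _ _ pos0 eq0]) (use a sub in auto)
    moreover have "?m (\<lambda>i. 0 + a i) (L0_sum t K L) = ?m (\<lambda>i. 0 + a i) K powr (1 - t) * ?m (\<lambda>i. 0 + a i) L powr t"
      by (rule inh(3)[OF _ _ _ pos0 eq0]) (use a sub in auto)
    ultimately show ?thesis by simp
  qed
  \<comment> \<open>The factor belonging to the step from \<open>a\<close> to \<open>a + l\<close>
    is a quotient of two values of \<open>\<kappa>\<close>, but as a ratio of suprema it depends on
    \<open>l\<close> alone. Comparing the start 0 with the start \<open>a\<close> gives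
    multiplicativity.\<close>
  define \<kappa> where "\<kappa> a = ?m a L / ?m a K" for a
  have \<kappa>_pos: "0 < \<kappa> a" if a: "\<forall>i. 0 \<le> a i" for a using base[OF a] by (simp add: \<kappa>_def)
  have ratio: "weight_sup e l L / weight_sup e l K = \<kappa> (\<lambda>i. a i + l i) / \<kappa> a"
    if a: "\<forall>i. 0 \<le> a i" and l: "\<forall>i. 0 \<le> l i" for a l
  proof -
    have al: "\<forall>i. 0 \<le> a i + l i" using a l by simp
    let ?c = "\<kappa> (\<lambda>i. a i + l i) / \<kappa> a"
    have "emeasure lborel {x \<in> L. (?m (\<lambda>i. a i + l i) L / ?m a L) / (?m (\<lambda>i. a i + l i) K / ?m a K) * r < coord_weight e l x} = 0
        \<longleftrightarrow> emeasure lborel {x \<in> K. r < coord_weight e l x} = 0" for r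
      by (rule inh(4)) (use a l base[OF a] sub in auto)
    moreover have "(?m (\<lambda>i. a i + l i) L / ?m a L) / (?m (\<lambda>i. a i + l i) K / ?m a K) = ?c"
      by (simp add: \<kappa>_def)
    ultimately have "emeasure lborel {x \<in> L. ?c * r < coord_weight e l x} = 0
        \<longleftrightarrow> emeasure lborel {x \<in> K. r < coord_weight e l x} = 0" for r
      by (simp only:)
    then have "weight_sup e l L \<le> ?c * r \<longleftrightarrow> weight_sup e l K \<le> r" for r
      by (simp add: superlevel_null_iff_weight_sup[OF e L l] superlevel_null_iff_weight_sup[OF e K l])
    then have "weight_sup e l L = ?c * weight_sup e l K"
      by (rule real_eq_mult_of_le_iff) (use \<kappa>_pos[OF a] \<kappa>_pos[OF al] in simp)
    then show ?thesis using weight_sup_pos[OF e K l] by simp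
  qed
  have al: "\<forall>i. 0 \<le> a i + l i" using a l by simp
  have "weight_sup e (\<lambda>i. a i + l i) L / weight_sup e (\<lambda>i. a i + l i) K = \<kappa> (\<lambda>i. a i + l i) / \<kappa> (\<lambda>_. 0)"
    "weight_sup e a L / weight_sup e a K = \<kappa> a / \<kappa> (\<lambda>_. 0)"
    using ratio[of "\<lambda>_. 0" "\<lambda>i. a i + l i"] ratio[of "\<lambda>_. 0" a] a al by simp_all
  then show ?thesis using ratio[OF a l] \<kappa>_pos[OF a] by simp
qed

text \<open>A nonnegative exponent vector is a sum of nonnegative multiples of unit vectors.
  Multiplicativity of \<open>\<rho>\<close> handles the sum, and \<open>weight_sup_scale\<close>
  handles arbitrary real multiples, so no continuity argument in the exponents arises.\<close>

lemma weight_sup_ratio_eq_prod: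
  fixes K L :: "(real^'n) set"
  assumes e: "orthonormal_basis e" and K: "unconditional_body e K" and L: "unconditional_body e L"
    and t: "0 < t" "t < 1"
    and eq: "measure lebesgue (L0_sum t K L) = measure lebesgue K powr (1 - t) * measure lebesgue L powr t"
  obtains d where "\<And>i. 0 < d i"
    "\<And>l. (\<forall>i. 0 \<le> l i) \<Longrightarrow> weight_sup e l L = (\<Prod>i\<in>UNIV. d i powr l i) * weight_sup e l K"
proof -
  define \<rho> where "\<rho> l = weight_sup e l L / weight_sup e l K" for l
  define unit where "unit i j = (if j = i then 1 else 0 :: real)" for i j :: 'n
  define d where "d i = \<rho> (unit i)" for i
  have unit: "\<forall>j. 0 \<le> unit i j" for i by (simp add: unit_def)
  have d: "0 < d i" for i
    using weight_sup_pos[OF e K unit] weight_sup_pos[OF e L unit] by (simp add: d_def \<rho>_def)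
  have scale: "\<rho> (\<lambda>j. c * unit i j) = d i powr c" if "0 \<le> c" for c i
    using weight_sup_scale[OF e K unit that] weight_sup_scale[OF e L unit that]
      weight_sup_pos[OF e K unit] weight_sup_pos[OF e L unit]
    by (simp add: d_def \<rho>_def powr_divide less_imp_le)
  have prod_rho: "\<rho> (\<lambda>i. if i \<in> I then l i else 0) = (\<Prod>i\<in>I. d i powr l i)"
    if l: "\<forall>i. 0 \<le> l i" and "finite I" for l I
    using \<open>finite I\<close>
  proof induction
    case empty
    \<comment> \<open>The zero exponent is 0 times an arbitrary unit vector, here the one of index
      \<open>undefined\<close>.\<close>
    show ?case using scale[of 0 undefined] d[of undefined] by simp
  next
    case (insert j I)
    have "(\<lambda>i. if i \<in> insert j I then l i else 0) = (\<lambda>i. l j * unit j i + (if i \<in> I then l i else 0))"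
      using insert.hyps by (auto simp: unit_def fun_eq_iff)
    moreover have "\<rho> (\<lambda>i. l j * unit j i + (if i \<in> I then l i else 0))
        = \<rho> (\<lambda>i. l j * unit j i) * \<rho> (\<lambda>i. if i \<in> I then l i else 0)"
      unfolding \<rho>_def using l unit by (intro weight_sup_ratio_multiplicative[OF e K L t eq]) auto
    ultimately show ?case using insert scale[of "l j" j] l by simp
  qed
  show ?thesis
  proof (rule that[OF d])
    fix l :: "'n \<Rightarrow> real" assume l: "\<forall>i. 0 \<le> l i"
    have "\<rho> l = (\<Prod>i\<in>UNIV. d i powr l i)" using prod_rho[OF l, of UNIV] by simp
    then show "weight_sup e l L = (\<Prod>i\<in>UNIV. d i powr l i) * weight_sup e l K"
      using weight_sup_pos[OF e K l] by (simp add: \<rho>_def field_simps)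
  qed
qed

lemma closed_scaleR_limit:
  fixes z :: "'a::real_normed_vector"
  assumes S: "closed S" and z: "\<And>s. 0 < s \<Longrightarrow> s < 1 \<Longrightarrow> s *\<^sub>R z \<in> S"
  shows "z \<in> S"
proof -
  have "((\<lambda>s. s *\<^sub>R z) \<longlongrightarrow> 1 *\<^sub>R z) (at_left (1::real))" by (intro tendsto_intros)
  moreover have "\<forall>\<^sub>F s in at_left (1::real). s *\<^sub>R z \<in> S"
    by (rule eventually_mono[OF eventually_at_left_real[of 0 1]]) (use z in auto)
  ultimately show ?thesis using Lim_in_closed_set[OF S, of "\<lambda>s. s *\<^sub>R z" "at_left 1" "1 *\<^sub>R z"] by simp
qed

text \<open>In logarithmic coordinates an unconditional convex body is a closed convex set that is
  downward closed in every coordinate, hence cut out by half-spaces with nonnegative normals.\<close>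

lemma diag_map_mem_of_weight_sup:
  fixes K L :: "(real^'n) set"
  assumes e: "orthonormal_basis e" and K: "unconditional_body e K" and L: "unconditional_body e L"
    and d: "\<And>i. 0 < d i"
    and w: "\<And>l. (\<forall>i. 0 \<le> l i) \<Longrightarrow> (\<Prod>i\<in>UNIV. d i powr l i) * weight_sup e l K \<le> weight_sup e l L"
    and x: "x \<in> K"
  shows "diag_map e d x \<in> L"
proof -
  note K' = unconditional_bodyD[OF K] and L' = unconditional_bodyD[OF L]
  have nonvan: "diag_map e d x \<in> L" if x: "x \<in> K" "x \<in> nonvanishing e" for x
  proof (rule ccontr)
    assume nL: "diag_map e d x \<notin> L"
    have x0: "x \<bullet> e i \<noteq> 0" for i using x(2) by (simp add: nonvanishing_def)
    define E where "E s = frame_map e (\<chi> i. exp (s $ i))" for s :: "real^'n"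
    have E: "E s \<bullet> e i = exp (s $ i)" for s i by (simp add: E_def frame_map_inner[OF e])
    \<comment> \<open>\<open>A\<close> is the logarithmic image of the part of \<open>L\<close> with
      positive coordinates. It is separated from the logarithmic image \<open>p\<close> of the point
      to be placed in \<open>L\<close>.\<close>
    define A where "A = {s. E s \<in> L}"
    define p :: "real^'n" where "p = (\<chi> i. ln (d i * \<bar>x \<bullet> e i\<bar>))"
    have mem: "s \<in> A" if "y \<in> L" "\<And>i. exp (s $ i) \<le> \<bar>y \<bullet> e i\<bar>" for s y
      unfolding A_def by (simp, rule unconditional_dominated[OF e L'(2,4) that(1)]) (simp add: E that(2))
    have pA: "p \<notin> A"
    proof
      assume "p \<in> A"
      then have "E p \<in> L" by (simp add: A_def)
      then have "diag_map e d x \<in> L"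
        by (rule unconditional_dominated[OF e L'(2,4)])
          (use d x0 in \<open>simp add: E p_def diag_map_inner[OF e] abs_mult less_imp_le\<close>)
      with nL show False by simp
    qed
    have "continuous_on UNIV E"
      unfolding E_def frame_map_def by (simp, intro continuous_intros)
    then have clA: "closed A" using closed_vimage[OF L'(5), of E] by (simp add: A_def vimage_def)
    have cvA: "convex A"
    proof (rule convexI)
      fix s s' and u v :: real
      assume s: "s \<in> A" "s' \<in> A" and uv: "0 \<le> u" "0 \<le> v" "u + v = 1"
      have "u *\<^sub>R E s + v *\<^sub>R E s' \<in> L" using s uv L'(2) by (intro convexD) (auto simp: A_def)
      then show "u *\<^sub>R s + v *\<^sub>R s' \<in> A"
      proof (rule mem)
        fix i
        \<comment> \<open>By convexity of \<open>exp\<close>, the point that belongs to the convex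
          combination of the logarithms is dominated by the convex combination of the points, which
          lies in \<open>L\<close>.\<close>
        have "exp (u * s $ i + v * s' $ i) \<le> u * exp (s $ i) + v * exp (s' $ i)"
        proof -
          have "u = 1 - v" using uv by simp
          then show ?thesis using convex_onD[OF exp_convex, of v "s $ i" "s' $ i"] uv by (simp only:) simp
        qed
        then show "exp ((u *\<^sub>R s + v *\<^sub>R s') $ i) \<le> \<bar>(u *\<^sub>R E s + v *\<^sub>R E s') \<bullet> e i\<bar>"
          by (simp add: inner_add_left E)
      qed
    qed
    obtain f b where fb: "f \<bullet> p < b" "\<And>s. s \<in> A \<Longrightarrow> b < f \<bullet> s"
      using separating_hyperplane_closed_point[OF cvA clA pA] by auto
    define l where "l i = - (f $ i)" for i
    have dot: "f \<bullet> s = - (\<Sum>i\<in>UNIV. l i * s $ i)" for s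
      by (simp add: inner_vec_def l_def sum_negf)
    have down: "s' \<in> A" if "s \<in> A" "\<And>i. s' $ i \<le> s $ i" for s s'
      by (rule mem[of "E s"]) (use that in \<open>auto simp: A_def E\<close>)
    obtain y where y: "y \<in> L" "\<And>i. 0 < y \<bullet> e i" using nonvanishing_point[OF e L] by blast
    define s0 :: "real^'n" where "s0 = (\<chi> i. ln (y \<bullet> e i))"
    have s0: "s0 \<in> A" by (rule mem[OF y(1)]) (simp add: s0_def y(2))
    have l: "\<forall>i. 0 \<le> l i"
    proof (rule ccontr)
      assume "\<not> (\<forall>i. 0 \<le> l i)"
      then obtain i where "l i < 0" by (auto simp: not_le)
      then have li: "f $ i > 0" by (simp add: l_def)
      \<comment> \<open>Lowering coordinate \<open>i\<close> of \<open>s0\<close> keeps it in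
        \<open>A\<close>. If \<open>f $ i\<close> were positive, lowering by this \<open>c\<close>
        would push the functional down to the separating level \<open>b\<close> or below.\<close>
      define c where "c = max 0 ((f \<bullet> s0 - b) / f $ i)"
      have "s0 - c *\<^sub>R axis i 1 \<in> A"
        by (rule down[OF s0]) (simp add: c_def axis_def)
      then have "b < f \<bullet> s0 - c * f $ i" using fb(2) by (fastforce simp: inner_diff_right inner_axis)
      moreover have "f \<bullet> s0 - b \<le> c * f $ i"
        using li by (simp add: c_def pos_divide_le_eq[symmetric])
      ultimately show False by simp
    qed
    \<comment> \<open>The separating functional, read as a monomial with exponents \<open>l\<close>,
      is at most \<open>exp (- b)\<close> on \<open>L\<close> but exceeds this value at the scaled
      point; this contradicts the comparison of suprema.\<close>
    have "weight_sup e l L \<le> exp (- b)"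
      unfolding weight_sup_le_iff[OF e L l]
    proof
      fix y assume y: "y \<in> L \<inter> nonvanishing e"
      then have "(\<chi> i. ln \<bar>y \<bullet> e i\<bar>) \<in> A"
        by (intro mem[of y]) (auto simp: nonvanishing_def)
      then have "b < f \<bullet> (\<chi> i. ln \<bar>y \<bullet> e i\<bar>)" by (rule fb(2))
      then show "coord_weight e l y \<le> exp (- b)" by (simp add: coord_weight_def dot)
    qed
    moreover have "(\<Prod>i\<in>UNIV. d i powr l i) * coord_weight e l x = exp (\<Sum>i\<in>UNIV. l i * p $ i)"
    proof -
      have "d i powr l i = exp (l i * ln (d i))" for i using d[of i] by (simp add: powr_def)
      then have "(\<Prod>i\<in>UNIV. d i powr l i) = exp (\<Sum>i\<in>UNIV. l i * ln (d i))" by (simp add: exp_sum)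
      moreover have "ln (d i * \<bar>x \<bullet> e i\<bar>) = ln (d i) + ln \<bar>x \<bullet> e i\<bar>" for i
        using d[of i] x0[of i] by (simp add: ln_mult)
      ultimately show ?thesis
        by (simp add: coord_weight_def p_def exp_add[symmetric] sum.distrib[symmetric] distrib_left)
    qed
    moreover have "exp (- b) < exp (\<Sum>i\<in>UNIV. l i * p $ i)" using fb(1) by (simp add: dot)
    moreover have "(\<Prod>i\<in>UNIV. d i powr l i) * coord_weight e l x \<le> (\<Prod>i\<in>UNIV. d i powr l i) * weight_sup e l K"
      using coord_weight_le_weight_sup[OF e K l x] by (intro mult_left_mono prod_nonneg) auto
    ultimately show False using w[OF l] by linarith
  qed
  obtain q where q: "q \<in> K" "\<And>i. 0 < q \<bullet> e i" using nonvanishing_point[OF e K] by blast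
  define x' where "x' = frame_map e (\<chi> i. \<bar>x \<bullet> e i\<bar>)"
  have x'i: "x' \<bullet> e i = \<bar>x \<bullet> e i\<bar>" for i by (simp add: x'_def frame_map_inner[OF e])
  have x': "x' \<in> K" by (rule unconditional_dominated[OF e K'(2,4) x]) (simp add: x'i)
  show ?thesis
  proof (rule closed_scaleR_limit[OF L'(5)])
    fix s :: real assume s: "0 < s" "s < 1"
    \<comment> \<open>Vanishing coordinates are removed by moving \<open>x'\<close> towards the
      positive point \<open>q\<close>. The result still dominates \<open>s *\<^sub>R x\<close>, and
      then \<open>s\<close> tends to 1.\<close>
    define y where "y = s *\<^sub>R x' + (1 - s) *\<^sub>R q"
    have y: "y \<in> K" using x' q(1) s K'(2) unfolding y_def by (intro convexD) auto
    have yi: "y \<bullet> e i = s * \<bar>x \<bullet> e i\<bar> + (1 - s) * (q \<bullet> e i)" for i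
      by (simp add: y_def inner_add_left x'i)
    have ypos: "s * \<bar>x \<bullet> e i\<bar> < y \<bullet> e i" for i using s q(2)[of i] by (simp add: yi)
    have "0 < y \<bullet> e i" for i using ypos[of i] s by (smt (verit) abs_ge_zero mult_nonneg_nonneg)
    then have "y \<in> nonvanishing e" by (auto simp: nonvanishing_def less_le)
    with y have "diag_map e d y \<in> L" by (rule nonvan)
    then show "s *\<^sub>R diag_map e d x \<in> L"
    proof (rule unconditional_dominated[OF e L'(2,4)])
      fix i
      have "\<bar>(s *\<^sub>R diag_map e d x) \<bullet> e i\<bar> = d i * (s * \<bar>x \<bullet> e i\<bar>)"
        using s d[of i] by (simp add: diag_map_inner[OF e] abs_mult)
      also have "\<dots> \<le> d i * (y \<bullet> e i)" using d[of i] ypos[of i] by (intro mult_left_mono) auto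
      also have "\<dots> \<le> \<bar>diag_map e d y \<bullet> e i\<bar>" by (simp add: diag_map_inner[OF e])
      finally show "\<bar>(s *\<^sub>R diag_map e d x) \<bullet> e i\<bar> \<le> \<bar>diag_map e d y \<bullet> e i\<bar>" .
    qed
  qed
qed

lemma diag_map_inverse:
  assumes "orthonormal_basis e" "\<And>i. d i \<noteq> 0"
  shows "diag_map e d (diag_map e (\<lambda>i. 1 / d i) x) = x" "diag_map e (\<lambda>i. 1 / d i) (diag_map e d x) = x"
  using assms by (auto intro!: orthonormal_eqI[OF assms(1)] simp: diag_map_inner)

lemma volume_equality_imp_diagonal:
  fixes K L :: "(real^'n) set"
  assumes e: "orthonormal_basis e" and K: "unconditional_body e K" and L: "unconditional_body e L"
    and t: "0 < t" "t < 1"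
    and eq: "measure lebesgue (L0_sum t K L) = measure lebesgue K powr (1 - t) * measure lebesgue L powr t"
  obtains d where "\<And>i. 0 < d i" "L = diag_map e d ` K"
proof -
  obtain d where d: "\<And>i. 0 < d i" and
    w: "\<And>l. (\<forall>i. 0 \<le> l i) \<Longrightarrow> weight_sup e l L = (\<Prod>i\<in>UNIV. d i powr l i) * weight_sup e l K"
    using weight_sup_ratio_eq_prod[OF e K L t eq] by metis
  have "diag_map e d x \<in> L" if "x \<in> K" for x
    by (rule diag_map_mem_of_weight_sup[OF e K L d _ that]) (simp add: w)
  \<comment> \<open>The relation between the suprema is an equation, so it can be used with
    \<open>K\<close> and \<open>L\<close> exchanged and reciprocal factors; this gives the reverse
    inclusion.\<close>
  moreover have "diag_map e (\<lambda>i. 1 / d i) y \<in> K" if "y \<in> L" for y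
  proof (rule diag_map_mem_of_weight_sup[OF e L K _ _ that])
    fix l :: "'n \<Rightarrow> real" assume l: "\<forall>i. 0 \<le> l i"
    have "(\<Prod>i\<in>UNIV. (1 / d i) powr l i) * (\<Prod>i\<in>UNIV. d i powr l i) = 1"
      unfolding prod.distrib[symmetric] using d by (intro prod.neutral) (simp add: powr_divide less_imp_le less_imp_neq[symmetric])
    then show "(\<Prod>i\<in>UNIV. (1 / d i) powr l i) * weight_sup e l L \<le> weight_sup e l K"
      by (simp add: w[OF l] mult.assoc[symmetric])
  qed (use d in simp)
  moreover have "d i \<noteq> 0" for i using d[of i] by simp
  ultimately have "L = diag_map e d ` K"
    using diag_map_inverse(1)[OF e, of d] by (intro equalityI subsetI) (force intro: image_eqI[rotated])+
  with d that show ?thesis by blast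
qed

section \<open>Splitting along level sets\<close>

definition level_proj :: "('n::finite \<Rightarrow> real^'n) \<Rightarrow> ('n \<Rightarrow> real) \<Rightarrow> real \<Rightarrow> real^'n \<Rightarrow> real^'n" where
  "level_proj e d c x = frame_map e (\<chi> i. if d i = c then x \<bullet> e i else 0)"

text \<open>\<open>K\<close> is the product of its sections by the coordinate subspaces on which \<open>d\<close> is constant.\<close>

definition level_split :: "('n::finite \<Rightarrow> real^'n) \<Rightarrow> ('n \<Rightarrow> real) \<Rightarrow> (real^'n) set \<Rightarrow> bool" where
  "level_split e d K \<longleftrightarrow> (\<forall>x. (\<forall>c. level_proj e d c x \<in> K) \<longrightarrow> x \<in> K)"

lemma level_proj_inner:
  assumes "orthonormal_basis e"
  shows "level_proj e d c x \<bullet> e i = (if d i = c then x \<bullet> e i else 0)"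
  by (simp add: level_proj_def frame_map_inner[OF assms])

lemma level_proj_mem:
  assumes "orthonormal_basis e" "unconditional_body e K" "x \<in> K"
  shows "level_proj e d c x \<in> K"
  by (rule unconditional_dominated[OF assms(1) unconditional_bodyD(2,4)[OF assms(2)] assms(3)])
    (simp add: level_proj_inner[OF assms(1)])

lemma unconditional_body_zero_mem:
  assumes "orthonormal_basis e" "unconditional_body e K"
  shows "0 \<in> K"
proof -
  obtain x where "x \<in> K" using unconditional_bodyD(8)[OF assms(2)] by blast
  then show ?thesis
    by (rule unconditional_dominated[OF assms(1) unconditional_bodyD(2,4)[OF assms(2)]]) simp
qed

text \<open>The image of \<open>K\<close> under the powers \<open>d i powr t\<close> lies in the
  \<open>L_0\<close>-sum and already has the volume required for equality. So equality of volumes is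
  the question whether the \<open>L_0\<close>-sum is larger than this image.\<close>

lemma diag_map_geometric_mean:
  fixes K :: "(real^'n) set"
  assumes e: "orthonormal_basis e" and K: "unconditional_body e K"
    and L: "unconditional_body e (diag_map e d ` K)"
    and d: "\<And>i. 0 < d i" and t: "0 < t" "t < 1"
  shows "diag_map e (\<lambda>i. d i powr t) ` K \<subseteq> L0_sum t K (diag_map e d ` K)"
    and "measure lebesgue (diag_map e (\<lambda>i. d i powr t) ` K)
      = measure lebesgue K powr (1 - t) * measure lebesgue (diag_map e d ` K) powr t"
proof -
  show "diag_map e (\<lambda>i. d i powr t) ` K \<subseteq> L0_sum t K (diag_map e d ` K)"
  proof (rule image_subsetI)
    fix k assume k: "k \<in> K"
    show "diag_map e (\<lambda>i. d i powr t) k \<in> L0_sum t K (diag_map e d ` K)"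
    proof (rule coordinate_geometric_mean_in_L0_sum[OF e K L t k imageI[OF k]])
      fix i
      have "\<bar>k \<bullet> e i\<bar> powr (1 - t) * \<bar>diag_map e d k \<bullet> e i\<bar> powr t
          = d i powr t * (\<bar>k \<bullet> e i\<bar> powr (1 - t) * \<bar>k \<bullet> e i\<bar> powr t)"
        using d[of i] by (simp add: diag_map_inner[OF e] abs_mult powr_mult less_imp_le)
      also have "\<bar>k \<bullet> e i\<bar> powr (1 - t) * \<bar>k \<bullet> e i\<bar> powr t = \<bar>k \<bullet> e i\<bar>" by (simp add: powr_add[symmetric])
      finally show "\<bar>diag_map e (\<lambda>i. d i powr t) k \<bullet> e i\<bar> \<le> \<bar>k \<bullet> e i\<bar> powr (1 - t) * \<bar>diag_map e d k \<bullet> e i\<bar> powr t"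
        by (simp add: diag_map_inner[OF e] abs_mult)
    qed
  qed
  have d0: "d i \<noteq> 0" "d i powr t \<noteq> 0" for i using d[of i] by auto
  have dp: "(\<Prod>i\<in>UNIV. \<bar>d i\<bar>) = (\<Prod>i\<in>UNIV. d i)" using d by (intro prod.cong) (auto simp: abs_of_pos)
  have dt: "(\<Prod>i\<in>UNIV. \<bar>d i powr t\<bar>) = (\<Prod>i\<in>UNIV. d i) powr t"
    using prod_powr_distrib[of d UNIV t] by simp
  have V: "0 < measure lebesgue K" by (rule unconditional_body_measure_pos[OF K])
  have P: "0 < (\<Prod>i\<in>UNIV. d i)" by (intro prod_pos) (simp add: d)
  have "measure lebesgue K powr (1 - t) * measure lebesgue (diag_map e d ` K) powr t
      = (\<Prod>i\<in>UNIV. d i) powr t * (measure lebesgue K powr (1 - t) * measure lebesgue K powr t)"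
    unfolding measure_diag_map_image[OF e unconditional_bodyD(1)[OF K], of d, OF d0(1)] dp
    using V P by (simp add: powr_mult)
  also have "measure lebesgue K powr (1 - t) * measure lebesgue K powr t = measure lebesgue K"
    using V by (simp add: powr_add[symmetric])
  finally show "measure lebesgue (diag_map e (\<lambda>i. d i powr t) ` K)
      = measure lebesgue K powr (1 - t) * measure lebesgue (diag_map e d ` K) powr t"
    unfolding measure_diag_map_image[OF e unconditional_bodyD(1)[OF K], of "\<lambda>i. d i powr t", OF d0(2)] dt by simp
qed

text \<open>\<open>z\<close> is a limit of interior points of \<open>C\<close>, and the complement
  of \<open>M\<close> is an open set around \<open>z\<close>. So \<open>C - M\<close> contains a
  nonempty open set.\<close>

lemma measure_less_of_convex_extra_point:
  fixes M C :: "'a::euclidean_space set"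
  assumes M: "compact M" "0 < measure lebesgue M" and C: "convex C" "compact C" "M \<subseteq> C"
    and z: "z \<in> C" "z \<notin> M"
  shows "measure lebesgue M < measure lebesgue C"
proof -
  have lm: "M \<in> lmeasurable" "C \<in> lmeasurable" using M C by (auto intro: lmeasurable_compact)
  have "\<not> negligible M" using M(2) lm(1) by (simp add: negligible_iff_measure)
  then have "\<not> negligible C" using C(3) negligible_subset by blast
  then have "interior C \<noteq> {}" using negligible_convex_interior[OF C(1)] by simp
  then have "closure (interior C) = closure C" by (rule convex_closure_interior[OF C(1)])
  then have "z \<in> closure (interior C)" using z(1) closure_subset by auto
  moreover have o: "open (- M)" using M(1) by (simp add: compact_imp_closed open_Compl)
  ultimately have "- M \<inter> interior C \<noteq> {}" using z(2) open_Int_closure_eq_empty[OF o] by blast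
  then have "\<not> negligible (- M \<inter> interior C)" by (intro open_not_negligible open_Int o open_interior)
  moreover have "- M \<inter> interior C \<subseteq> C - M" using interior_subset by auto
  ultimately have "\<not> negligible (C - M)" using negligible_subset by blast
  moreover have "C - M \<in> lmeasurable" using lm by (intro fmeasurable.Diff)
  ultimately have "0 < measure lebesgue (C - M)" using negligible_iff_measure zero_less_measure_iff by blast
  moreover have "measure lebesgue (C - M) = measure lebesgue C - measure lebesgue M"
    using lm C(3) by (intro measurable_measure_Diff) auto
  ultimately show ?thesis by simp
qed

text \<open>Applied to a direction in which the \<open>L_0\<close>-sum leaves no room beyond the
  scaled point, this shows that the bound by the support function of \<open>K\<close> is
  attained.\<close>

lemma mult_powr_eq_imp_eq:
  fixes P Q h k t :: real
  assumes "0 < P" "0 < Q" "P \<le> h" "Q \<le> k" "0 < t" "t < 1"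
    and le: "h powr (1 - t) * k powr t \<le> P powr (1 - t) * Q powr t"
  shows "P = h"
proof (rule ccontr)
  assume "P \<noteq> h"
  then have "P powr (1 - t) < h powr (1 - t)" using assms by (intro powr_less_mono2) auto
  moreover have "Q powr t \<le> k powr t" using assms by (intro powr_mono2) auto
  ultimately have "P powr (1 - t) * Q powr t < h powr (1 - t) * k powr t"
    using assms by (intro mult_less_le_imp_less) auto
  with le show False by simp
qed

text \<open>At a boundary point of \<open>K\<close> that is interior to the product of the sections of \<open>K\<close>, no outer
  normal lives in a single level set of \<open>d\<close>; hence Hoelder is strict in every direction and the
  \<open>L\<^sub>0\<close>-sum extends beyond \<open>diag_map e (\<lambda>i. d i powr t) ` K\<close>.\<close>

lemma diagonal_equality_imp_level_split:
  fixes K :: "(real^'n) set"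
  assumes e: "orthonormal_basis e" and K: "unconditional_body e K"
    and L: "unconditional_body e (diag_map e d ` K)"
    and d: "\<And>i. 0 < d i" and t: "0 < t" "t < 1"
    and eq: "measure lebesgue (L0_sum t K (diag_map e d ` K))
      = measure lebesgue K powr (1 - t) * measure lebesgue (diag_map e d ` K) powr t"
  shows "level_split e d K"
  unfolding level_split_def
proof (intro allI impI, rule ccontr)
  note K' = unconditional_bodyD[OF K] and L' = unconditional_bodyD[OF L]
  note dom = unconditional_dominated[OF e K'(2,4)]
  let ?L = "diag_map e d ` K" and ?hK = "support_function K" and ?hL = "support_function (diag_map e d ` K)"
  fix w assume w: "\<forall>c. level_proj e d c w \<in> K" and wK: "w \<notin> K"
  define w' where "w' = frame_map e (\<chi> i. \<bar>w \<bullet> e i\<bar>)"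
  have w'i: "w' \<bullet> e i = \<bar>w \<bullet> e i\<bar>" for i by (simp add: w'_def frame_map_inner[OF e])
  have w': "level_proj e d c w' \<in> K" for c
    by (rule dom[OF spec[OF w, of c]]) (simp add: level_proj_inner[OF e] w'i)
  have "w' \<notin> K" using wK dom[of w' w] by (auto simp: w'i)
  obtain p where p: "p \<in> K" "\<And>i. 0 < p \<bullet> e i" using nonvanishing_point[OF e K] by blast
  have "\<exists>s. 0 < s \<and> s < 1 \<and> s *\<^sub>R w' \<notin> K"
    using closed_scaleR_limit[OF K'(5), of w'] \<open>w' \<notin> K\<close> by blast
  then obtain s where s: "0 < s" "s < 1" "s *\<^sub>R w' \<notin> K" by blast
  \<comment> \<open>Mixing in \<open>p\<close> makes all coordinates positive. The point stays
    outside \<open>K\<close> because it dominates \<open>s *\<^sub>R w'\<close>, and its level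
    projections stay in \<open>K\<close> by convexity.\<close>
  define y where "y = s *\<^sub>R w' + (1 - s) *\<^sub>R p"
  have yi: "y \<bullet> e i = s * \<bar>w \<bullet> e i\<bar> + (1 - s) * (p \<bullet> e i)" for i
    by (simp add: y_def inner_add_left w'i)
  have ypos: "0 < y \<bullet> e i" and yge: "s * \<bar>w \<bullet> e i\<bar> \<le> y \<bullet> e i" for i
    using s p(2)[of i] by (auto simp: yi intro!: add_nonneg_pos)
  have yK: "y \<notin> K"
    using s(3) dom[of y "s *\<^sub>R w'"] yge s(1) ypos by (auto simp: w'i abs_mult abs_of_pos)
  have yP: "level_proj e d c y \<in> K" for c
  proof -
    have "level_proj e d c y = s *\<^sub>R level_proj e d c w' + (1 - s) *\<^sub>R level_proj e d c p"
      by (rule orthonormal_eqI[OF e]) (simp add: level_proj_inner[OF e] inner_add_left y_def)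
    then show ?thesis using w' level_proj_mem[OF e K p(1)] s K'(2) by (simp add: convexD)
  qed
  \<comment> \<open>The ray through \<open>y\<close> leaves \<open>K\<close> at a parameter
    \<open>\<sigma>\<close> strictly between 0 and 1. The slack between \<open>\<sigma>\<close> and
    1 places \<open>x\<close> inside the product of the sections.\<close>
  define S where "S = {r \<in> {0..1}. r *\<^sub>R y \<in> K}"
  have "closed ({0..1::real} \<inter> (\<lambda>r. r *\<^sub>R y) -` K)"
    by (intro continuous_closed_preimage K'(5) continuous_intros)
  then have "closed S" by (simp add: S_def Int_def vimage_def)
  then have "compact S" unfolding compact_eq_bounded_closed
    by (auto simp: S_def intro: bounded_subset[of "{0..1}"])
  moreover have "0 \<in> S" using unconditional_body_zero_mem[OF e K] by (simp add: S_def)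
  ultimately obtain \<sigma> where \<sigma>: "\<sigma> \<in> S" "\<And>r. r \<in> S \<Longrightarrow> r \<le> \<sigma>" using compact_attains_sup[of S] by blast
  have \<sigma>1: "\<sigma> < 1" using \<sigma>(1) yK by (cases "\<sigma> = 1") (auto simp: S_def)
  have \<sigma>0: "0 < \<sigma>"
  proof -
    obtain \<eta> where eta: "\<eta> > 0" "\<And>x. (\<forall>i. \<bar>x \<bullet> e i\<bar> \<le> \<eta>) \<Longrightarrow> x \<in> K"
      using unconditional_body_contains_cube[OF e K] by blast
    define r where "r = min 1 (\<eta> / (norm y + 1))"
    have r: "0 < r" "r \<le> 1" using eta by (auto simp: r_def intro!: divide_pos_pos add_nonneg_pos)
    have "r *\<^sub>R y \<in> K"
    proof (rule eta(2), rule allI)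
      fix i
      have "\<bar>(r *\<^sub>R y) \<bullet> e i\<bar> \<le> r * norm y"
        using orthonormal_coord_le_norm[OF e, of "r *\<^sub>R y" i] r by simp
      also have "\<dots> \<le> \<eta> / (norm y + 1) * (norm y + 1)"
        using eta by (intro mult_mono) (auto simp: r_def)
      also have "\<dots> = \<eta>" using norm_ge_zero[of y] by (simp add: add_nonneg_eq_0_iff)
      finally show "\<bar>(r *\<^sub>R y) \<bullet> e i\<bar> \<le> \<eta>" .
    qed
    then show ?thesis using \<sigma>(2)[of r] r by (simp add: S_def)
  qed
  have beyond: "r *\<^sub>R y \<notin> K" if "\<sigma> < r" for r
  proof
    assume r: "r *\<^sub>R y \<in> K"
    have "r \<le> 1"
    proof (rule ccontr)
      assume "\<not> r \<le> 1"
      have "\<bar>y \<bullet> e i\<bar> \<le> \<bar>(r *\<^sub>R y) \<bullet> e i\<bar>" for i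
        using \<open>\<not> r \<le> 1\<close> by (simp add: abs_mult mult_le_cancel_right1)
      then have "y \<in> K" using dom[OF r] by blast
      with yK show False by simp
    qed
    then have "r \<in> S" using r that \<sigma>0 by (simp add: S_def)
    with \<sigma>(2) that show False by force
  qed
  define x where "x = \<sigma> *\<^sub>R y"
  have xK: "x \<in> K" using \<sigma>(1) by (simp add: x_def S_def)
  have xpos: "0 < x \<bullet> e i" for i using \<sigma>0 ypos by (simp add: x_def)
  define z where "z = diag_map e (\<lambda>i. d i powr t) x"
  have strict: "z \<bullet> u < ?hK u powr (1 - t) * ?hL u powr t" if u: "u \<in> sphere 0 1" for u
  proof (rule ccontr)
    assume neg: "\<not> ?thesis"
    define q where "q i = \<bar>u \<bullet> e i\<bar>" for i
    define P Q where "P = (\<Sum>i\<in>UNIV. q i * (x \<bullet> e i))" and "Q = (\<Sum>i\<in>UNIV. q i * (d i * (x \<bullet> e i)))"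
    have q: "0 \<le> q i" for i by (simp add: q_def)
    have "\<exists>i. u \<bullet> e i \<noteq> 0" using u orthonormal_eqI[OF e, of u 0] by force
    then obtain j where j: "u \<bullet> e j \<noteq> 0" by blast
    have P: "0 < P" unfolding P_def using j xpos
      by (intro sum_pos2[of _ j]) (auto simp: q_def less_imp_le)
    have Q: "0 < Q" unfolding Q_def using j xpos d
      by (intro sum_pos2[of _ j]) (auto simp: q_def less_imp_le)
    have PK: "P \<le> ?hK u"
      using sum_abs_le_support_function[OF e K xK, of u] xpos by (simp add: P_def q_def abs_of_pos)
    have QL: "Q \<le> ?hL u"
      using sum_abs_le_support_function[OF e L imageI[OF xK], of u] xpos d
      by (simp add: Q_def q_def abs_mult abs_of_pos diag_map_inner[OF e])
    have nn: "0 \<le> x \<bullet> e i" "0 \<le> d i * (x \<bullet> e i)" for i using xpos[of i] d[of i] by auto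
    have "z \<bullet> u \<le> (\<Sum>i\<in>UNIV. q i * ((x \<bullet> e i) powr (1 - t) * (d i * (x \<bullet> e i)) powr t))"
    proof -
      have "\<bar>z \<bullet> e i\<bar> = (x \<bullet> e i) powr (1 - t) * (d i * (x \<bullet> e i)) powr t" for i
      proof -
        have "(x \<bullet> e i) powr (1 - t) * (d i * (x \<bullet> e i)) powr t
            = d i powr t * ((x \<bullet> e i) powr (1 - t) * (x \<bullet> e i) powr t)"
          using xpos[of i] d[of i] by (simp add: powr_mult)
        also have "(x \<bullet> e i) powr (1 - t) * (x \<bullet> e i) powr t = x \<bullet> e i"
          using xpos[of i] by (simp add: powr_add[symmetric])
        finally show ?thesis using xpos[of i] by (simp add: z_def diag_map_inner[OF e] abs_mult)
      qed
      then show ?thesis using inner_le_sum_abs[OF e, of z u] by (simp add: q_def)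
    qed
    also have "\<dots> = (\<Sum>i\<in>UNIV. (q i * (x \<bullet> e i)) powr (1 - t) * (q i * (d i * (x \<bullet> e i))) powr t)"
      using t q nn by (rule holder_weighted_coords(2))
    finally have lower: "?hK u powr (1 - t) * ?hL u powr t
        \<le> (\<Sum>i\<in>UNIV. (q i * (x \<bullet> e i)) powr (1 - t) * (q i * (d i * (x \<bullet> e i))) powr t)"
      using neg by simp
    have upper: "(\<Sum>i\<in>UNIV. (q i * (x \<bullet> e i)) powr (1 - t) * (q i * (d i * (x \<bullet> e i))) powr t)
        \<le> P powr (1 - t) * Q powr t"
      unfolding P_def Q_def using t q nn by (intro holder_sum) auto
    have PQ: "P powr (1 - t) * Q powr t \<le> ?hK u powr (1 - t) * ?hL u powr t"
      using P Q PK QL t by (intro mult_mono powr_mono2) auto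
    have Ph: "P = ?hK u" using mult_powr_eq_imp_eq[OF P Q PK QL t] lower upper by linarith
    have Heq: "(\<Sum>i\<in>UNIV. (q i * (x \<bullet> e i)) powr (1 - t) * (q i * (d i * (x \<bullet> e i))) powr t)
        = P powr (1 - t) * Q powr t"
      using lower upper PQ by linarith
    have lev: "d i = Q / P" if "u \<bullet> e i \<noteq> 0" for i
    proof -
      have qi: "0 < q i" using that by (simp add: q_def)
      have "q i * (x \<bullet> e i) / P = q i * (d i * (x \<bullet> e i)) / Q"
        unfolding P_def Q_def
        by (rule holder_sum_eq[OF finite t _ _ Heq[unfolded P_def Q_def] UNIV_I])
          (use q nn qi xpos[of i] d[of i] in simp_all)
      then show ?thesis using qi xpos[of i] P Q by (simp add: field_simps)
    qed
    \<comment> \<open>By the equality case of Hoelder, \<open>u\<close> lives on the single level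
      \<open>Q / P\<close>, so it only sees the projection of \<open>y\<close> onto that level. This
      projection lies in \<open>K\<close>, while \<open>x\<close> is \<open>\<sigma>\<close> times
      \<open>y\<close>; hence \<open>P\<close> stays below the support value that it should
      attain.\<close>
    have "P = \<sigma> * (\<Sum>i\<in>UNIV. \<bar>u \<bullet> e i\<bar> * \<bar>level_proj e d (Q / P) y \<bullet> e i\<bar>)"
      unfolding P_def[unfolded q_def] sum_distrib_left
      by (intro sum.cong refl) (use lev ypos in \<open>auto simp: level_proj_inner[OF e] x_def abs_of_pos P_def q_def\<close>)
    also have "\<dots> \<le> \<sigma> * ?hK u"
      using \<sigma>0 by (intro mult_left_mono sum_abs_le_support_function[OF e K yP]) auto
    also have "\<dots> < 1 * ?hK u" using \<sigma>1 P Ph by (intro mult_strict_right_mono) auto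
    finally show False using Ph by simp
  qed
  \<comment> \<open>Strictness in each direction becomes a uniform margin by compactness of the
    sphere.\<close>
  define \<phi> where "\<phi> u = ?hK u powr (1 - t) * ?hL u powr t - z \<bullet> u" for u
  have "?hK u \<noteq> 0 \<and> ?hL u \<noteq> 0" if "u \<in> sphere 0 1" for u
  proof -
    have "u \<noteq> 0" using that by auto
    then show ?thesis using support_function_pos[OF e K, of u] support_function_pos[OF e L, of u] by simp
  qed
  then have "continuous_on (sphere 0 1) \<phi>"
    unfolding \<phi>_def
    by (intro continuous_on_diff continuous_on_mult continuous_on_powr continuous_on_const
        continuous_on_inner continuous_on_id support_function_continuous_on K'(1,8) L'(1,8)) auto
  moreover have "e undefined \<in> sphere 0 1" using orthonormal_norm[OF e] by simp
  ultimately have "\<exists>u0\<in>sphere 0 1. \<forall>u\<in>sphere 0 1. \<phi> u0 \<le> \<phi> u"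
    by (intro continuous_attains_inf compact_sphere) auto
  then obtain u0 where u0: "u0 \<in> sphere 0 1" "\<And>u. u \<in> sphere 0 1 \<Longrightarrow> \<phi> u0 \<le> \<phi> u" by blast
  have \<delta>: "0 < \<phi> u0" using strict[OF u0(1)] by (simp add: \<phi>_def)
  \<comment> \<open>In a unit direction \<open>u\<close>, enlarging \<open>z\<close> by the factor
    \<open>1 + \<epsilon>\<close> changes the inner product by at most \<open>\<epsilon>\<close>
    times \<open>norm z + 1\<close>, which is the minimal margin. The added 1 keeps the denominator
    positive.\<close>
  define \<epsilon> where "\<epsilon> = \<phi> u0 / (norm z + 1)"
  have \<epsilon>: "0 < \<epsilon>" unfolding \<epsilon>_def using \<delta> by (intro divide_pos_pos add_nonneg_pos) auto
  have zL: "(1 + \<epsilon>) *\<^sub>R z \<in> L0_sum t K ?L"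
    unfolding L0_sum_def
  proof (intro CollectI ballI)
    fix u :: "real^'n" assume u: "u \<in> sphere 0 1"
    have "z \<bullet> u \<le> norm z + 1" using norm_cauchy_schwarz[of z u] u by simp
    then have "\<epsilon> * (z \<bullet> u) \<le> \<epsilon> * (norm z + 1)" using \<epsilon> by (intro mult_left_mono) auto
    also have "\<dots> = \<phi> u0" using norm_ge_zero[of z] by (simp add: \<epsilon>_def add_nonneg_eq_0_iff)
    also have "\<dots> \<le> \<phi> u" by (rule u0(2)[OF u])
    finally show "(1 + \<epsilon>) *\<^sub>R z \<bullet> u \<le> ?hK u powr (1 - t) * ?hL u powr t"
      by (simp add: \<phi>_def distrib_right)
  qed
  let ?M = "diag_map e (\<lambda>i. d i powr t) ` K"
  have zM: "(1 + \<epsilon>) *\<^sub>R z \<notin> ?M"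
  proof
    assume "(1 + \<epsilon>) *\<^sub>R z \<in> ?M"
    then obtain k where k: "k \<in> K" "(1 + \<epsilon>) *\<^sub>R z = diag_map e (\<lambda>i. d i powr t) k" by auto
    have "k = ((1 + \<epsilon>) * \<sigma>) *\<^sub>R y"
    proof (rule orthonormal_eqI[OF e])
      fix i
      have *: "(1 + \<epsilon>) * (d i powr t * (\<sigma> * (y \<bullet> e i))) = d i powr t * (k \<bullet> e i)"
        using arg_cong[OF k(2), of "\<lambda>v. v \<bullet> e i"] by (simp add: z_def diag_map_inner[OF e] x_def)
      have "d i powr t * (k \<bullet> e i) = d i powr t * ((1 + \<epsilon>) * \<sigma> * (y \<bullet> e i))"
        unfolding *[symmetric] by (simp only: mult_ac)
      then show "k \<bullet> e i = (((1 + \<epsilon>) * \<sigma>) *\<^sub>R y) \<bullet> e i" using d[of i] by (metis inner_scaleR_left less_irrefl mult_cancel_left powr_eq_0_iff)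
    qed
    moreover have "\<sigma> < (1 + \<epsilon>) * \<sigma>" using \<epsilon> \<sigma>0 by simp
    ultimately show False using beyond k(1) by blast
  qed
  have "compact ?M"
    using linear_diag_map[of e "\<lambda>i. d i powr t"]
    by (intro compact_continuous_image K'(1) linear_continuous_on) (simp add: linear_conv_bounded_linear)
  moreover have "0 < measure lebesgue ?M"
    unfolding diag_map_geometric_mean(2)[OF e K L d t]
    using unconditional_body_measure_pos[OF K] unconditional_body_measure_pos[OF L] by simp
  moreover have "compact (L0_sum t K ?L)"
    using closed_L0_sum bounded_L0_sum[OF e K L t] by (simp add: compact_eq_bounded_closed)
  ultimately have "measure lebesgue ?M < measure lebesgue (L0_sum t K ?L)"
    using diag_map_geometric_mean(1)[OF e K L d t] zL zM convex_L0_sum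
    by (intro measure_less_of_convex_extra_point)
  then show False unfolding diag_map_geometric_mean(2)[OF e K L d t] eq by simp
qed

text \<open>If the preimage \<open>w\<close> of a point of the \<open>L_0\<close>-sum were outside
  \<open>K\<close>, some level projection of \<open>w\<close> would be outside \<open>K\<close> and
  could be separated from it by a normal that lives on that level. On a single level all diagonal
  maps involved are multiplications by a constant, so the bound of the \<open>L_0\<close>-sum in
  that direction collapses to the bound for \<open>K\<close> itself.\<close>

lemma level_split_imp_diagonal_equality:
  fixes K :: "(real^'n) set"
  assumes e: "orthonormal_basis e" and K: "unconditional_body e K"
    and L: "unconditional_body e (diag_map e d ` K)"
    and d: "\<And>i. 0 < d i" and t: "0 < t" "t < 1"
    and split: "level_split e d K"
  shows "measure lebesgue (L0_sum t K (diag_map e d ` K))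
      = measure lebesgue K powr (1 - t) * measure lebesgue (diag_map e d ` K) powr t"
proof -
  note K' = unconditional_bodyD[OF K]
  have "L0_sum t K (diag_map e d ` K) \<subseteq> diag_map e (\<lambda>i. d i powr t) ` K"
  proof
    fix x assume x: "x \<in> L0_sum t K (diag_map e d ` K)"
    define w where "w = diag_map e (\<lambda>i. 1 / d i powr t) x"
    have dt: "d i powr t \<noteq> 0" for i using d[of i] by simp
    have xw: "x = diag_map e (\<lambda>i. d i powr t) w"
      unfolding w_def using diag_map_inverse(1)[OF e, of "\<lambda>i. d i powr t", OF dt] by simp
    have "w \<in> K"
    proof (rule ccontr)
      assume "w \<notin> K"
      then obtain c where c: "level_proj e d c w \<notin> K" using split by (auto simp: level_split_def)
      obtain a b where ab: "a \<bullet> level_proj e d c w < b" "\<And>k. k \<in> K \<Longrightarrow> b < a \<bullet> k"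
        using separating_hyperplane_closed_point[OF K'(2,5) c] by auto
      define u where "u = - a"
      \<comment> \<open>Level projections are self-adjoint, so the normal can be projected instead
        of the point, and projecting does not increase the support value because \<open>K\<close>
        contains its level projections.\<close>
      define v where "v = level_proj e d c u"
      have sym: "u \<bullet> level_proj e d c k = v \<bullet> k" for k
        unfolding orthonormal_inner[OF e, of u "level_proj e d c k"] orthonormal_inner[OF e, of v k]
        by (intro sum.cong) (auto simp: v_def level_proj_inner[OF e])
      have hu: "support_function K u \<le> - b"
        by (rule support_function_le[OF K'(8)]) (use ab(2) in \<open>force simp: u_def\<close>)
      have vw: "support_function K u < v \<bullet> w" using hu ab(1) by (simp add: sym[of w, symmetric] u_def)
      have h0: "0 \<le> support_function K u"
        using support_function_ge[OF K'(1) unconditional_body_zero_mem[OF e K], of u] by simp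
      have "v \<noteq> 0"
      proof
        assume "v = 0"
        with vw h0 show False by simp
      qed
      have "\<exists>j. v \<bullet> e j \<noteq> 0"
      proof (rule ccontr)
        assume "\<not> ?thesis"
        then have "v = 0" by (intro orthonormal_eqI[OF e]) simp
        with \<open>v \<noteq> 0\<close> show False by simp
      qed
      then obtain j where "v \<bullet> e j \<noteq> 0" by blast
      then have "d j = c" by (auto simp: v_def level_proj_inner[OF e] split: if_splits)
      then have c0: "0 < c" using d[of j] by simp
      have vD: "v \<bullet> diag_map e \<delta> k = r * (v \<bullet> k)" if "\<And>i. d i = c \<Longrightarrow> \<delta> i = r" for \<delta> r k
        unfolding orthonormal_inner[OF e, of v "diag_map e \<delta> k"] orthonormal_inner[OF e, of v k] sum_distrib_left
        by (intro sum.cong) (auto simp: v_def level_proj_inner[OF e] diag_map_inner[OF e] that)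
      have vk: "v \<bullet> k \<le> support_function K u" if "k \<in> K" for k
        unfolding sym[symmetric] by (rule support_function_ge[OF K'(1) level_proj_mem[OF e K that]])
      have hK: "support_function K v \<le> support_function K u"
        by (rule support_function_le[OF K'(8) vk])
      have hL: "support_function (diag_map e d ` K) v \<le> c * support_function K u"
        using K'(8) vk c0 by (intro support_function_le) (auto simp: vD)
      have "c powr t * (v \<bullet> w) = x \<bullet> v"
        unfolding xw by (subst inner_commute, subst vD[of _ "c powr t"]) auto
      also have "\<dots> \<le> support_function K v powr (1 - t) * support_function (diag_map e d ` K) v powr t"
        by (rule L0_sum_inner_le[OF K L x \<open>v \<noteq> 0\<close>])
      also have "\<dots> \<le> support_function K u powr (1 - t) * (c * support_function K u) powr t"
        using hK hL t support_function_pos[OF e K \<open>v \<noteq> 0\<close>] support_function_pos[OF e L \<open>v \<noteq> 0\<close>]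
        by (intro mult_mono powr_mono2) auto
      also have "\<dots> = c powr t * (support_function K u powr (1 - t) * support_function K u powr t)"
        using c0 h0 by (simp add: powr_mult)
      also have "support_function K u powr (1 - t) * support_function K u powr t = support_function K u"
        using h0 by (simp add: powr_add[symmetric])
      finally show False using vw c0 by simp
    qed
    then show "x \<in> diag_map e (\<lambda>i. d i powr t) ` K" using xw by blast
  qed
  then have "L0_sum t K (diag_map e d ` K) = diag_map e (\<lambda>i. d i powr t) ` K"
    using diag_map_geometric_mean(1)[OF e K L d t] by blast
  then show ?thesis using diag_map_geometric_mean(2)[OF e K L d t] by simp
qed

section \<open>Level splitting and orthogonal decompositions\<close>

lemma linear_image_set_sum:
  assumes f: "linear f" and I: "finite I"
  shows "f ` (\<Sum>i\<in>I. X i) = (\<Sum>i\<in>I. f ` X i)"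
proof -
  have "f (sum s I) = (\<Sum>i\<in>I. f (s i))" for s by (rule linear_sum[OF f])
  then show ?thesis
    unfolding set_sum_alt[OF I]
  proof (intro equalityI subsetI)
    assume sum: "\<And>s. f (sum s I) = (\<Sum>i\<in>I. f (s i))"
    fix y assume "y \<in> {sum s I |s. \<forall>i\<in>I. s i \<in> f ` X i}"
    then obtain s where s: "y = sum s I" "\<forall>i\<in>I. s i \<in> f ` X i" by auto
    then have "\<forall>i\<in>I. \<exists>x. x \<in> X i \<and> s i = f x" by auto
    then obtain x where x: "\<forall>i\<in>I. x i \<in> X i \<and> s i = f (x i)" by metis
    then have "y = f (sum x I)" using s(1) sum by simp
    with x show "y \<in> f ` {sum s I |s. \<forall>i\<in>I. s i \<in> X i}" by blast
  qed auto
qed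

definition level_space :: "('n::finite \<Rightarrow> real^'n) \<Rightarrow> ('n \<Rightarrow> real) \<Rightarrow> real \<Rightarrow> (real^'n) set" where
  "level_space e d c = {x. \<forall>j. d j \<noteq> c \<longrightarrow> x \<bullet> e j = 0}"

lemma subspace_level_space: "subspace (level_space e d c)"
  by (auto simp: subspace_def level_space_def inner_add_left)

lemma level_proj_mem_level_space:
  assumes "orthonormal_basis e"
  shows "level_proj e d c x \<in> level_space e d c"
  by (simp add: level_space_def level_proj_inner[OF assms])

lemma orthogonal_affine_level_space:
  assumes e: "orthonormal_basis e" and "c \<noteq> c'" "A \<subseteq> level_space e d c" "B \<subseteq> level_space e d c'"
  shows "orthogonal_affine (affine hull A) (affine hull B)"
proof -
  have AB: "affine hull A \<subseteq> level_space e d c" "affine hull B \<subseteq> level_space e d c'"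
    using assms(3,4) by (auto intro!: hull_minimal subspace_imp_affine subspace_level_space del: subsetI)
  have orth: "x \<bullet> y = 0" if "x \<in> level_space e d c" "y \<in> level_space e d c'" for x y
    unfolding orthonormal_inner[OF e, of x y]
  proof (intro sum.neutral ballI)
    fix j
    show "x \<bullet> e j * (y \<bullet> e j) = 0"
      using that \<open>c \<noteq> c'\<close> by (cases "d j = c") (auto simp: level_space_def)
  qed
  show ?thesis
    unfolding orthogonal_affine_def orthogonal_def
    using AB by (intro ballI orth subspace_diff[OF subspace_level_space]) auto
qed

text \<open>The section contains 0, so its affine dimension is a linear one. Since \<open>K\<close>
  contains a cube, the section contains multiples of all basis vectors of its level and spans the
  whole level space.\<close>

lemma aff_dim_level_section:
  fixes K :: "(real^'n) set"
  assumes e: "orthonormal_basis e" and K: "unconditional_body e K"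
  shows "aff_dim (K \<inter> level_space e d c) = int (card {j. d j = c})"
proof -
  let ?X = "K \<inter> level_space e d c" and ?E = "e ` {j. d j = c}"
  have "0 \<in> ?X"
    using unconditional_body_zero_mem[OF e K] subspace_0[OF subspace_level_space] by blast
  then have "0 \<in> affine hull ?X" by (rule hull_inc)
  then have "aff_dim ?X = int (dim ?X)" by (rule aff_dim_zero)
  also have "dim ?X = dim ?E"
  proof (rule span_eq_dim, rule span_eq[THEN iffD2], rule conjI)
    show "?X \<subseteq> span ?E"
    proof
      fix x assume x: "x \<in> ?X"
      have "(\<Sum>i\<in>UNIV. (x \<bullet> e i) *\<^sub>R e i) \<in> span ?E"
      proof (rule span_sum)
        fix i
        show "(x \<bullet> e i) *\<^sub>R e i \<in> span ?E"
          using x by (cases "d i = c") (auto simp: level_space_def intro: span_mul span_base span_0)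
      qed
      then show "x \<in> span ?E" using orthonormal_expansion[OF e, of x] by simp
    qed
    obtain \<eta> where eta: "\<eta> > 0" "\<And>x. (\<forall>i. \<bar>x \<bullet> e i\<bar> \<le> \<eta>) \<Longrightarrow> x \<in> K"
      using unconditional_body_contains_cube[OF e K] by blast
    have ee: "e j \<bullet> e i = (if j = i then 1 else 0)" for i j using e by (simp add: orthonormal_basis_def)
    show "?E \<subseteq> span ?X"
    proof
      fix v assume "v \<in> ?E"
      then obtain j where j: "d j = c" "v = e j" by auto
      have "\<eta> *\<^sub>R e j \<in> K" using eta(1) by (intro eta(2)) (simp add: ee)
      moreover have "\<eta> *\<^sub>R e j \<in> level_space e d c" using j(1) by (auto simp: level_space_def ee)
      ultimately have "\<eta> *\<^sub>R e j \<in> span ?X" by (intro span_base) blast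
      then have "(1 / \<eta>) *\<^sub>R (\<eta> *\<^sub>R e j) \<in> span ?X" by (rule span_mul)
      then show "v \<in> span ?X" using eta(1) j(2) by simp
    qed
  qed
  also have "dim ?E = card ?E"
  proof (rule dim_eq_card_independent, rule pairwise_orthogonal_independent)
    show "pairwise orthogonal ?E"
      using e by (auto simp: pairwise_def orthogonal_def orthonormal_basis_def)
    show "0 \<notin> ?E" using orthonormal_norm[OF e] by (metis imageE norm_zero zero_neq_one)
  qed
  also have "card ?E = card {j. d j = c}"
    using e by (intro card_image inj_onI) (metis orthonormal_basis_def zero_neq_one)
  finally show ?thesis .
qed

lemma hyperplane_reflection_scaleR: "hyperplane_reflection v (c *\<^sub>R x) = c *\<^sub>R hyperplane_reflection v x"
  by (simp add: hyperplane_reflection_def scaleR_diff_right mult_ac)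

lemma unconditional_scaled_image:
  assumes "unconditional e X"
  shows "unconditional e ((\<lambda>x. c *\<^sub>R x) ` X)"
  using assms by (auto simp: unconditional_def hyperplane_reflection_scaleR)

text \<open>A point is the sum of its level projections, and these stay in \<open>K\<close> by
  domination. Conversely, the summands live on disjoint sets of coordinates, so they are the level
  projections of their sum, and \<open>level_split\<close> puts the sum into
  \<open>K\<close>.\<close>

lemma level_space_decomposition:
  fixes K :: "(real^'n) set" and g :: "nat \<Rightarrow> real"
  assumes e: "orthonormal_basis e" and K: "unconditional_body e K" and split: "level_split e d K"
    and g: "bij_betw g {1..m} (range d)"
  shows "K = (\<Sum>i=1..m. K \<inter> level_space e d (g i))"
proof (intro equalityI subsetI)
  fix x assume x: "x \<in> K"
  have "x = (\<Sum>i=1..m. level_proj e d (g i) x)"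
  proof (rule orthonormal_eqI[OF e])
    fix j
    have "(\<Sum>i=1..m. level_proj e d (g i) x) \<bullet> e j = (\<Sum>i=1..m. if d j = g i then x \<bullet> e j else 0)"
      by (simp add: inner_sum_left level_proj_inner[OF e])
    also have "\<dots> = (\<Sum>c\<in>range d. if d j = c then x \<bullet> e j else 0)"
      by (rule sum.reindex_bij_betw[OF g])
    also have "\<dots> = x \<bullet> e j" by (subst sum.delta') auto
    finally show "x \<bullet> e j = (\<Sum>i=1..m. level_proj e d (g i) x) \<bullet> e j" by simp
  qed
  moreover have "level_proj e d (g i) x \<in> K \<inter> level_space e d (g i)" for i
    using level_proj_mem[OF e K x] level_proj_mem_level_space[OF e] by blast
  ultimately show "x \<in> (\<Sum>i=1..m. K \<inter> level_space e d (g i))"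
    unfolding set_sum_alt[OF finite_atLeastAtMost] by blast
next
  fix x assume "x \<in> (\<Sum>i=1..m. K \<inter> level_space e d (g i))"
  then obtain s where s: "x = sum s {1..m}" "\<And>i. i \<in> {1..m} \<Longrightarrow> s i \<in> K \<inter> level_space e d (g i)"
    unfolding set_sum_alt[OF finite_atLeastAtMost] by blast
  have "level_proj e d c x \<in> K" for c
  proof (cases "c \<in> range d")
    case True
    then have "c \<in> g ` {1..m}" using g by (simp only: bij_betw_def)
    then obtain i where i: "i \<in> {1..m}" "c = g i" by blast
    have "level_proj e d c x = s i"
    proof (rule orthonormal_eqI[OF e])
      fix j
      have si: "s k \<bullet> e j = 0" if "k \<in> {1..m}" "d j \<noteq> g k" for k
        using s(2)[OF that(1)] that(2) by (auto simp: level_space_def)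
      show "level_proj e d c x \<bullet> e j = s i \<bullet> e j"
      proof (cases "d j = c")
        case True
        have "x \<bullet> e j = (\<Sum>k=1..m. s k \<bullet> e j)" by (simp add: s(1) inner_sum_left)
        also have "\<dots> = (\<Sum>k=1..m. if k = i then s i \<bullet> e j else 0)"
        proof (intro sum.cong refl)
          fix k assume k: "k \<in> {1..m}"
          have "g k \<noteq> g i" if "k \<noteq> i" using inj_onD[OF bij_betw_imp_inj_on[OF g], of k i] k i(1) that by blast
          then show "s k \<bullet> e j = (if k = i then s i \<bullet> e j else 0)" using si[OF k] True i(2) by auto
        qed
        also have "\<dots> = s i \<bullet> e j" using i(1) by simp
        finally show ?thesis using True by (simp add: level_proj_inner[OF e])
      next
        case False
        then show ?thesis using si[OF i(1)] i(2) by (simp add: level_proj_inner[OF e])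
      qed
    qed
    then show ?thesis using s(2)[OF i(1)] by simp
  next
    case False
    then have "level_proj e d c x = 0"
      by (intro orthonormal_eqI[OF e]) (auto simp: level_proj_inner[OF e])
    then show ?thesis using unconditional_body_zero_mem[OF e K] by simp
  qed
  then show "x \<in> K" using split by (simp add: level_split_def)
qed

lemma level_split_imp_orthogonal_decomposition:
  fixes K :: "(real^'n) set"
  assumes e: "orthonormal_basis e" and K: "unconditional_body e K" and d: "\<And>i. 0 < d i"
    and split: "level_split e d K"
  shows "\<exists>m\<ge>1. \<exists>X Y :: nat \<Rightarrow> (real^'n) set.
       is_orthogonal_sum m X K \<and> is_orthogonal_sum m Y (diag_map e d ` K) \<and>
       (\<forall>i\<in>{1..m}.
          compact (X i) \<and> convex (X i) \<and> unconditional e (X i) \<and> aff_dim (X i) \<ge> 1 \<and>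
          compact (Y i) \<and> convex (Y i) \<and> unconditional e (Y i) \<and> aff_dim (Y i) \<ge> 1 \<and>
          dilates (X i) (Y i)) \<and>
       (\<Sum>i=1..m. aff_dim (X i)) = int CARD('n)"
proof -
  note K' = unconditional_bodyD[OF K]
  define m where "m = card (range d)"
  \<comment> \<open>One summand for each distinct value of \<open>d\<close>; this value will be its
    dilation factor.\<close>
  obtain g :: "nat \<Rightarrow> real" where g: "bij_betw g {1..m} (range d)"
    using ex_bij_betw_nat_finite_1[of "range d"] by (auto simp: m_def)
  have m: "m \<ge> 1" by (simp add: m_def Suc_le_eq card_gt_0_iff)
  have g_inj: "g i \<noteq> g j" if "i \<in> {1..m}" "j \<in> {1..m}" "i \<noteq> j" for i j
    using inj_onD[OF bij_betw_imp_inj_on[OF g], of i j] that by blast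
  have g_pos: "0 < g i" if i: "i \<in> {1..m}" for i
  proof -
    have "g i \<in> range d" using g i by (auto simp: bij_betw_def)
    then show ?thesis using d by auto
  qed
  define X where "X i = K \<inter> level_space e d (g i)" for i
  define Y where "Y i = (\<lambda>x. g i *\<^sub>R x) ` X i" for i
  have X_sub: "X i \<subseteq> level_space e d (g i)" and Y_sub: "Y i \<subseteq> level_space e d (g i)" for i
    by (auto simp: X_def Y_def intro: subspace_scale[OF subspace_level_space])
  have KX: "K = (\<Sum>i=1..m. X i)"
    unfolding X_def by (rule level_space_decomposition[OF e K split g])
  have DX: "diag_map e d ` X i = Y i" for i
    unfolding Y_def
  proof (rule image_cong)
    fix x assume x: "x \<in> X i"
    show "diag_map e d x = g i *\<^sub>R x"
    proof (rule orthonormal_eqI[OF e])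
      fix j
      show "diag_map e d x \<bullet> e j = (g i *\<^sub>R x) \<bullet> e j"
        using x by (cases "d j = g i") (auto simp: diag_map_inner[OF e] X_def level_space_def)
    qed
  qed simp
  have DY: "diag_map e d ` K = (\<Sum>i=1..m. Y i)"
  proof -
    have "diag_map e d ` K = diag_map e d ` (\<Sum>i=1..m. X i)" by (rule arg_cong[OF KX])
    also have "\<dots> = (\<Sum>i=1..m. diag_map e d ` X i)" by (intro linear_image_set_sum linear_diag_map) simp
    finally show ?thesis by (simp only: DX)
  qed
  have dimX: "aff_dim (X i) = int (card {j. d j = g i})" for i
    unfolding X_def by (rule aff_dim_level_section[OF e K])
  have dim1: "1 \<le> aff_dim (X i)" if i: "i \<in> {1..m}" for i
  proof -
    have "g i \<in> range d" using g i by (auto simp: bij_betw_def)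
    then have "{j. d j = g i} \<noteq> {}" by auto
    then show ?thesis unfolding dimX by (simp add: Suc_le_eq card_gt_0_iff)
  qed
  have dimY: "aff_dim (Y i) = aff_dim (X i)" if i: "i \<in> {1..m}" for i
    unfolding Y_def using g_pos[OF i]
    by (intro aff_dim_injective_linear_image linear_scale_self) (auto intro!: injI)
  have compX: "compact (X i)" "convex (X i)" "unconditional e (X i)" for i
  proof -
    show "compact (X i)" unfolding X_def by (intro compact_Int_closed K'(1) closed_subspace subspace_level_space)
    show "convex (X i)" unfolding X_def by (intro convex_Int K'(2) subspace_imp_convex subspace_level_space)
    show "unconditional e (X i)"
      using K'(4) by (auto simp: X_def unconditional_def level_space_def inner_hyperplane_reflection[OF e])
  qed
  have sum_dim: "(\<Sum>i=1..m. aff_dim (X i)) = int CARD('n)"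
  proof -
    have "(\<Sum>i=1..m. card {j. d j = g i}) = (\<Sum>c\<in>range d. card {j. d j = c})"
      by (rule sum.reindex_bij_betw[OF g])
    also have "\<dots> = CARD('n)"
      using sum.image_gen[of UNIV "\<lambda>_. 1 :: nat" d] by simp
    finally show ?thesis unfolding dimX by (simp flip: of_nat_sum)
  qed
  have orthX: "pairwise (\<lambda>i j. orthogonal_affine (affine hull X i) (affine hull X j)) {1..m}"
    and orthY: "pairwise (\<lambda>i j. orthogonal_affine (affine hull Y i) (affine hull Y j)) {1..m}"
    unfolding pairwise_def
    by (intro ballI impI orthogonal_affine_level_space[OF e _ X_sub X_sub] g_inj; assumption)
      (intro ballI impI orthogonal_affine_level_space[OF e _ Y_sub Y_sub] g_inj; assumption)
  show ?thesis
  proof (intro exI conjI ballI)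
    show "1 \<le> m" by (rule m)
    show "is_orthogonal_sum m X K" using orthX KX by (simp add: is_orthogonal_sum_def)
    show "is_orthogonal_sum m Y (diag_map e d ` K)" using orthY DY by (simp add: is_orthogonal_sum_def)
    show "(\<Sum>i=1..m. aff_dim (X i)) = int CARD('n)" by (rule sum_dim)
    fix i assume i: "i \<in> {1..m}"
    show "compact (X i)" "convex (X i)" "unconditional e (X i)" by (rule compX)+
    show "1 \<le> aff_dim (X i)" by (rule dim1[OF i])
    show "1 \<le> aff_dim (Y i)" unfolding dimY[OF i] by (rule dim1[OF i])
    show "compact (Y i)" unfolding Y_def by (intro compact_scaling compX)
    show "convex (Y i)" unfolding Y_def by (intro convex_scaling compX)
    show "unconditional e (Y i)" unfolding Y_def by (intro unconditional_scaled_image compX)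
    show "dilates (X i) (Y i)" unfolding dilates_def Y_def using g_pos[OF i] by blast
  qed
qed

text \<open>Orthogonality and unconditionality force different summands to use disjoint sets of
  coordinates, and since \<open>K\<close> has a point without vanishing coordinates these sets cover
  everything. Each coordinate thus belongs to one summand, whose dilation factor becomes the
  diagonal entry.\<close>

lemma orthogonal_decomposition_imp_level_split:
  fixes K L :: "(real^'n) set" and X Y :: "nat \<Rightarrow> (real^'n) set"
  assumes e: "orthonormal_basis e" and K: "unconditional_body e K"
    and sumK: "is_orthogonal_sum m X K" and sumL: "is_orthogonal_sum m Y L"
    and X: "\<And>i. i \<in> {1..m} \<Longrightarrow> convex (X i) \<and> unconditional e (X i) \<and> X i \<noteq> {}"
    and dil: "\<And>i. i \<in> {1..m} \<Longrightarrow> dilates (X i) (Y i)"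
  obtains d where "\<And>i. 0 < d i" "L = diag_map e d ` K" "level_split e d K"
proof -
  have KX: "K = (\<Sum>i=1..m. X i)" and LY: "L = (\<Sum>i=1..m. Y i)"
    and orth: "\<And>i k. i \<in> {1..m} \<Longrightarrow> k \<in> {1..m} \<Longrightarrow> i \<noteq> k \<Longrightarrow> orthogonal_affine (affine hull X i) (affine hull X k)"
    using sumK sumL by (auto simp: is_orthogonal_sum_def pairwise_def)
  have dom: "y \<in> X i" if "i \<in> {1..m}" "x \<in> X i" "\<And>j. \<bar>y \<bullet> e j\<bar> \<le> \<bar>x \<bullet> e j\<bar>" for i x y
    using unconditional_dominated[OF e _ _ that(2,3)] X[OF that(1)] by blast
  have ee: "e j \<bullet> e i = (if j = i then 1 else 0)" for i j using e by (simp add: orthonormal_basis_def)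
  have zero: "0 \<in> X i" if i: "i \<in> {1..m}" for i
  proof -
    obtain x where "x \<in> X i" using X[OF i] by blast
    then show ?thesis by (rule dom[OF i]) simp
  qed
  define S where "S i = {j. \<exists>x\<in>X i. x \<bullet> e j \<noteq> 0}" for i
  have uniq: "i = k" if i: "i \<in> {1..m}" and k: "k \<in> {1..m}" and j: "j \<in> S i" "j \<in> S k" for i k j
  proof (rule ccontr)
    assume "i \<noteq> k"
    obtain x y where x: "x \<in> X i" "x \<bullet> e j \<noteq> 0" and y: "y \<in> X k" "y \<bullet> e j \<noteq> 0"
      using j by (auto simp: S_def)
    \<comment> \<open>By domination both summands contain a nonzero multiple of the same basis
      vector as well as 0, so their affine hulls are not orthogonal.\<close>
    have "(x \<bullet> e j) *\<^sub>R e j \<in> X i" by (rule dom[OF i x(1)]) (simp add: ee)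
    moreover have "(y \<bullet> e j) *\<^sub>R e j \<in> X k" by (rule dom[OF k y(1)]) (simp add: ee)
    ultimately have "orthogonal ((x \<bullet> e j) *\<^sub>R e j - 0) ((y \<bullet> e j) *\<^sub>R e j - 0)"
      using orth[OF i k \<open>i \<noteq> k\<close>] zero[OF i] zero[OF k] unfolding orthogonal_affine_def
      by (meson hull_inc)
    then show False using x y by (simp add: orthogonal_def ee)
  qed
  have cover: "\<exists>i\<in>{1..m}. j \<in> S i" for j
  proof -
    obtain p where p: "p \<in> K" "\<And>i. 0 < p \<bullet> e i" using nonvanishing_point[OF e K] by blast
    obtain s where s: "p = sum s {1..m}" "\<forall>i\<in>{1..m}. s i \<in> X i"
      using p(1) unfolding KX set_sum_alt[OF finite_atLeastAtMost] by blast
    have "(\<Sum>i=1..m. s i \<bullet> e j) \<noteq> 0" using p(2)[of j] by (simp add: s(1) inner_sum_left)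
    then obtain i where "i \<in> {1..m}" "s i \<bullet> e j \<noteq> 0" by (meson sum.neutral)
    then show ?thesis using s(2) unfolding S_def by blast
  qed
  then have "\<forall>j. \<exists>i. i \<in> {1..m} \<and> j \<in> S i" by blast
  from choice[OF this] obtain \<iota> where \<iota>: "\<And>j. \<iota> j \<in> {1..m}" "\<And>j. j \<in> S (\<iota> j)" by blast
  have "\<forall>i\<in>{1..m}. \<exists>c. 0 < c \<and> Y i = (\<lambda>x. c *\<^sub>R x) ` X i" using dil by (simp add: dilates_def)
  from bchoice[OF this] obtain c where "\<forall>i\<in>{1..m}. 0 < c i \<and> Y i = (\<lambda>x. c i *\<^sub>R x) ` X i" by blast
  then have c: "\<And>i. i \<in> {1..m} \<Longrightarrow> 0 < c i" "\<And>i. i \<in> {1..m} \<Longrightarrow> Y i = (\<lambda>x. c i *\<^sub>R x) ` X i"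
    by blast+
  define d where "d j = c (\<iota> j)" for j
  have vanish: "x \<bullet> e j = 0" if "i \<in> {1..m}" "x \<in> X i" "\<iota> j \<noteq> i" for i j x
    using uniq[OF that(1) \<iota>(1) _ \<iota>(2), of j] that by (auto simp: S_def)
  have DX: "diag_map e d ` X i = Y i" if i: "i \<in> {1..m}" for i
    unfolding c(2)[OF i]
  proof (rule image_cong)
    fix x assume x: "x \<in> X i"
    show "diag_map e d x = c i *\<^sub>R x"
    proof (rule orthonormal_eqI[OF e])
      fix j
      show "diag_map e d x \<bullet> e j = (c i *\<^sub>R x) \<bullet> e j"
        using vanish[OF i x, of j] by (cases "\<iota> j = i") (auto simp: diag_map_inner[OF e] d_def)
    qed
  qed simp
  have L: "L = diag_map e d ` K"
    unfolding KX LY by (subst linear_image_set_sum[OF linear_diag_map]) (simp_all add: DX)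
  have "level_split e d K"
    unfolding level_split_def
  proof (intro allI impI)
    fix x assume x: "\<forall>c. level_proj e d c x \<in> K"
    define s where "s i = frame_map e (\<chi> j. if \<iota> j = i then x \<bullet> e j else 0)" for i
    have s: "s i \<bullet> e j = (if \<iota> j = i then x \<bullet> e j else 0)" for i j
      by (simp add: s_def frame_map_inner[OF e])
    have "s i \<in> X i" if i: "i \<in> {1..m}" for i
    proof -
      \<comment> \<open>Several summands may share the factor \<open>c i\<close>, so this level can
        be larger than the coordinate set of \<open>X i\<close>. The component in \<open>X i\<close>
        of the decomposition still carries the coordinates of \<open>x\<close> that belong to
        \<open>i\<close>.\<close>
      have "level_proj e d (c i) x \<in> K" using x by blast
      then obtain k where k: "level_proj e d (c i) x = sum k {1..m}" "\<forall>l\<in>{1..m}. k l \<in> X l"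
        unfolding KX set_sum_alt[OF finite_atLeastAtMost] by blast
      have ki: "x \<bullet> e j = k i \<bullet> e j" if j: "\<iota> j = i" for j
      proof -
        have "x \<bullet> e j = (\<Sum>l=1..m. k l \<bullet> e j)"
          using arg_cong[OF k(1), of "\<lambda>v. v \<bullet> e j"] j by (simp add: level_proj_inner[OF e] d_def inner_sum_left)
        also have "\<dots> = (\<Sum>l=1..m. if l = i then k i \<bullet> e j else 0)"
          using k(2) vanish j by (intro sum.cong) auto
        also have "\<dots> = k i \<bullet> e j" using i by simp
        finally show ?thesis .
      qed
      show ?thesis
        by (rule dom[OF i, of "k i"]) (use k(2) i ki in \<open>auto simp: s\<close>)
    qed
    moreover have "x = sum s {1..m}"
    proof (rule orthonormal_eqI[OF e])
      fix j
      show "x \<bullet> e j = sum s {1..m} \<bullet> e j"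
        using \<iota>(1)[of j] by (simp add: inner_sum_left s)
    qed
    ultimately show "x \<in> K" unfolding KX set_sum_alt[OF finite_atLeastAtMost] by blast
  qed
  with L show ?thesis using c(1) \<iota>(1) that[of d] by (simp add: d_def)
qed

theorem proposition4:
  fixes e :: "'n::finite \<Rightarrow> real^'n"
    and K L :: "(real^'n) set"
    and t :: real
  assumes "orthonormal_basis e"
    and "convex_body K" and "unconditional e K"
    and "convex_body L" and "unconditional e L"
    and "0 < t" and "t < 1"
  shows "measure lebesgue (L0_sum t K L) = measure lebesgue K powr (1 - t) * measure lebesgue L powr t
    \<longleftrightarrow>
    (\<exists>m\<ge>1. \<exists>X Y :: nat \<Rightarrow> (real^'n) set.
       is_orthogonal_sum m X K \<and> is_orthogonal_sum m Y L \<and>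
       (\<forall>i\<in>{1..m}.
          compact (X i) \<and> convex (X i) \<and> unconditional e (X i) \<and> aff_dim (X i) \<ge> 1 \<and>
          compact (Y i) \<and> convex (Y i) \<and> unconditional e (Y i) \<and> aff_dim (Y i) \<ge> 1 \<and>
          dilates (X i) (Y i)) \<and>
       (\<Sum>i=1..m. aff_dim (X i)) = int CARD('n))"
    (is "?volume \<longleftrightarrow> ?decomposition")
proof
  note e = assms(1) and t = assms(6,7)
  have K: "unconditional_body e K" and L: "unconditional_body e L"
    using assms by (simp_all add: unconditional_body_def)
  {
    assume eq: ?volume
    obtain d where d: "\<And>i. 0 < d i" "L = diag_map e d ` K"
      using volume_equality_imp_diagonal[OF e K L t eq] by blast
    have "level_split e d K"
      by (rule diagonal_equality_imp_level_split[OF e K _ d(1) t]) (use L eq in \<open>simp_all add: d(2)\<close>)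
    from level_split_imp_orthogonal_decomposition[OF e K d(1) this] show ?decomposition
      unfolding d(2)[symmetric] .
  next
    assume ?decomposition
    then obtain m X Y where XY: "is_orthogonal_sum m X K" "is_orthogonal_sum m Y L" and
      i: "\<forall>i\<in>{1..m}. convex (X i) \<and> unconditional e (X i) \<and> aff_dim (X i) \<ge> 1 \<and> dilates (X i) (Y i)"
      by blast
    \<comment> \<open>Nonemptiness comes from the dimension bound, since the empty set has affine
      dimension -1.\<close>
    have "convex (X i) \<and> unconditional e (X i) \<and> X i \<noteq> {}" if "i \<in> {1..m}" for i
      using bspec[OF i that] by auto
    moreover have "dilates (X i) (Y i)" if "i \<in> {1..m}" for i using i that by blast
    ultimately obtain d where
      d: "\<And>i. 0 < d i" "L = diag_map e d ` K" "level_split e d K"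
      using orthogonal_decomposition_imp_level_split[OF e K XY] by blast
    show ?volume
      unfolding d(2) by (rule level_split_imp_diagonal_equality[OF e K _ d(1) t d(3)]) (use L in \<open>simp add: d(2)\<close>)
  }
qed

end
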